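(* For $n=1,2,\dots$ the number $\xi_n$ is the unique real solution $t$ of the equation $\kappa(t)=n$.
   Context: $\zeta$ is Riemann's zeta function; $\vartheta\colon\mathbf{R}\to\mathbf{R}$ is the Riemann–Siegel theta function, i.e. the real analytic function with $\vartheta(0)=0$ and $\Gamma(\frac14+\frac{it}{2})=|\Gamma(\frac14+\frac{it}{2})|\,e^{i(\vartheta(t)+\frac t2\log\pi)}$. The function $\kappa\colon\mathbf{R}\to\mathbf{R}$ is the unique real analytic function with $\kappa(0)=-\frac12$ and $e^{2\pi i\kappa(t)}=1+2\vartheta'(t)\frac{\zeta(1/2+it)}{\zeta'(1/2+it)}$ for all real $t$ (the quotient is extended analytically, with value $0$, at points where $\zeta'(\frac12+it)=0$; such points are zeros of $\zeta(\frac12+it)$). The sequence $0<\xi_1<\xi_2<\cdots$ enumerates in increasing order, without multiplicity, the set $\{t>0:\zeta(\frac12+it)=0\}$. No unproved hypothesis is assumed. *)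

theory Defs
  imports "HOL-Complex_Analysis.Complex_Analysis"
begin

text \<open>
  Riemann's zeta function is the analytic continuation of its Dirichlet series to the plane
  punctured at 1. The value at the pole is an arbitrary convention, fixed to 0 so that the
  description has exactly one solution.
\<close>

definition riemann_zeta :: "complex \<Rightarrow> complex" where
  "riemann_zeta = (THE f. f holomorphic_on (- {1}) \<and> f 1 = 0 \<and>
     (\<forall>s. Re s > 1 \<longrightarrow> (\<lambda>n. 1 / of_nat (Suc n) powr s) sums f s))"

definition real_analytic :: "(real \<Rightarrow> real) \<Rightarrow> bool" where
  "real_analytic f \<longleftrightarrow> (\<forall>x. \<exists>F. (\<lambda>h. f (x + h)) has_fps_expansion F)"

definition rs_theta :: "real \<Rightarrow> real" where
  "rs_theta = (THE \<theta>. real_analytic \<theta> \<and> \<theta> 0 = 0 \<and>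
     (\<forall>t. Gamma (Complex (1/4) (t/2)) =
          of_real (cmod (Gamma (Complex (1/4) (t/2)))) *
          exp (\<i> * of_real (\<theta> t + t / 2 * ln pi))))"

text \<open>
  Wherever the derivative of zeta vanishes on the critical line, the quotient of zeta by its
  derivative is to be extended analytically, with value 0; this is the value that division
  by zero yields.
\<close>

definition kappa :: "real \<Rightarrow> real" where
  "kappa = (THE \<kappa>. real_analytic \<kappa> \<and> \<kappa> 0 = - 1/2 \<and>
     (\<forall>t. exp (2 * of_real pi * \<i> * of_real (\<kappa> t)) =
          1 + 2 * of_real (deriv rs_theta t) *
              (riemann_zeta (Complex (1/2) t) / deriv riemann_zeta (Complex (1/2) t))))"

definition critical_ordinates :: "real set" where
  "critical_ordinates = {t. t > 0 \<and> riemann_zeta (Complex (1/2) t) = 0}"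

text \<open>
  The increasing enumeration, starting from index 1: the n-th ordinate is the one with
  exactly n ordinates up to and including itself. The library function \<open>enumerate\<close> is not
  available, since it requires a well-ordered type.
\<close>

definition xi :: "nat \<Rightarrow> real" where
  "xi n = (THE t. t \<in> critical_ordinates \<and> card {u \<in> critical_ordinates. u \<le> t} = n)"

end

theory Submission
  imports Defs "HOL-Probability.Probability" "HOL-Real_Asymp.Real_Asymp"
begin

text \<open>
  On the critical line $\zeta$ is a nowhere vanishing factor of phase $-\vartheta(t)$ times a real
  function $\Xi(t)$ (\<open>xi_line\<close> below), so that $\zeta'/\zeta = -\vartheta' - i W$ there with a real $W$
  (\<open>phase_d1\<close>). Hence $e^{2\pi i\kappa} = -\overline{(\vartheta' + i W)}/(\vartheta' + i W)$ has modulus 1, and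
  $\kappa$ is an integer exactly at the zeros of $\Xi$ and of $\vartheta'$. On $t \ge 0$ the latter is a
  single point $t_0 \approx 6.29$, below the first zero of $\Xi$. At a zero of $\Xi$ of order $n$ the derivative
  of $\kappa$ is $\vartheta'/(\pi n) > 0$, and at $t_0$ it is $\vartheta''/(\pi W)$, where $W > 0$ by a
  numerical estimate. So $\kappa$ crosses every integer upwards, hence at most once on $t \ge 0$; starting from
  $\kappa(0) = -1/2$ it reaches 0 at $t_0$ and then 1, 2, ... at the successive zeros, of which there are
  infinitely many by Hardy's theorem. The reflection $\kappa(-t) = -1 - \kappa(t)$ excludes negative $t$.
\<close>

text \<open>Zeta, \<vartheta>, \<open>kappa\<close> and \<open>xi\<close> are definite descriptions,
  so each needs an explicit witness and a uniqueness argument before anything can be computed. One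
  construction serves several ends: the Mellin transform of Jacobi's theta function continues zeta,
  its evenness makes Xi real, and moving the same integral off the real line gives Hardy's theorem.
  The delicate point is the sign of W at t_0. If W vanished there, zeta' would vanish at a point
  where zeta does not, and the defining equation of \<open>kappa\<close> would break down. If W were
  negative, \<open>kappa\<close> would fall from -1/2 to -1 at t_0 and the numbering of the zeros
  would shift by one. Now W = Im psi(1/4 + i t/2) / 2 + Xi'/Xi, where psi is the Digamma function,
  and the two terms are separated by the constant 0.815: the first is at least 0.815, the second
  exceeds -0.815. The second bound is the hard one, because Xi is a difference of two quantities of
  similar size, a theta integral and 1/(1/4 + t^2), so the kernel has to be enclosed tightly. As t_0
  is located only within (6.1, 6.4), the estimates are uniform on that interval.\<close>

section \<open>Poisson summation for Gaussians\<close>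

text \<open>Product formulas reduce cos^m y cos(j y) to cosines of multiples of y, so
  \<open>h\<close> is orthogonal to every polynomial in cos y. Weierstrass approximation of
  \<open>h\<close> composed with arccos on [-1,1] then makes the integral of h^2 arbitrarily small.
  This takes the place of convergence theory for Fourier series.\<close>

lemma cos_moments_zero:
  fixes h :: "real \<Rightarrow> real"
  assumes cont: "continuous_on {0..pi} h"
    and mom: "\<And>k::nat. integral {0..pi} (\<lambda>y. h y * cos (real k * y)) = 0"
    and y: "y \<in> {0..pi}"
  shows "h y = 0"
proof -
  have int [intro]: "f integrable_on {0..pi}" if "continuous_on {0..pi} f" for f :: "real \<Rightarrow> real"
    using that by (rule integrable_continuous_interval)
  have *: "integral {0..pi} (\<lambda>y. h y * (cos y ^ m * cos (real j * y))) = 0" for m j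
  proof (induction m arbitrary: j)
    case 0
    show ?case using mom[of j] by simp
  next
    case (Suc m)
    show ?case
    proof (cases j)
      case 0
      then show ?thesis using Suc.IH[of 1] by (simp add: mult_ac)
    next
      case (Suc i)
      have cc: "cos y * cos (real j * y) = (cos (real (i+2) * y) + cos (real i * y)) / 2" for y
      proof -
        have "y - real j * y = - (real i * y)" "y + real j * y = real (i+2) * y"
          by (simp_all add: Suc algebra_simps)
        thus ?thesis unfolding cos_times_cos by simp
      qed
      hence "integral {0..pi} (\<lambda>y. h y * (cos y ^ Suc m * cos (real j * y))) =
          integral {0..pi} (\<lambda>y. (1/2) * (h y * (cos y ^ m * cos (real (i+2) * y)))
             + (1/2) * (h y * (cos y ^ m * cos (real i * y))))"
      proof (intro integral_cong)
        fix y :: real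
        have alg: "p * q * ((A + B) / 2) = (1/2) * (p * (q * A)) + (1/2) * (p * (q * B))" for p q A B :: real
          by (simp add: field_simps)
        have "h y * (cos y ^ Suc m * cos (real j * y)) = h y * cos y ^ m * (cos y * cos (real j * y))"
          by (simp add: mult_ac)
        thus "h y * (cos y ^ Suc m * cos (real j * y)) = (1/2) * (h y * (cos y ^ m * cos (real (i+2) * y)))
             + (1/2) * (h y * (cos y ^ m * cos (real i * y)))"
          unfolding cc alg .
      qed
      also have "\<dots> = integral {0..pi} (\<lambda>y. (1/2) * (h y * (cos y ^ m * cos (real (i+2) * y))))
             + integral {0..pi} (\<lambda>y. (1/2) * (h y * (cos y ^ m * cos (real i * y))))"
        by (intro integral_add int continuous_intros cont)
      also have "\<dots> = 0"
        by (simp only: integral_mult_right Suc.IH)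
      finally show ?thesis .
    qed
  qed
  have **: "integral {0..pi} (\<lambda>y. h y * p (cos y)) = 0" if p: "real_polynomial_function p" for p
  proof -
    obtain a n where pe: "p = (\<lambda>x. \<Sum>i\<le>n. a i * x ^ i)"
      using p real_polynomial_function_iff_sum by metis
    have "integral {0..pi} (\<lambda>y. h y * p (cos y))
        = integral {0..pi} (\<lambda>y. \<Sum>i\<le>n. a i * (h y * (cos y ^ i * cos (real 0 * y))))"
      by (simp add: pe sum_distrib_left mult_ac)
    also have "\<dots> = (\<Sum>i\<le>n. integral {0..pi} (\<lambda>y. a i * (h y * (cos y ^ i * cos (real 0 * y)))))"
      by (intro integral_sum int continuous_intros cont) auto
    also have "\<dots> = 0"
      by (simp only: integral_mult_right *) simp
    finally show ?thesis .
  qed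
  define B where "B = integral {0..pi} (\<lambda>y. \<bar>h y\<bar>)"
  have B0: "B \<ge> 0" unfolding B_def by (intro integral_nonneg int continuous_intros cont) auto
  have small: "integral {0..pi} (\<lambda>y. h y * h y) \<le> e * B" if e: "e > 0" for e
  proof -
    have "continuous_on {-1..1} (\<lambda>x. h (arccos x))"
      by (intro continuous_on_compose2[OF cont] continuous_intros)
         (auto simp: arccos_lbound arccos_ubound)
    then obtain p where p: "real_polynomial_function p"
       "\<And>x. x \<in> {-1..1} \<Longrightarrow> \<bar>h (arccos x) - p x\<bar> < e"
      using Stone_Weierstrass_real_polynomial_function[of "{-1..1}" "\<lambda>x. h (arccos x)" e] e by auto
    have contp: "continuous_on A (\<lambda>y. p (cos y))" for A
    proof -
      obtain a n where "p = (\<lambda>x. \<Sum>i\<le>n. a i * x ^ i)"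
        using p(1) real_polynomial_function_iff_sum by metis
      thus ?thesis by (auto intro!: continuous_intros)
    qed
    have "integral {0..pi} (\<lambda>y. h y * h y) = integral {0..pi} (\<lambda>y. h y * (h y - p (cos y)) + h y * p (cos y))"
      by (simp add: algebra_simps)
    also have "\<dots> = integral {0..pi} (\<lambda>y. h y * (h y - p (cos y))) + integral {0..pi} (\<lambda>y. h y * p (cos y))"
      by (intro integral_add int continuous_intros cont contp)
    also have "\<dots> = integral {0..pi} (\<lambda>y. h y * (h y - p (cos y)))"
      by (simp only: **[OF p(1)])
    also have "\<dots> \<le> integral {0..pi} (\<lambda>y. e * \<bar>h y\<bar>)"
    proof (rule integral_le)
      fix y assume y: "y \<in> {0..pi}"
      have "\<bar>h y - p (cos y)\<bar> < e" using p(2)[of "cos y"] y by (simp add: arccos_cos)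
      hence "\<bar>h y\<bar> * \<bar>h y - p (cos y)\<bar> \<le> \<bar>h y\<bar> * e" by (intro mult_left_mono) auto
      thus "h y * (h y - p (cos y)) \<le> e * \<bar>h y\<bar>"
        using abs_ge_self[of "h y * (h y - p (cos y))"] unfolding abs_mult by (simp only: mult.commute)
    qed (auto intro!: int continuous_intros cont contp)
    finally show ?thesis by (simp add: B_def)
  qed
  have "integral {0..pi} (\<lambda>y. h y * h y) \<le> 0"
  proof (rule field_le_epsilon)
    fix e :: real assume "e > 0"
    hence "integral {0..pi} (\<lambda>y. h y * h y) \<le> e / (B + 1) * B" using B0 by (intro small) auto
    also have "\<dots> \<le> e" using B0 \<open>e > 0\<close> by (simp add: field_simps)
    finally show "integral {0..pi} (\<lambda>y. h y * h y) \<le> 0 + e" by simp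
  qed
  moreover have "integral {0..pi} (\<lambda>y. h y * h y) \<ge> 0"
    by (intro integral_nonneg int continuous_intros cont) auto
  ultimately have "integral {0..pi} (\<lambda>y. h y * h y) = 0" by simp
  hence "\<forall>x\<in>{0..pi}. h x * h x = 0"
    by (subst (asm) integral_eq_0_iff) (auto intro!: continuous_intros cont)
  thus ?thesis using y by auto
qed

text \<open>The characteristic function of the standard normal distribution, rescaled by sqrt (2
  a).\<close>

lemma gaussian_fourier:
  fixes a y :: real
  assumes a: "a > 0"
  shows "has_bochner_integral lborel (\<lambda>x. of_real (exp (-a * x\<^sup>2)) * exp (\<i> * of_real (x * y)))
           (complex_of_real (sqrt (pi / a) * exp (- y\<^sup>2 / (4 * a))))"
proof -
  define c where "c = sqrt (2 * a)"
  have c: "c > 0" "c\<^sup>2 = 2 * a" using a by (auto simp: c_def)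
  have "(\<integral>x. iexp (y / c * x) \<partial>std_normal_distribution) = exp (- ((y/c)^2) / 2)"
    using fun_cong[OF char_std_normal_distribution, of "y / c"] unfolding char_def by simp
  moreover have "integrable std_normal_distribution (\<lambda>x. iexp (y / c * x))"
    by (intro finite_measure.integrable_const_bound[where B=1] prob_space.finite_measure
         prob_space_normal_density) auto
  ultimately have "has_bochner_integral std_normal_distribution (\<lambda>x. iexp (y / c * x)) (of_real (exp (- ((y/c)^2) / 2)))"
    by (simp add: has_bochner_integral_iff exp_of_real[symmetric])
  hence "has_bochner_integral lborel (\<lambda>x. std_normal_density x *\<^sub>R iexp (y / c * x)) (of_real (exp (- ((y/c)^2) / 2)))"
    by (simp add: has_bochner_integral_iff integrable_density integral_density)
  hence "has_bochner_integral lborel (\<lambda>x. std_normal_density (0 + c * x) *\<^sub>R iexp (y / c * (0 + c * x)))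
       (of_real (exp (- ((y/c)^2) / 2)) /\<^sub>R \<bar>c\<bar>)"
    using c by (subst (asm) lborel_has_bochner_integral_real_affine_iff[where c = c and t = 0]) auto
  hence "has_bochner_integral lborel (\<lambda>x. sqrt (2 * pi) *\<^sub>R (std_normal_density (0 + c * x) *\<^sub>R iexp (y / c * (0 + c * x))))
       (sqrt (2 * pi) *\<^sub>R (of_real (exp (- ((y/c)^2) / 2)) /\<^sub>R \<bar>c\<bar>))"
    by (rule has_bochner_integral_scaleR_right)
  moreover have "sqrt (2 * pi) *\<^sub>R (std_normal_density (0 + c * x) *\<^sub>R iexp (y / c * (0 + c * x)))
      = of_real (exp (-a * x\<^sup>2)) * exp (\<i> * of_real (x * y))" for x
  proof -
    have "exp (- (c * x)\<^sup>2 / 2) = exp (- a * x\<^sup>2)" using c by (simp add: power_mult_distrib)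
    moreover have "y / c * (0 + c * x) = x * y" using c by simp
    ultimately show ?thesis unfolding std_normal_density_def
      by (simp add: scaleR_conv_of_real)
  qed
  moreover have "(sqrt (2 * pi) *\<^sub>R (of_real (exp (- ((y/c)^2) / 2)) /\<^sub>R \<bar>c\<bar>)) =
      complex_of_real (sqrt (pi / a) * exp (- y\<^sup>2 / (4 * a)))"
  proof -
    have "sqrt (2 * pi) / c = sqrt (pi / a)" using a unfolding c_def real_sqrt_divide[symmetric] by simp
    moreover have "- ((y/c)^2) / 2 = - y\<^sup>2 / (4 * a)" using c by (simp add: power_divide)
    moreover have "sqrt (2 * pi) *\<^sub>R (of_real e /\<^sub>R \<bar>c\<bar>) = complex_of_real (sqrt (2 * pi) / c * e)" for e
      using c by (simp add: scaleR_conv_of_real field_simps)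
    ultimately show ?thesis by (simp only:)
  qed
  ultimately show ?thesis by simp
qed

lemma gaussian_cos_half_line:
  fixes a k :: real
  assumes a: "a > 0"
  shows "set_integrable lborel {0..} (\<lambda>v. exp (- a * v\<^sup>2) * cos (k * v))"
    and "2 * (LINT v:{0..}|lborel. exp (- a * v\<^sup>2) * cos (k * v)) = sqrt (pi / a) * exp (- k\<^sup>2 / (4 * a))"
proof -
  let ?f = "\<lambda>v. exp (- a * v\<^sup>2) * cos (k * v)"
  have hb: "has_bochner_integral lborel ?f (sqrt (pi / a) * exp (- k\<^sup>2 / (4 * a)))"
    using has_bochner_integral_bounded_linear[OF bounded_linear_Re gaussian_fourier[OF a, of k]]
    by (simp add: Re_exp cos_of_real mult.commute)
  have int: "integrable lborel ?f" using hb by (auto simp: has_bochner_integral_iff)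
  show si: "set_integrable lborel {0..} ?f"
    using int unfolding set_integrable_def by (rule integrable_mult_indicator[rotated]) auto
  have si': "set_integrable lborel {..0} ?f"
    using int unfolding set_integrable_def by (rule integrable_mult_indicator[rotated]) auto
  have "(LINT v:{..0}|lborel. ?f v) = (LINT v:{0..}|lborel. ?f v)"
    unfolding set_lebesgue_integral_def
    by (subst lborel_integral_real_affine[where c = "-1" and t = 0])
       (auto intro!: Bochner_Integration.integral_cong simp: indicator_def)
  moreover have "(LINT v|lborel. ?f v) = (LINT v:{..0} \<union> {0..}|lborel. ?f v)"
    unfolding set_lebesgue_integral_def
    by (intro Bochner_Integration.integral_cong) (auto simp: indicator_def)
  moreover have "\<dots> = (LINT v:{..0}|lborel. ?f v) + (LINT v:{0..}|lborel. ?f v)"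
  proof (rule set_integral_Un_AE)
    have "AE v in lborel. v \<noteq> (0::real)" by (rule AE_lborel_singleton)
    thus "AE v in lborel. \<not> (v \<in> {..0} \<and> v \<in> {0::real..})" by eventually_elim auto
  qed (use si si' in auto)
  ultimately show "2 * (LINT v:{0..}|lborel. ?f v) = sqrt (pi / a) * exp (- k\<^sup>2 / (4 * a))"
    using hb by (simp add: has_bochner_integral_iff)
qed

text \<open>Unfolds a pair of reflected summands into one full period. With c a multiple of 2 pi it
  turns moments of the periodised Gaussian into integrals over adjacent intervals.\<close>

lemma integral_reflect_pair:
  fixes f :: "real \<Rightarrow> real"
  assumes cont: "continuous_on UNIV f" and r: "r \<ge> 0"
  shows "integral {0..r} (\<lambda>y. f (c + y) + f (c - y)) = integral {c-r..c+r} f"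
proof -
  obtain P where P: "\<And>x. x \<in> {c-r-1..c+r+1} \<Longrightarrow> (P has_vector_derivative f x) (at x within {c-r-1..c+r+1})"
    using antiderivative_continuous[OF continuous_on_subset[OF cont, of "{c-r-1..c+r+1}"]] by auto
  have P': "(P has_real_derivative f x) (at x)" if "x \<in> {c-r..c+r}" for x
    using P[of x] that by (simp add: has_real_derivative_iff_has_vector_derivative at_within_Icc_at)
  have "((\<lambda>y. f (c + y) + f (c - y)) has_integral
       ((P (c + r) - P (c - r)) - (P (c + 0) - P (c - 0)))) {0..r}"
  proof (rule fundamental_theorem_of_calculus[OF r])
    fix x assume x: "x \<in> {0..r}"
    have 1: "((\<lambda>y. P (c + y)) has_real_derivative f (c + x)) (at x)"
    proof -
      have "((\<lambda>y. P (c + y)) has_real_derivative f (c + x) * 1) (at x)"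
        by (rule DERIV_chain2[where f = P, OF P']) (use x in \<open>auto intro!: derivative_eq_intros\<close>)
      thus ?thesis by simp
    qed
    have 2: "((\<lambda>y. P (c - y)) has_real_derivative f (c - x) * (-1)) (at x)"
      by (rule DERIV_chain2[where f = P, OF P']) (use x in \<open>auto intro!: derivative_eq_intros\<close>)
    have "((\<lambda>y. P (c + y) - P (c - y)) has_real_derivative f (c + x) + f (c - x)) (at x)"
      using DERIV_diff[OF 1 2] by simp
    thus "((\<lambda>y. P (c + y) - P (c - y)) has_vector_derivative f (c + x) + f (c - x)) (at x within {0..r})"
      by (simp add: has_real_derivative_iff_has_vector_derivative has_vector_derivative_at_within)
  qed
  hence 1: "integral {0..r} (\<lambda>y. f (c + y) + f (c - y)) = P (c + r) - P (c - r)" by (simp add: integral_unique)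
  have "(f has_integral (P (c + r) - P (c - r))) {c-r..c+r}"
    by (rule fundamental_theorem_of_calculus)
       (use r P' in \<open>auto simp: has_real_derivative_iff_has_vector_derivative intro: has_vector_derivative_at_within\<close>)
  with 1 show ?thesis by (simp add: integral_unique)
qed

text \<open>Termwise integration by uniform convergence. The majorant is geometric because both the
  periodised Gaussian and its cosine series have one.\<close>

lemma geometric_series_cos_integral:
  fixes u :: "nat \<Rightarrow> real \<Rightarrow> real"
  assumes cont: "\<And>n. continuous_on {0..pi} (u n)"
    and bnd: "\<And>n y. y \<in> {0..pi} \<Longrightarrow> \<bar>u n y\<bar> \<le> M * r ^ n" and r: "0 \<le> r" "r < 1"
  shows "continuous_on {0..pi} (\<lambda>y. \<Sum>n. u n y)"
    and "(\<lambda>n. integral {0..pi} (\<lambda>y. u n y * cos (k * y))) sums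
           integral {0..pi} (\<lambda>y. (\<Sum>n. u n y) * cos (k * y))"
proof -
  have sm: "summable (\<lambda>n. M * r ^ n)" using r by (intro summable_mult summable_geometric) auto
  have lim: "uniform_limit {0..pi} (\<lambda>n y. \<Sum>i<n. u i y) (\<lambda>y. \<Sum>n. u n y) sequentially"
    by (rule Weierstrass_m_test[OF _ sm]) (use bnd in auto)
  show "continuous_on {0..pi} (\<lambda>y. \<Sum>n. u n y)"
    by (rule uniform_limit_theorem[OF _ lim]) (auto intro!: always_eventually continuous_intros cont)
  have sm1: "summable (\<lambda>n. u n y)" if "y \<in> {0..pi}" for y
    by (rule summable_comparison_test[OF _ sm]) (use bnd that in auto)
  have lim': "uniform_limit {0..pi} (\<lambda>n y. \<Sum>i<n. u i y * cos (k * y)) (\<lambda>y. \<Sum>n. u n y * cos (k * y)) sequentially"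
  proof (rule Weierstrass_m_test[OF _ sm])
    fix n y assume y: "y \<in> {0..pi}"
    have "\<bar>u n y\<bar> * \<bar>cos (k * y)\<bar> \<le> (M * r ^ n) * 1"
      using order_trans[OF abs_ge_zero bnd[OF y, of n]] by (intro mult_mono bnd y) auto
    thus "norm (u n y * cos (k * y)) \<le> M * r ^ n" by (simp add: abs_mult)
  qed
  obtain I J where IJ: "\<And>n. ((\<lambda>y. \<Sum>i<n. u i y * cos (k * y)) has_integral I n) {0..pi}"
      "((\<lambda>y. \<Sum>n. u n y * cos (k * y)) has_integral J) {0..pi}" "I \<longlonglongrightarrow> J"
    by (rule uniform_limit_integral[OF lim']) (auto intro!: continuous_intros cont)
  have "I = (\<lambda>n. \<Sum>i<n. integral {0..pi} (\<lambda>y. u i y * cos (k * y)))"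
  proof
    fix n
    show "I n = (\<Sum>i<n. integral {0..pi} (\<lambda>y. u i y * cos (k * y)))"
    using integral_unique[OF IJ(1)[of n]]
    by (subst (asm) integral_sum) (auto intro!: integrable_continuous_interval continuous_intros cont)
  qed
  moreover have "J = integral {0..pi} (\<lambda>y. (\<Sum>n. u n y) * cos (k * y))"
    unfolding integral_unique[OF IJ(2), symmetric]
    by (intro integral_cong) (use sm1 in \<open>auto simp: suminf_mult2\<close>)
  ultimately show "(\<lambda>n. integral {0..pi} (\<lambda>y. u n y * cos (k * y))) sums
           integral {0..pi} (\<lambda>y. (\<Sum>n. u n y) * cos (k * y))"
    using IJ(3) unfolding sums_def by simp
qed

lemma integral_cos_nat:
  "integral {0..pi} (\<lambda>y. cos (real k * y)) = (if k = 0 then pi else 0)"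
proof (cases "k = 0")
  case False
  have "((\<lambda>y. cos (real k * y)) has_integral (sin (real k * pi) / real k - sin (real k * 0) / real k)) {0..pi}"
    by (rule fundamental_theorem_of_calculus)
       (use False in \<open>auto intro!: derivative_eq_intros simp: has_real_derivative_iff_has_vector_derivative[symmetric]\<close>)
  thus ?thesis using False by (simp add: integral_unique)
qed auto

lemma integral_cos_cos_nat:
  assumes "j > 0"
  shows "integral {0..pi} (\<lambda>y. cos (real j * y) * cos (real k * y)) = (if j = k then pi / 2 else 0)"
proof -
  define d where "d = (if j \<le> k then k - j else j - k)"
  have "cos (real j * y) * cos (real k * y) = (1/2) * cos (real d * y) + (1/2) * cos (real (j + k) * y)" for y
  proof -
    have "cos (real j * y - real k * y) = cos (real d * y)"
    proof (cases "j \<le> k")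
      case True
      hence "real j * y - real k * y = - (real d * y)" by (simp add: d_def of_nat_diff left_diff_distrib)
      thus ?thesis by simp
    qed (simp add: d_def of_nat_diff left_diff_distrib)
    moreover have "real j * y + real k * y = real (j + k) * y" by (simp add: distrib_right)
    ultimately show ?thesis unfolding cos_times_cos by simp
  qed
  hence "integral {0..pi} (\<lambda>y. cos (real j * y) * cos (real k * y)) =
     integral {0..pi} (\<lambda>y. (1/2) * cos (real d * y)) + integral {0..pi} (\<lambda>y. (1/2) * cos (real (j + k) * y))"
    by (simp only:) (intro integral_add integrable_continuous_interval continuous_intros)
  also have "\<dots> = (if j = k then pi / 2 else 0)"
    unfolding integral_mult_right integral_cos_nat using assms by (auto simp: d_def)
  finally show ?thesis .
qed

text \<open>The 2 pi-periodised Gaussian and its cosine series have the same cosine moments on a half period.\<close>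

lemma gaussian_poisson:
  fixes a :: real
  assumes a: "a > 0"
  shows "1 + 2 * (\<Sum>n. exp (- 4 * pi\<^sup>2 * a * real (Suc n) ^ 2)) =
         (1 + 2 * (\<Sum>n. exp (- (real (Suc n) ^ 2) / (4 * a)))) / (2 * sqrt (pi * a))"
proof -
  define G where "G = (\<lambda>v::real. exp (- a * v\<^sup>2))"
  have contG [continuous_intros]: "continuous_on A (\<lambda>x. G (f x))" if "continuous_on A f" for A :: "real set" and f
    unfolding G_def by (intro continuous_intros that)
  \<comment> \<open>The summands of index n and -n of the periodisation are paired, so that
    everything happens on \<open>{0..pi}\<close>; index 0 stands alone.\<close>
  define u where "u = (\<lambda>n y. if n = 0 then G y else G (2 * pi * real n + y) + G (2 * pi * real n - y))"
  define q where "q = exp (- a * pi\<^sup>2)"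
  have q: "0 \<le> q" "q < 1" using a by (auto simp: q_def)
  have Gb: "G v \<le> q ^ n" if "v \<ge> pi * real n" for v n
  proof -
    have "0 \<le> pi * real n" by simp
    hence "pi * real n * (pi * real n) \<le> v * v" using that by (intro mult_mono) linarith+
    moreover have "real n * (pi * pi) \<le> real (n * n) * (pi * pi)"
      by (intro mult_right_mono) (auto simp del: of_nat_mult simp: le_square)
    moreover have "real (n * n) * (pi * pi) = pi * real n * (pi * real n)" by simp
    ultimately have "real n * pi\<^sup>2 \<le> v\<^sup>2" unfolding power2_eq_square by linarith
    hence "a * (real n * pi\<^sup>2) \<le> a * v\<^sup>2" using a by (intro mult_left_mono) auto
    thus ?thesis by (simp add: G_def q_def exp_of_nat_mult[symmetric] mult_ac)
  qed
  have Gpos: "G v \<ge> 0" for v by (simp add: G_def)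
  have ub: "\<bar>u n y\<bar> \<le> 2 * q ^ n" if "y \<in> {0..pi}" for n y
  proof (cases n)
    case 0
    then show ?thesis using that a Gpos[of y] by (auto simp: u_def G_def)
         (smt (verit) mult_nonneg_nonneg exp_le_one_iff zero_le_power2)
  next
    case (Suc m)
    have "pi * real n \<ge> 0" by simp
    moreover have "pi * real n \<ge> pi" using Suc by simp
    ultimately have "pi * real n \<le> 2 * pi * real n - y" "pi * real n \<le> 2 * pi * real n + y"
      using that unfolding mult.assoc atLeastAtMost_iff by linarith+
    thus ?thesis using Gb[of n "2 * pi * real n - y"] Gb[of n "2 * pi * real n + y"] Gpos Suc
      by (auto simp: u_def)
  qed
  have uc: "continuous_on {0..pi} (u n)" for n
    unfolding u_def by (cases n) (auto intro!: continuous_intros)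
  note S1 = geometric_series_cos_integral[OF uc ub q]
  \<comment> \<open>Half of the Fourier integral of the Gaussian at frequency k, that is, its cosine
    moment over the half line.\<close>
  define C where "C = (\<lambda>k. sqrt (pi / a) * exp (- (real k)\<^sup>2 / (4 * a)) / 2)"
  \<comment> \<open>Summand n unfolds to the interval from (2n-1) pi to (2n+1) pi, so the first N+1
    summands cover \<open>{0..(2 * real N + 1) * pi}\<close> without gaps.\<close>
  have part: "(\<Sum>n<Suc N. integral {0..pi} (\<lambda>y. u n y * cos (real k * y))) =
      integral {0..(2 * real N + 1) * pi} (\<lambda>v. G v * cos (real k * v))" for N k
  proof (induction N)
    case 0
    show ?case by (simp add: u_def)
  next
    case (Suc N)
    let ?c = "2 * pi * real (Suc N)" and ?f = "\<lambda>v. G v * cos (real k * v)"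
    have per: "cos (real k * (?c + y)) = cos (real k * y)" "cos (real k * (?c - y)) = cos (real k * y)" for y
    proof -
      have "real k * (?c + y) = real k * y + real (k * Suc N) * (2 * pi)"
           "real k * (?c - y) = - (real k * y) + real (k * Suc N) * (2 * pi)"
        by (auto simp: algebra_simps)
      thus "cos (real k * (?c + y)) = cos (real k * y)" "cos (real k * (?c - y)) = cos (real k * y)"
        using cos.plus_of_nat[of "real k * y" "k * Suc N"] cos.plus_of_nat[of "- (real k * y)" "k * Suc N"]
        by (simp_all only: of_real_eq_id id_apply cos_minus)
    qed
    have "integral {0..pi} (\<lambda>y. u (Suc N) y * cos (real k * y)) = integral {0..pi} (\<lambda>y. ?f (?c + y) + ?f (?c - y))"
      unfolding per by (simp add: u_def algebra_simps)
    also have "\<dots> = integral {?c - pi..?c + pi} ?f"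
      by (rule integral_reflect_pair) (auto intro!: continuous_intros)
    also have "\<dots> = integral {(2 * real N + 1) * pi..(2 * real (Suc N) + 1) * pi} ?f"
      by (simp add: algebra_simps)
    finally show ?case unfolding sum.lessThan_Suc[of _ "Suc N"] Suc.IH
      by (subst Henstock_Kurzweil_Integration.integral_combine[symmetric, of 0 "(2 * real N + 1) * pi"])
         (auto intro!: integrable_continuous_interval continuous_intros simp: algebra_simps)
  qed
  have lim: "(\<lambda>N. integral {0..(2 * real N + 1) * pi} (\<lambda>v. G v * cos (real k * v))) \<longlonglongrightarrow> C k" for k
  proof -
    have "((\<lambda>b. LINT v:{0..b}|lborel. G v * cos (real k * v)) \<longlongrightarrow> (LINT v:{0..}|lborel. G v * cos (real k * v))) at_top"
      unfolding G_def by (intro tendsto_set_lebesgue_integral_at_top gaussian_cos_half_line a) auto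
    also have "(LINT v:{0..}|lborel. G v * cos (real k * v)) = C k"
      using gaussian_cos_half_line(2)[OF a, of "real k"] by (simp add: C_def G_def)
    finally have "(\<lambda>N. LINT v:{0..(2 * real N + 1) * pi}|lborel. G v * cos (real k * v)) \<longlonglongrightarrow> C k"
      by (rule filterlim_compose) real_asymp
    moreover have "(LINT v:{0..b}|lborel. G v * cos (real k * v)) = integral {0..b} (\<lambda>v. G v * cos (real k * v))" for b
      by (intro set_borel_integral_eq_integral borel_integrable_atLeastAtMost')
         (auto intro!: continuous_intros)
    ultimately show ?thesis by simp
  qed
  have m1: "integral {0..pi} (\<lambda>y. (\<Sum>n. u n y) * cos (real k * y)) = C k" for k
  proof (rule LIMSEQ_unique)
    show "(\<lambda>N. \<Sum>n<Suc N. integral {0..pi} (\<lambda>y. u n y * cos (real k * y))) \<longlonglongrightarrow>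
        integral {0..pi} (\<lambda>y. (\<Sum>n. u n y) * cos (real k * y))"
      using S1(2)[of "real k"] unfolding sums_def by (rule LIMSEQ_Suc)
    show "(\<lambda>N. \<Sum>n<Suc N. integral {0..pi} (\<lambda>y. u n y * cos (real k * y))) \<longlonglongrightarrow> C k"
      unfolding part by (rule lim)
  qed
  \<comment> \<open>The cosine series whose k-th moment is \<open>C k\<close>. The squared norm is
    pi for frequency 0 and pi/2 for the others, hence the case distinction.\<close>
  define w where "w = (\<lambda>n y. if n = 0 then C 0 / pi else 2 * C n / pi * cos (real n * y))"
  define p where "p = exp (- 1 / (4 * a))"
  have p: "0 \<le> p" "p < 1" using a by (auto simp: p_def)
  have Cb: "C n \<le> sqrt (pi / a) / 2 * p ^ n" "C n \<ge> 0" for n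
  proof -
    have "real n \<le> (real n)\<^sup>2" by (cases n) (auto simp: power2_eq_square)
    hence "- (real n)\<^sup>2 / (4 * a) \<le> real n * (- 1 / (4 * a))" using a by (simp add: field_simps)
    thus "C n \<le> sqrt (pi / a) / 2 * p ^ n"
      using a by (simp add: C_def p_def exp_of_nat_mult[symmetric] mult_left_mono del: exp_le_cancel_iff)
        (auto intro!: divide_right_mono mult_left_mono)
    show "C n \<ge> 0" using a by (simp add: C_def)
  qed
  have wb: "\<bar>w n y\<bar> \<le> sqrt (pi / a) / pi * p ^ n" if "y \<in> {0..pi}" for n y
  proof -
    have "\<bar>w n y\<bar> \<le> 2 * C n / pi * 1"
      unfolding w_def using Cb(2)[of n]
      by (auto simp: abs_mult intro!: divide_right_mono mult_left_le)
    also have "\<dots> \<le> 2 * (sqrt (pi / a) / 2 * p ^ n) / pi * 1"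
      by (intro mult_right_mono divide_right_mono mult_left_mono Cb) auto
    finally show ?thesis by (simp add: mult_ac)
  qed
  have wc: "continuous_on {0..pi} (w n)" for n
    unfolding w_def by (cases n) (auto intro!: continuous_intros)
  note S2 = geometric_series_cos_integral[OF wc wb p]
  have "integral {0..pi} (\<lambda>y. w n y * cos (real k * y)) = (if n = k then C k else 0)" for n k
  proof (cases "n = 0")
    case True
    thus ?thesis by (simp add: w_def integral_cos_nat)
  next
    case False
    hence "integral {0..pi} (\<lambda>y. w n y * cos (real k * y)) =
       integral {0..pi} (\<lambda>y. (2 * C n / pi) * (cos (real n * y) * cos (real k * y)))"
      by (simp add: w_def mult_ac)
    also have "\<dots> = (if n = k then C k else 0)"
      unfolding integral_mult_right using False by (subst integral_cos_cos_nat) auto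
    finally show ?thesis .
  qed
  hence m2: "integral {0..pi} (\<lambda>y. (\<Sum>n. w n y) * cos (real k * y)) = C k" for k
    using sums_unique2[OF S2(2)[of "real k"]] sums_single[of k "\<lambda>_. C k"] by simp
  have S1c: "continuous_on {0..pi} (\<lambda>y. \<Sum>n. u n y)" by (rule S1(1))
  have S2c: "continuous_on {0..pi} (\<lambda>y. \<Sum>n. w n y)" by (rule S2(1))
  \<comment> \<open>Poisson summation is the equality of the two functions at y = 0.\<close>
  have eq: "(\<Sum>n. u n 0) - (\<Sum>n. w n 0) = 0"
  proof (rule cos_moments_zero[where h = "\<lambda>y. (\<Sum>n. u n y) - (\<Sum>n. w n y)"])
    show "continuous_on {0..pi} (\<lambda>y. (\<Sum>n. u n y) - (\<Sum>n. w n y))"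
      by (rule continuous_on_diff[OF S1c S2c])
    fix k :: nat
    have "integral {0..pi} (\<lambda>y. ((\<Sum>n. u n y) - (\<Sum>n. w n y)) * cos (real k * y)) =
        integral {0..pi} (\<lambda>y. (\<Sum>n. u n y) * cos (real k * y)) - integral {0..pi} (\<lambda>y. (\<Sum>n. w n y) * cos (real k * y))"
      unfolding left_diff_distrib
      by (intro integral_diff integrable_continuous_interval continuous_on_mult S1c S2c continuous_intros)
    thus "integral {0..pi} (\<lambda>y. ((\<Sum>n. u n y) - (\<Sum>n. w n y)) * cos (real k * y)) = 0"
      by (simp only: m1 m2)
  qed auto
  define A where "A = (\<lambda>n. exp (- 4 * pi\<^sup>2 * a * real (Suc n) ^ 2))"
  define B where "B = (\<lambda>n. exp (- (real (Suc n) ^ 2) / (4 * a)))"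
  have smu: "summable (\<lambda>n. u n 0)"
    by (rule summable_comparison_test[OF _ summable_mult[OF summable_geometric, of q 2]]) (use ub q in auto)
  have smw: "summable (\<lambda>n. w n 0)"
    by (rule summable_comparison_test[OF _ summable_mult[OF summable_geometric, of p "sqrt (pi / a) / pi"]]) (use wb p in auto)
  have uS: "u (Suc n) 0 = 2 * A n" for n by (simp add: u_def G_def A_def power2_eq_square algebra_simps)
  have wS: "w (Suc n) 0 = sqrt (pi / a) / pi * B n" for n by (simp add: w_def C_def B_def)
  have "(\<Sum>n. u n 0) = u 0 0 + (\<Sum>n. u (Suc n) 0)" using suminf_split_head[OF smu] by simp
  also have "summable (\<lambda>n. 2 * A n)" using smu by (subst (asm) summable_Suc_iff[symmetric]) (simp add: uS)
  hence "(\<Sum>n. u (Suc n) 0) = 2 * (\<Sum>n. A n)"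
    unfolding uS by (subst suminf_mult) (auto intro: summable_mult_D)
  finally have 1: "(\<Sum>n. u n 0) = 1 + 2 * (\<Sum>n. A n)" by (simp add: u_def G_def)
  have "(\<Sum>n. w n 0) = w 0 0 + (\<Sum>n. w (Suc n) 0)" using suminf_split_head[OF smw] by simp
  also have "summable (\<lambda>n. sqrt (pi / a) / pi * B n)"
    using smw by (subst (asm) summable_Suc_iff[symmetric]) (simp only: wS)
  hence "(\<Sum>n. w (Suc n) 0) = sqrt (pi / a) / pi * (\<Sum>n. B n)"
    unfolding wS using a by (subst suminf_mult) (auto intro: summable_mult_D)
  finally have 2: "(\<Sum>n. w n 0) = sqrt (pi / a) / pi * (1 + 2 * (\<Sum>n. B n)) / 2"
    by (simp add: w_def C_def field_simps)
  have "sqrt (pi / a) / pi = sqrt (pi / a / pi\<^sup>2)" by (simp add: real_sqrt_divide real_sqrt_mult)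
  also have "pi / a / pi\<^sup>2 = 1 / (pi * a)" by (simp add: power2_eq_square)
  also have "sqrt \<dots> = 1 / sqrt (pi * a)" by (simp add: real_sqrt_divide)
  finally have 3: "sqrt (pi / a) / pi = 1 / sqrt (pi * a)" .
  show ?thesis
    using eq unfolding 1 2 3 A_def B_def by simp
qed

section \<open>The theta function\<close>

text \<open>The part n >= 1 of Jacobi's theta series, the sum of exp (- pi n^2 w) over all integers
  n, which equals \<open>1 + 2 * theta_tail w\<close>.\<close>

definition theta_tail :: "complex \<Rightarrow> complex" where
  "theta_tail w = (\<Sum>n. exp (- of_real (pi * real (Suc n) ^ 2) * w))"

text \<open>From (n+1)^2 >= 1 + n. The factor in front keeps the decay in \<open>Re w\<close>, while
  the ratio depends only on \<delta>, so the bound is uniform on the half-plane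
  \<open>Re w \<ge> \<delta>\<close>.\<close>

lemma theta_term_bound:
  assumes "\<delta> \<ge> 0" "Re w \<ge> \<delta>"
  shows "norm (exp (- of_real (pi * real (Suc n) ^ 2) * w)) \<le> exp (- pi * Re w) * exp (- pi * \<delta>) ^ n"
proof -
  have "real n \<le> real (Suc n) ^ 2 - 1" by (simp add: power2_eq_square algebra_simps)
  hence "real n * \<delta> \<le> (real (Suc n) ^ 2 - 1) * \<delta>" using assms by (intro mult_right_mono) auto
  also have "\<dots> \<le> (real (Suc n) ^ 2 - 1) * Re w" using assms by (intro mult_left_mono) auto
  finally have "pi * (real n * \<delta>) \<le> pi * ((real (Suc n) ^ 2 - 1) * Re w)" by (intro mult_left_mono) auto
  hence "- (pi * real (Suc n) ^ 2 * Re w) \<le> - pi * Re w + real n * (- pi * \<delta>)" by (simp add: algebra_simps)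
  hence "exp (- (pi * real (Suc n) ^ 2 * Re w)) \<le> exp (- pi * Re w + real n * (- pi * \<delta>))"
    by (simp only: exp_le_cancel_iff)
  also have "\<dots> = exp (- pi * Re w) * exp (- pi * \<delta>) ^ n" by (simp only: exp_add exp_of_nat_mult)
  finally show ?thesis by (simp only: norm_exp_eq_Re mult_minus_left uminus_complex.sel Re_complex_of_real times_complex.sel Im_complex_of_real) simp
qed

lemma theta_tail_summable:
  assumes "Re w > 0"
  shows "summable (\<lambda>n. norm (exp (- of_real (pi * real (Suc n) ^ 2) * w)))"
proof (rule summable_comparison_test)
  show "summable (\<lambda>n. exp (- pi * Re w) * exp (- pi * Re w) ^ n)"
    using assms by (intro summable_mult summable_geometric) auto
  show "\<exists>N. \<forall>n\<ge>N. norm (norm (exp (- of_real (pi * real (Suc n) ^ 2) * w))) \<le> exp (- pi * Re w) * exp (- pi * Re w) ^ n"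
    unfolding real_norm_def abs_norm_cancel by (intro exI[of _ 0] allI impI theta_term_bound) (use assms in auto)
qed

lemma theta_tail_norm_le:
  assumes "\<delta> > 0" "Re w \<ge> \<delta>"
  shows "norm (theta_tail w) \<le> exp (- pi * Re w) / (1 - exp (- pi * \<delta>))"
proof -
  have s: "(\<lambda>n. exp (- pi * Re w) * exp (- pi * \<delta>) ^ n) sums (exp (- pi * Re w) * (1 / (1 - exp (- pi * \<delta>))))"
    using assms by (intro sums_mult geometric_sums) auto
  have w: "Re w > 0" using assms by auto
  have "norm (theta_tail w) \<le> (\<Sum>n. norm (exp (- of_real (pi * real (Suc n) ^ 2) * w)))"
    unfolding theta_tail_def by (rule summable_norm[OF theta_tail_summable[OF w]])
  also have "\<dots> \<le> (\<Sum>n. exp (- pi * Re w) * exp (- pi * \<delta>) ^ n)"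
    by (rule suminf_le[OF theta_term_bound theta_tail_summable[OF w] sums_summable[OF s]]) (use assms in auto)
  finally show ?thesis using sums_unique[OF s] by simp
qed

lemma theta_tail_holomorphic: "theta_tail holomorphic_on {w. Re w > 0}"
proof (rule holomorphic_uniform_sequence[where f = "\<lambda>N w. \<Sum>n<N. exp (- of_real (pi * real (Suc n) ^ 2) * w)"])
  show "open {w. Re w > 0}" by (rule open_halfspace_Re_gt)
  fix w assume w: "w \<in> {w. Re w > 0}"
  define d where "d = Re w / 2"
  have d: "d > 0" using w by (simp add: d_def)
  have Re: "Re z \<ge> d" if "z \<in> cball w d" for z
    using that abs_Re_le_cmod[of "w - z"] by (simp add: dist_norm d_def)
  have "uniform_limit (cball w d) (\<lambda>N w. \<Sum>n<N. exp (- of_real (pi * real (Suc n) ^ 2) * w))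
          (\<lambda>w. \<Sum>n. exp (- of_real (pi * real (Suc n) ^ 2) * w)) sequentially"
  proof (rule Weierstrass_m_test)
    fix n z assume z: "z \<in> cball w d"
    have "norm (exp (- of_real (pi * real (Suc n) ^ 2) * z)) \<le> exp (- pi * Re z) * exp (- pi * d) ^ n"
      by (rule theta_term_bound) (use d Re z in auto)
    also have "\<dots> \<le> 1 * exp (- pi * d) ^ n" using Re[OF z] d by (intro mult_right_mono) auto
    finally show "norm (exp (- of_real (pi * real (Suc n) ^ 2) * z)) \<le> exp (- pi * d) ^ n" by simp
  qed (use d in \<open>auto intro: summable_geometric\<close>)
  moreover have "cball w d \<subseteq> {w. Re w > 0}" using Re d by force
  ultimately show "\<exists>d>0. cball w d \<subseteq> {w. Re w > 0} \<and>
      uniform_limit (cball w d) (\<lambda>N w. \<Sum>n<N. exp (- of_real (pi * real (Suc n) ^ 2) * w)) theta_tail sequentially"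
    using d unfolding theta_tail_def[abs_def] by blast
qed (intro holomorphic_intros)

lemma theta_tail_of_real:
  assumes "x > 0"
  shows "theta_tail (of_real x) = of_real (\<Sum>n. exp (- pi * real (Suc n) ^ 2 * x))"
    and "summable (\<lambda>n. exp (- pi * real (Suc n) ^ 2 * x))"
proof -
  have eq: "exp (- of_real (pi * real (Suc n) ^ 2) * complex_of_real x) = of_real (exp (- pi * real (Suc n) ^ 2 * x))" for n
    by (simp add: exp_of_real[symmetric])
  have "summable (\<lambda>n. norm (exp (- of_real (pi * real (Suc n) ^ 2) * complex_of_real x)))"
    using assms by (intro theta_tail_summable) auto
  thus sm: "summable (\<lambda>n. exp (- pi * real (Suc n) ^ 2 * x))" unfolding eq by simp
  show "theta_tail (of_real x) = of_real (\<Sum>n. exp (- pi * real (Suc n) ^ 2 * x))"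
    unfolding theta_tail_def eq by (rule suminf_of_real[symmetric, OF sm])
qed

text \<open>Poisson summation proves it on the positive reals, and the identity theorem carries it
  to the right half-plane, where the principal branch of the square root is holomorphic.\<close>

lemma theta_functional_equation:
  assumes "Re w > 0"
  shows "1 + 2 * theta_tail (1 / w) = csqrt w * (1 + 2 * theta_tail w)"
proof -
  let ?S = "{w::complex. Re w > 0}"
  let ?f = "\<lambda>w. 1 + 2 * theta_tail (1 / w) - csqrt w * (1 + 2 * theta_tail w)"
  have Re_inv: "Re (1 / w) > 0" if "Re w > 0" for w :: complex
    using that by (auto simp: Re_divide intro!: divide_pos_pos add_pos_nonneg)
  have "?f w = 0"
  proof (rule analytic_continuation[of ?f ?S "complex_of_real ` {0<..}" 1])
    have "(\<lambda>w. theta_tail (1 / w)) holomorphic_on ?S"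
      by (rule holomorphic_on_compose_gen[unfolded o_def, OF _ theta_tail_holomorphic])
         (auto intro!: holomorphic_intros Re_inv)
    moreover have "csqrt holomorphic_on ?S"
      by (rule holomorphic_on_subset[OF holomorphic_on_csqrt]) (auto simp: complex_nonpos_Reals_iff)
    ultimately show "?f holomorphic_on ?S"
      by (intro holomorphic_on_diff holomorphic_on_mult holomorphic_on_add holomorphic_on_const theta_tail_holomorphic)
    show "open ?S" by (rule open_halfspace_Re_gt)
    show "connected ?S" by (intro convex_connected convex_halfspace_Re_gt)
    show "1 islimpt complex_of_real ` {0<..}"
      unfolding islimpt_approachable
    proof (intro allI impI)
      fix e :: real assume e: "e > 0"
      have "dist (complex_of_real (1 + e / 2)) 1 < e" using e by (simp add: dist_norm)
      thus "\<exists>x'\<in>complex_of_real ` {0<..}. x' \<noteq> 1 \<and> dist x' 1 < e"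
        using e by (intro bexI[of _ "complex_of_real (1 + e / 2)"] conjI imageI)
          (auto simp: complex_eq_iff)
    qed
    fix z assume "z \<in> complex_of_real ` {0<..}"
    then obtain x where x: "x > 0" "z = of_real x" by auto
    define S where "S = (\<lambda>x. \<Sum>n. exp (- pi * real (Suc n) ^ 2 * x))"
    have "1 + 2 * S x = (1 + 2 * S (1 / x)) / sqrt x"
    proof -
      \<comment> \<open>With a = x / (4 pi) the two exponents in \<open>gaussian_poisson\<close>
        become - pi n^2 x and - pi n^2 / x.\<close>
      have "4 * pi\<^sup>2 * (x / (4 * pi)) = pi * x" "2 * sqrt (pi * (x / (4 * pi))) = sqrt x" "4 * (x / (4 * pi)) = x / pi"
        by (simp_all add: power2_eq_square real_sqrt_divide)
      moreover have "- 4 * pi\<^sup>2 * (x / (4 * pi)) = - (4 * pi\<^sup>2 * (x / (4 * pi)))" by simp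
      ultimately show ?thesis
        using gaussian_poisson[of "x / (4 * pi)"] x unfolding S_def by (simp add: mult_ac)
    qed
    hence "1 + 2 * S (1 / x) = sqrt x * (1 + 2 * S x)" using x by simp
    moreover have "theta_tail z = of_real (S x)" "theta_tail (1 / z) = of_real (S (1 / x))"
      using theta_tail_of_real(1)[of x] theta_tail_of_real(1)[of "1 / x"] x by (simp_all add: S_def)
    moreover have "csqrt z = of_real (sqrt x)" using x by simp
    ultimately show "?f z = 0"
      by (metis (no_types, lifting) diff_self of_real_1 of_real_add of_real_mult of_real_numeral)
  qed (use assms in auto)
  thus ?thesis by simp
qed

text \<open>The theta function in the variable $w = e^{2u}$: the subtracted term makes the functional equation
  an evenness statement and gives decay on both sides.\<close>

definition phi_kernel :: "complex \<Rightarrow> complex" where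
  "phi_kernel u = 2 * exp (u / 2) * theta_tail (exp (2 * u)) - exp (- u / 2)"

lemma Re_exp_double_pos:
  assumes "\<bar>Im u\<bar> < pi / 4"
  shows "Re (exp (2 * u)) > 0"
  using assms by (simp add: Re_exp cos_gt_zero_pi)

lemma phi_kernel_holomorphic: "phi_kernel holomorphic_on {u. \<bar>Im u\<bar> < pi / 4}"
proof -
  have "(\<lambda>u. theta_tail (exp (2 * u))) holomorphic_on {u. \<bar>Im u\<bar> < pi / 4}"
    by (rule holomorphic_on_compose_gen[unfolded o_def, OF _ theta_tail_holomorphic])
       (auto intro!: holomorphic_intros Re_exp_double_pos)
  thus ?thesis unfolding phi_kernel_def[abs_def] by (intro holomorphic_intros) auto
qed

lemma phi_kernel_minus:
  assumes "\<bar>Im u\<bar> < pi / 4"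
  shows "phi_kernel (- u) = phi_kernel u"
proof -
  have "csqrt (exp (2 * u)) = csqrt (exp u ^ 2)" by (simp add: exp_double)
  also have "\<dots> = exp u"
    using assms by (intro csqrt_square disjI1) (simp add: Re_exp cos_gt_zero_pi)
  finally have c: "csqrt (exp (2 * u)) = exp u" .
  have "2 * theta_tail (exp (- (2 * u))) = exp u * (1 + 2 * theta_tail (exp (2 * u))) - 1"
    using theta_functional_equation[OF Re_exp_double_pos[OF assms]] unfolding c
    by (simp add: exp_minus field_simps)
  hence "2 * exp (- u / 2) * theta_tail (exp (2 * (- u))) =
      exp (- u / 2) * (exp u * (1 + 2 * theta_tail (exp (2 * u))) - 1)" by simp
  moreover have "exp (- u / 2) * exp u = exp (u / 2)" by (simp flip: exp_add)
  ultimately show ?thesis unfolding phi_kernel_def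
    by (simp add: algebra_simps)
qed

text \<open>For \<open>Re u \<ge> 0\<close> the theta term decays much faster than the subtracted
  \<open>exp (- u / 2)\<close>, which fixes the rate; evenness gives the other side. C depends on b
  through cos (2 b), the lower bound for the cosine of the argument of \<open>exp (2 * u)\<close>,
  and degenerates as b approaches pi/4.\<close>

lemma phi_kernel_bound:
  assumes b: "0 \<le> b" "b < pi / 4"
  obtains C where "C \<ge> 0" "\<And>u. \<bar>Im u\<bar> \<le> b \<Longrightarrow> norm (phi_kernel u) \<le> C * exp (- \<bar>Re u\<bar> / 2)"
proof -
  define \<delta> where "\<delta> = cos (2 * b)"
  have \<delta>: "\<delta> > 0" unfolding \<delta>_def using b by (intro cos_gt_zero_pi) auto
  define C where "C = 2 / (pi * \<delta>) / (1 - exp (- pi * \<delta>)) + 1"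
  have q: "1 - exp (- pi * \<delta>) > 0" using \<delta> by simp
  have C: "C \<ge> 0" using \<delta> q by (simp add: C_def)
  have 1: "norm (phi_kernel u) \<le> C * exp (- Re u / 2)" if u: "\<bar>Im u\<bar> \<le> b" "Re u \<ge> 0" for u
  proof -
    define X where "X = exp (2 * Re u)"
    have X: "X \<ge> 1" using u by (simp add: X_def)
    have "cos (2 * b) \<le> cos (2 * \<bar>Im u\<bar>)" using u b by (intro cos_monotone_0_pi_le) auto
    hence "\<delta> \<le> cos (2 * Im u)" by (simp add: \<delta>_def abs_if split: if_splits)
    hence "\<delta> * X \<le> Re (exp (2 * u))" using X by (simp add: Re_exp X_def mult_ac)
    moreover have "\<delta> \<le> \<delta> * X" using X \<delta> by simp
    ultimately have R: "Re (exp (2 * u)) \<ge> \<delta> * X" "Re (exp (2 * u)) \<ge> \<delta>" by auto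
    have "norm (theta_tail (exp (2 * u))) \<le> exp (- pi * Re (exp (2 * u))) / (1 - exp (- pi * \<delta>))"
      by (rule theta_tail_norm_le[OF \<delta> R(2)])
    also have "\<dots> \<le> exp (- (pi * \<delta> * X)) / (1 - exp (- pi * \<delta>))"
      using R(1) q by (intro divide_right_mono) auto
    also have "exp (- (pi * \<delta> * X)) \<le> 1 / (pi * \<delta> * X)"
    proof -
      have "pi * \<delta> * X \<le> exp (pi * \<delta> * X)" using exp_ge_add_one_self[of "pi * \<delta> * X"] by linarith
      thus ?thesis using \<delta> X by (simp add: exp_minus field_simps)
    qed
    finally have "norm (theta_tail (exp (2 * u))) \<le> 1 / (pi * \<delta> * X) / (1 - exp (- pi * \<delta>))"
      using q by (simp add: divide_right_mono)
    hence "2 * exp (Re u / 2) * norm (theta_tail (exp (2 * u))) \<le> 2 * exp (Re u / 2) * (1 / (pi * \<delta> * X) / (1 - exp (- pi * \<delta>)))"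
      by (intro mult_left_mono) auto
    also have "\<dots> = 2 / (pi * \<delta>) / (1 - exp (- pi * \<delta>)) * (exp (Re u / 2) / X)" by simp
    also have "exp (Re u / 2) / X \<le> exp (- Re u / 2)"
      using u by (simp add: X_def exp_diff[symmetric])
    finally have "2 * exp (Re u / 2) * norm (theta_tail (exp (2 * u))) \<le> 2 / (pi * \<delta>) / (1 - exp (- pi * \<delta>)) * exp (- Re u / 2)"
      using \<delta> q by (simp add: mult_left_mono del: times_divide_eq_left divide_divide_eq_left)
    moreover have "norm (phi_kernel u) \<le> 2 * exp (Re u / 2) * norm (theta_tail (exp (2 * u))) + exp (- Re u / 2)"
      unfolding phi_kernel_def by (rule order_trans[OF norm_triangle_ineq4]) (simp add: norm_mult norm_exp_eq_Re)
    ultimately show ?thesis by (simp add: C_def distrib_right)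
  qed
  have "norm (phi_kernel u) \<le> C * exp (- \<bar>Re u\<bar> / 2)" if "\<bar>Im u\<bar> \<le> b" for u
    using 1[of u] 1[of "-u"] phi_kernel_minus[of u] that b by (cases "Re u \<ge> 0") auto
  thus thesis using that[OF C] by blast
qed

section \<open>Continuation of zeta by a Mellin transform\<close>

text \<open>A kernel on the half line that beats every exponential, so that its Laplace transform is
  entire. The weight \<open>u ^ k\<close> in \<open>transform\<close> corresponds to the k-th
  derivative in z.\<close>

locale laplace_kernel =
  fixes g :: "real \<Rightarrow> real"
  assumes int: "\<And>A. integrable lborel (\<lambda>u. g u * exp (A * u))"
    and neg: "\<And>u. u < 0 \<Longrightarrow> g u = 0"
begin

definition transform :: "nat \<Rightarrow> complex \<Rightarrow> complex" where
  "transform k z = (\<integral>u. of_real (g u * u ^ k) * exp (z * of_real u) \<partial>lborel)"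

lemma measurable [measurable]: "g \<in> borel_measurable borel"
  using borel_measurable_integrable[OF int[of 0]] by simp

lemma abs_int: "integrable lborel (\<lambda>u. \<bar>g u\<bar> * exp (A * u))"
  using integrable_abs[OF int[of A]] by (simp add: abs_mult)

lemma power_le: "u \<ge> 0 \<Longrightarrow> (u::real) ^ k \<le> exp (real k * u)"
proof -
  assume u: "u \<ge> 0"
  have "u \<le> exp u" using exp_ge_add_one_self[of u] by linarith
  hence "u ^ k \<le> exp u ^ k" using u by (intro power_mono) auto
  thus ?thesis by (simp add: exp_of_nat_mult)
qed

lemma transform_integrable: "integrable lborel (\<lambda>u. complex_of_real (g u * u ^ k) * exp (z * of_real u))"
proof (rule Bochner_Integration.integrable_bound[OF abs_int[of "real k + Re z"]])
  show "AE u in lborel. norm (complex_of_real (g u * u ^ k) * exp (z * of_real u)) \<le> norm (\<bar>g u\<bar> * exp ((real k + Re z) * u))"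
  proof (rule AE_I2)
    fix u :: real
    show "norm (complex_of_real (g u * u ^ k) * exp (z * of_real u)) \<le> norm (\<bar>g u\<bar> * exp ((real k + Re z) * u))"
    proof (cases "u < 0")
      case False
      have "\<bar>g u\<bar> * u ^ k * exp (Re z * u) \<le> \<bar>g u\<bar> * exp (real k * u) * exp (Re z * u)"
        using power_le[of u k] False by (intro mult_mono) auto
      also have "\<dots> = \<bar>g u\<bar> * exp ((real k + Re z) * u)" by (simp add: distrib_right exp_add)
      finally show ?thesis using False by (simp add: norm_mult norm_power norm_exp_eq_Re abs_mult power_abs)
    qed (simp add: neg)
  qed
qed measurable

text \<open>Differentiation under the integral sign, from the second-order Taylor remainder of
  exp.\<close>

lemma transform_0_deriv: "(transform 0 has_field_derivative transform 1 z) (at z)"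
proof -
  \<comment> \<open>The exponent 3 is 1 + 2: \<open>\<bar>Re h\<bar> \<le> 1\<close> costs exp u,
    and the factor u^2 of the remainder is at most exp (2 u).\<close>
  define C where "C = (\<integral>u. \<bar>g u\<bar> * exp ((Re z + 3) * u) \<partial>lborel)"
  have est: "norm ((transform 0 (z + h) - transform 0 z) / h - transform 1 z) \<le> norm h * C"
    if h: "h \<noteq> 0" "norm h \<le> 1" for h
  proof -
    let ?d = "\<lambda>u. of_real (g u) * (exp (z * of_real u) * ((exp (h * of_real u) - 1) / h - of_real u))"
    have pt: "norm (?d u) \<le> norm h * (\<bar>g u\<bar> * exp ((Re z + 3) * u))" for u
    proof (cases "u < 0")
      case False
      define w where "w = h * of_real u"
      have "(exp (h * of_real u) - 1) / h - of_real u = (exp w - (\<Sum>k\<le>1. w ^ k / fact k)) / h"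
        using h by (simp add: w_def divide_simps algebra_simps)
      hence "norm ((exp (h * of_real u) - 1) / h - of_real u) = norm (exp w - (\<Sum>k\<le>1. w ^ k / fact k)) / norm h"
        by (simp add: norm_divide)
      also have "\<dots> \<le> (exp \<bar>Re w\<bar> * norm w ^ Suc 1 / fact 1) / norm h"
        by (intro divide_right_mono Taylor_exp) auto
      also have "\<dots> = exp (\<bar>Re h\<bar> * u) * norm h * u ^ 2"
        using h False by (simp add: w_def norm_mult abs_mult power2_eq_square)
      also have "\<dots> \<le> exp (1 * u) * norm h * exp (real 2 * u)"
        using power_le[of u 2] False order_trans[OF abs_Re_le_cmod h(2)] mult_right_mono[of "\<bar>Re h\<bar>" 1 u]
        by (intro mult_mono mult_right_mono) auto
      finally have n: "norm ((exp (h * of_real u) - 1) / h - of_real u) \<le> norm h * exp (3 * u)"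
        by (simp add: mult_ac flip: exp_add)
      have "norm (?d u) = \<bar>g u\<bar> * exp (Re z * u) * norm ((exp (h * of_real u) - 1) / h - of_real u)"
        by (simp add: norm_mult norm_exp_eq_Re)
      also have "\<dots> \<le> \<bar>g u\<bar> * exp (Re z * u) * (norm h * exp (3 * u))"
        by (intro mult_left_mono n) auto
      also have "\<dots> = norm h * (\<bar>g u\<bar> * exp ((Re z + 3) * u))"
        by (simp add: distrib_right exp_add)
      finally show ?thesis .
    qed (simp add: neg)
    let ?A = "\<lambda>w u. complex_of_real (g u * u ^ 0) * exp (w * of_real u)"
    let ?B = "\<lambda>u. complex_of_real (g u * u ^ 1) * exp (z * of_real u)"
    have "(transform 0 (z + h) - transform 0 z) / h - transform 1 z = (\<integral>u. ?A (z + h) u - ?A z u \<partial>lborel) / h - (\<integral>u. ?B u \<partial>lborel)"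
      unfolding transform_def by (subst Bochner_Integration.integral_diff[OF transform_integrable transform_integrable]) (rule refl)
    also have "\<dots> = (\<integral>u. (?A (z + h) u - ?A z u) / h \<partial>lborel) - (\<integral>u. ?B u \<partial>lborel)"
      by simp
    also have "\<dots> = (\<integral>u. (?A (z + h) u - ?A z u) / h - ?B u \<partial>lborel)"
      by (rule Bochner_Integration.integral_diff[symmetric])
         (intro Bochner_Integration.integrable_diff Bochner_Integration.integrable_divide transform_integrable)+
    also have "\<dots> = (\<integral>u. ?d u \<partial>lborel)"
      by (intro Bochner_Integration.integral_cong refl)
         (use h in \<open>simp add: exp_add field_simps\<close>)
    also have "norm \<dots> \<le> (\<integral>u. norm h * (\<bar>g u\<bar> * exp ((Re z + 3) * u)) \<partial>lborel)"
    proof (rule Bochner_Integration.integral_norm_bound_integral)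
      show "integrable lborel ?d"
      proof (rule Bochner_Integration.integrable_bound[OF integrable_mult_right[OF abs_int, of "norm h" "Re z + 3"]])
        show "AE u in lborel. norm (?d u) \<le> norm (norm h * (\<bar>g u\<bar> * exp ((Re z + 3) * u)))"
          by (rule AE_I2) (use pt in \<open>auto simp: abs_mult\<close>)
      qed measurable
      fix u :: real
      show "norm (?d u) \<le> norm h * (\<bar>g u\<bar> * exp ((Re z + 3) * u))" by (rule pt)
    qed (intro integrable_mult_right abs_int)
    also have "\<dots> = norm h * C" by (simp add: C_def)
    finally show ?thesis .
  qed
  have "((\<lambda>h. (transform 0 (z + h) - transform 0 z) / h - transform 1 z) \<longlongrightarrow> 0) (at 0)"
  proof (rule Lim_null_comparison)
    have "eventually (\<lambda>h::complex. h \<noteq> 0 \<and> norm h < 1) (at 0)"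
      using eventually_at[of "\<lambda>h::complex. h \<noteq> 0 \<and> norm h < 1" 0] by (auto intro!: exI[of _ 1] simp: dist_norm)
    thus "\<forall>\<^sub>F h in at 0. norm ((transform 0 (z + h) - transform 0 z) / h - transform 1 z) \<le> norm h * C"
      by eventually_elim (use est in auto)
    show "((\<lambda>h. norm h * C) \<longlongrightarrow> 0) (at (0::complex))" by (auto intro!: tendsto_eq_intros)
  qed
  thus ?thesis unfolding DERIV_def by (rule LIM_zero_cancel)
qed

end

section \<open>Exponential and Gamma integrals in the logarithmic variable\<close>

lemma exp_half_line_integral:
  fixes a :: complex
  assumes a: "Re a > 0"
  shows "has_bochner_integral lborel (\<lambda>u. indicator {0..} u *\<^sub>R exp (- a * of_real u)) (1 / a)"
proof -
  have "((\<lambda>x. exp (- Re a * x)) has_integral exp (- Re a * 0) / Re a) {0..}"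
    using has_integral_exp_minus_to_infinity[OF a, of 0] by simp
  hence "((\<lambda>x. indicator {0..} x *\<^sub>R exp (- Re a * x)) has_integral exp (- Re a * 0) / Re a) UNIV"
    by (subst (asm) has_integral_restrict_UNIV[symmetric]) (erule has_integral_eq[rotated], auto simp: indicator_def)
  hence nn: "integral\<^sup>N lborel (\<lambda>x. indicator {0..} x *\<^sub>R exp (- Re a * x)) = ennreal (exp (- Re a * 0) / Re a)"
    by (intro nn_integral_has_integral_lborel) auto
  have "integrable lborel (\<lambda>x. indicator {0..} x *\<^sub>R exp (- Re a * x))"
    by (rule integrableI_nn_integral_finite[OF _ _ nn]) auto
  hence int: "integrable lborel (\<lambda>u. indicator {0..} u *\<^sub>R exp (- a * of_real u))"
    by (rule Bochner_Integration.integrable_bound) (auto simp: norm_exp_eq_Re)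
  have a0: "a \<noteq> 0" using a by auto
  have "((\<lambda>b. LINT u:{0..b}|lborel. exp (- a * of_real u)) \<longlongrightarrow> (LINT u:{0..}|lborel. exp (- a * of_real u))) at_top"
    by (rule tendsto_set_lebesgue_integral_at_top) (use int in \<open>auto simp: set_integrable_def\<close>)
  moreover have "((\<lambda>b. LINT u:{0..b}|lborel. exp (- a * of_real u)) \<longlongrightarrow> 1 / a) at_top"
  proof (rule Lim_transform_eventually)
    have "((\<lambda>b. exp (- Re a * b)) \<longlongrightarrow> 0) at_top" using a by real_asymp
    hence "((\<lambda>b. exp (- a * complex_of_real b)) \<longlongrightarrow> 0) at_top"
      by (subst tendsto_norm_zero_iff[symmetric]) (simp add: norm_exp_eq_Re)
    thus "((\<lambda>b. (1 - exp (- a * complex_of_real b)) / a) \<longlongrightarrow> 1 / a) at_top"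
      using tendsto_divide[OF tendsto_diff[OF tendsto_const[of 1]] tendsto_const[of a]] a0 by fastforce
    show "\<forall>\<^sub>F b in at_top. (1 - exp (- a * complex_of_real b)) / a = (LINT u:{0..b}|lborel. exp (- a * of_real u))"
      using eventually_ge_at_top[of 0]
    proof eventually_elim
      case (elim b)
      have "((\<lambda>u. exp (- a * complex_of_real u)) has_integral
          (- exp (- a * of_real b) / a - (- exp (- a * of_real 0) / a))) {0..b}"
        by (rule fundamental_theorem_of_calculus[OF elim])
           (use a0 in \<open>auto intro!: derivative_eq_intros has_vector_derivative_real_field simp: field_simps\<close>)
      moreover have "(LINT u:{0..b}|lborel. exp (- a * of_real u)) = integral {0..b} (\<lambda>u. exp (- a * complex_of_real u))"
        by (intro set_borel_integral_eq_integral borel_integrable_atLeastAtMost' continuous_intros)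
      ultimately show ?case using a0 by (simp add: integral_unique diff_divide_distrib)
    qed
  qed
  ultimately have "(LINT u:{0..}|lborel. exp (- a * of_real u)) = 1 / a"
    by (rule tendsto_unique[rotated]) simp
  thus ?thesis using int by (simp add: has_bochner_integral_iff set_lebesgue_integral_def)
qed

text \<open>Euler's integral under the substitution t = c exp (2 u). For c = pi n^2 and z = s/2 the
  right-hand side is pi^(-s/2) Gamma(s/2) n^(-s), a term of the completed Dirichlet series.\<close>

lemma gamma_exp_integral:
  fixes z :: complex
  assumes z: "Re z > 0" and c: "c > 0"
  shows "has_bochner_integral lborel (\<lambda>u. 2 * exp (2 * z * of_real u) * exp (- of_real (c * exp (2 * u))))
           (Gamma z * exp (- z * of_real (ln c)))"
proof -
  let ?f = "\<lambda>t. complex_of_real t powr (z - 1) / of_real (exp t)"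
  let ?F = "\<lambda>u. 2 * exp (2 * z * of_real u) * exp (- of_real (c * exp (2 * u)))"
  have img: "(\<lambda>u. c * exp (2 * u)) ` UNIV = {0<..}"
  proof (intro equalityI subsetI)
    fix x :: real assume "x \<in> {0<..}"
    hence "x = c * exp (2 * (ln (x / c) / 2))" using c by simp
    thus "x \<in> (\<lambda>u. c * exp (2 * u)) ` UNIV" by blast
  qed (use c in auto)
  have "?f absolutely_integrable_on (\<lambda>u. c * exp (2 * u)) ` UNIV \<and> integral ((\<lambda>u. c * exp (2 * u)) ` UNIV) ?f = Gamma z"
    unfolding img using absolutely_integrable_Gamma_integral'[OF z] Gamma_integral_complex'[OF z]
    by (simp add: integral_unique)
  hence *: "(\<lambda>u. \<bar>2 * c * exp (2 * u)\<bar> *\<^sub>R ?f (c * exp (2 * u))) absolutely_integrable_on UNIV \<and>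
      integral UNIV (\<lambda>u. \<bar>2 * c * exp (2 * u)\<bar> *\<^sub>R ?f (c * exp (2 * u))) = Gamma z"
    by (subst has_absolute_integral_change_of_variables_real[where g = "\<lambda>u. c * exp (2 * u)"])
       (use c in \<open>auto intro!: derivative_eq_intros inj_onI\<close>)
  have eq: "(\<lambda>u. \<bar>2 * c * exp (2 * u)\<bar> *\<^sub>R ?f (c * exp (2 * u))) = (\<lambda>u. exp (z * of_real (ln c)) * ?F u)"
  proof
    fix u :: real
    have x: "c * exp (2 * u) > 0" using c by simp
    have L: "Ln (complex_of_real (c * exp (2 * u))) = of_real (ln c + 2 * u)"
      using x c by (subst Ln_of_real) (auto simp: ln_mult)
    have "c * exp (2 * u) = exp (ln c + 2 * u)" using c by (simp add: exp_add)
    hence "complex_of_real (c * exp (2 * u)) = exp (of_real (ln c + 2 * u))"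
      by (simp only: exp_of_real)
    hence "complex_of_real (c * exp (2 * u)) * complex_of_real (c * exp (2 * u)) powr (z - 1) =
       exp (of_real (ln c + 2 * u)) * exp ((z - 1) * of_real (ln c + 2 * u))"
      using x unfolding powr_def L by auto
    also have "\<dots> = exp (z * of_real (ln c)) * exp (2 * z * of_real u)"
      by (simp add: exp_add[symmetric] algebra_simps)
    finally have 1: "complex_of_real (c * exp (2 * u)) * complex_of_real (c * exp (2 * u)) powr (z - 1) =
       exp (z * of_real (ln c)) * exp (2 * z * of_real u)" .
    have "\<bar>2 * c * exp (2 * u)\<bar> *\<^sub>R ?f (c * exp (2 * u)) = 2 * (complex_of_real (c * exp (2 * u)) * complex_of_real (c * exp (2 * u)) powr (z - 1)) / of_real (exp (c * exp (2 * u)))"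
      using c by (simp add: scaleR_conv_of_real)
    also have "\<dots> = exp (z * of_real (ln c)) * ?F u"
      unfolding 1 by (simp add: exp_minus exp_of_real[symmetric] divide_inverse)
    finally show "\<bar>2 * c * exp (2 * u)\<bar> *\<^sub>R ?f (c * exp (2 * u)) = exp (z * of_real (ln c)) * ?F u" .
  qed
  have meas: "(\<lambda>u. exp (z * of_real (ln c)) * ?F u) \<in> borel_measurable lborel" by measurable
  have "integrable lebesgue (\<lambda>u. exp (z * of_real (ln c)) * ?F u)"
    using *[unfolded eq] by (simp add: set_integrable_def)
  hence int: "integrable lborel (\<lambda>u. exp (z * of_real (ln c)) * ?F u)"
    by (rule integrable_completion[OF meas, THEN iffD1])
  have "integral\<^sup>L lborel (\<lambda>u. exp (z * of_real (ln c)) * ?F u) = Gamma z"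
    using *[unfolded eq] integral_lborel[OF int] by simp
  hence "has_bochner_integral lborel (\<lambda>u. exp (z * of_real (ln c)) * ?F u) (Gamma z)"
    using int by (simp add: has_bochner_integral_iff)
  note has_bochner_integral_mult_right[OF this, of "exp (- z * of_real (ln c))"]
  moreover have "(\<lambda>u. exp (- z * of_real (ln c)) * (exp (z * of_real (ln c)) * ?F u)) = ?F"
    by (rule ext) (simp add: exp_minus)
  ultimately show ?thesis by (subst mult.commute[of "Gamma z"]) (simp only:)
qed

text \<open>The theta part of twice \<open>phi_kernel\<close>, cut off at u = 0. On the whole line
  it would not be integrable against all exponentials, since the theta series grows as u tends to
  minus infinity; that half is folded over by the functional equation instead.\<close>

definition theta_kernel :: "real \<Rightarrow> real" where
  "theta_kernel u = (if u \<ge> 0 then 4 * exp (u / 2) * (\<Sum>n. exp (- pi * real (Suc n) ^ 2 * exp (2 * u))) else 0)"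

lemma theta_kernel_complex:
  assumes "u \<ge> 0"
  shows "complex_of_real (theta_kernel u) = 4 * exp (of_real u / 2) * theta_tail (exp (2 * of_real u))"
    and "complex_of_real (theta_kernel u) = 2 * (phi_kernel (of_real u) + exp (- of_real u / 2))"
proof -
  have "exp (2 * complex_of_real u) = of_real (exp (2 * u))" by (simp add: exp_of_real[symmetric])
  moreover have "exp (complex_of_real u / 2) = of_real (exp (u / 2))" by (simp add: exp_of_real[symmetric])
  ultimately show 1: "complex_of_real (theta_kernel u) = 4 * exp (of_real u / 2) * theta_tail (exp (2 * of_real u))"
    using assms theta_tail_of_real(1)[of "exp (2 * u)"] by (simp add: theta_kernel_def)
  show "complex_of_real (theta_kernel u) = 2 * (phi_kernel (of_real u) + exp (- of_real u / 2))"
    unfolding 1 phi_kernel_def by simp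
qed

lemma continuous_on_phi_kernel_line:
  assumes "\<bar>b\<bar> < pi / 4"
  shows "continuous_on UNIV (\<lambda>x. phi_kernel (Complex x b))"
proof -
  have "continuous_on {u. \<bar>Im u\<bar> < pi / 4} phi_kernel"
    by (rule holomorphic_on_imp_continuous_on[OF phi_kernel_holomorphic])
  moreover have "continuous_on UNIV (\<lambda>x. Complex x b)"
    unfolding Complex_eq by (intro continuous_intros)
  ultimately show ?thesis
    by (rule continuous_on_compose2) (use assms in auto)
qed

lemma theta_kernel_measurable [measurable]: "theta_kernel \<in> borel_measurable borel"
proof -
  have eq: "theta_kernel = (\<lambda>u. indicator {0..} u * (2 * (Re (phi_kernel (Complex u 0)) + exp (- u / 2))))"
  proof
    fix u :: real
    show "theta_kernel u = indicator {0..} u * (2 * (Re (phi_kernel (Complex u 0)) + exp (- u / 2)))"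
    proof (cases "u \<ge> 0")
      case True
      from arg_cong[OF theta_kernel_complex(2)[OF True], of Re] show ?thesis
        using True by (simp add: complex_of_real_def Re_exp)
    qed (simp add: theta_kernel_def)
  qed
  have [measurable]: "(\<lambda>x. phi_kernel (Complex x 0)) \<in> borel_measurable borel"
    by (intro borel_measurable_continuous_onI continuous_on_phi_kernel_line) simp
  show ?thesis by (subst eq) measurable
qed

lemma theta_kernel_nonneg: "theta_kernel u \<ge> 0"
  unfolding theta_kernel_def
  using theta_tail_of_real(2)[of "exp (2 * u)"] by (auto intro!: mult_nonneg_nonneg suminf_nonneg)

lemma theta_kernel_le:
  assumes "u \<ge> 0"
  shows "theta_kernel u \<le> 4 / (1 - exp (- pi)) * exp (u / 2) * exp (- pi * exp (2 * u))"
proof -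
  have e2: "complex_of_real (exp (2 * u)) = exp (2 * of_real u)" by (simp add: exp_of_real[symmetric])
  have "norm (theta_tail (of_real (exp (2 * u)))) \<le> exp (- pi * Re (of_real (exp (2 * u)))) / (1 - exp (- pi * 1))"
    by (rule theta_tail_norm_le) (use assms in auto)
  hence "norm (theta_tail (exp (2 * complex_of_real u))) \<le> exp (- pi * exp (2 * u)) / (1 - exp (- pi))"
    unfolding Re_complex_of_real unfolding e2 by simp
  hence "4 * exp (u / 2) * norm (theta_tail (exp (2 * complex_of_real u))) \<le>
     4 * exp (u / 2) * (exp (- pi * exp (2 * u)) / (1 - exp (- pi)))" by (intro mult_left_mono) auto
  hence "norm (4 * exp (complex_of_real u / 2) * theta_tail (exp (2 * of_real u))) \<le>
      4 * exp (u / 2) * (exp (- pi * exp (2 * u)) / (1 - exp (- pi)))"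
    by (simp add: norm_mult norm_exp_eq_Re)
  also have "4 * exp (complex_of_real u / 2) * theta_tail (exp (2 * of_real u)) = of_real (theta_kernel u)"
    by (rule theta_kernel_complex(1)[symmetric, OF assms])
  finally show ?thesis using theta_kernel_nonneg[of u] by (simp add: mult_ac)
qed

interpretation theta: laplace_kernel theta_kernel
proof
  fix A :: real
  \<comment> \<open>From pi exp (2 u) >= 2 u^2 and completing the square: (A + 1/2) u - 2 u^2 is at
    most (A + 1/2)^2 / 4 - u^2.\<close>
  define K where "K = 4 / (1 - exp (- pi)) * exp ((A + 1/2)\<^sup>2 / 4)"
  have K: "K \<ge> 0" by (simp add: K_def)
  have "integrable lborel (\<lambda>x. norm (complex_of_real (exp (-1 * x\<^sup>2)) * exp (\<i> * of_real (x * 0))))"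
    using gaussian_fourier[of 1 0] by (intro integrable_norm) (simp add: has_bochner_integral_iff)
  hence "integrable lborel (\<lambda>x::real. K * exp (- x\<^sup>2))" by simp
  thus "integrable lborel (\<lambda>u. theta_kernel u * exp (A * u))"
  proof (rule Bochner_Integration.integrable_bound)
    show "AE u in lborel. norm (theta_kernel u * exp (A * u)) \<le> norm (K * exp (- u\<^sup>2))"
    proof (rule AE_I2)
      fix u :: real
      show "norm (theta_kernel u * exp (A * u)) \<le> norm (K * exp (- u\<^sup>2))"
      proof (cases "u \<ge> 0")
        case True
        have "2 * u\<^sup>2 \<le> exp (2 * u)" using exp_lower_Taylor_quadratic[of "2 * u"] True by (simp add: power2_eq_square)
        also have "exp (2 * u) \<le> pi * exp (2 * u)" using pi_gt3 by simp
        finally have 1: "- pi * exp (2 * u) \<le> - 2 * u\<^sup>2" by simp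
        have "0 \<le> (u - (A + 1/2) / 2)\<^sup>2" by simp
        hence 2: "u / 2 + A * u \<le> u\<^sup>2 + (A + 1/2)\<^sup>2 / 4" by (simp add: power2_eq_square field_simps)
        have "theta_kernel u * exp (A * u) \<le> 4 / (1 - exp (- pi)) * exp (u / 2) * exp (- pi * exp (2 * u)) * exp (A * u)"
          by (intro mult_right_mono theta_kernel_le True) auto
        also have "\<dots> = 4 / (1 - exp (- pi)) * exp (u / 2 + A * u - pi * exp (2 * u))"
        proof -
          have "u / 2 + A * u - pi * exp (2 * u) = u / 2 + - pi * exp (2 * u) + A * u" by simp
          thus ?thesis by (simp only: exp_add mult.assoc)
        qed
        also have "\<dots> \<le> 4 / (1 - exp (- pi)) * exp ((A + 1/2)\<^sup>2 / 4 - u\<^sup>2)"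
          using 1 2 by (intro mult_left_mono) auto
        also have "\<dots> = K * exp (- u\<^sup>2)"
          by (simp only: K_def diff_conv_add_uminus[of "(A + 1/2)\<^sup>2 / 4"] exp_add mult.assoc)
        finally show ?thesis using theta_kernel_nonneg[of u] K by simp
      qed (simp add: theta_kernel_def)
    qed
  qed measurable
qed (simp add: theta_kernel_def)

text \<open>At z = s - 1/2 this is pi^(-s/2) Gamma(s/2) zeta(s) without its polar terms 1/(s-1) and
  -1/s. Symmetrising in z builds in the functional equation.\<close>

definition theta_mellin :: "complex \<Rightarrow> complex" where
  "theta_mellin z = (theta.transform 0 z + theta.transform 0 (- z)) / 2"

lemma theta_mellin_deriv:
  "(theta_mellin has_field_derivative (theta.transform 1 z - theta.transform 1 (- z)) / 2) (at z)"
proof -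
  have "((\<lambda>z. theta.transform 0 (- z)) has_field_derivative theta.transform 1 (- z) * (- 1)) (at z)"
    by (rule DERIV_chain2[where f = "theta.transform 0", OF theta.transform_0_deriv]) (auto intro!: derivative_eq_intros)
  from DERIV_cdivide[OF DERIV_add[OF theta.transform_0_deriv[of z] this], of 2] show ?thesis
    unfolding theta_mellin_def[abs_def] by simp
qed

lemma theta_mellin_holomorphic [holomorphic_intros]:
  "f holomorphic_on A \<Longrightarrow> (\<lambda>z. theta_mellin (f z)) holomorphic_on A"
proof -
  have "theta_mellin holomorphic_on UNIV"
    by (rule holomorphic_onI) (meson field_differentiable_at_within field_differentiable_def theta_mellin_deriv)
  thus "f holomorphic_on A \<Longrightarrow> (\<lambda>z. theta_mellin (f z)) holomorphic_on A"
    by (rule holomorphic_on_compose_gen[unfolded o_def, rotated]) auto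
qed

text \<open>The pole of the completed zeta function at 0 is absorbed by the reciprocal Gamma function
  through $\Gamma(s/2 + 1) = (s/2)\,\Gamma(s/2)$, so that only $s = 1$ has to be excluded.\<close>

definition zeta_cont :: "complex \<Rightarrow> complex" where
  "zeta_cont s = (if s = 1 then 0 else exp (s / 2 * of_real (ln pi)) *
     (rGamma (s / 2) * theta_mellin (s - 1/2) - rGamma (s / 2 + 1) / (2 * (1 - s))))"

lemma zeta_cont_holomorphic: "zeta_cont holomorphic_on - {1}"
proof -
  have "(\<lambda>s. exp (s / 2 * of_real (ln pi)) *
     (rGamma (s / 2) * theta_mellin (s - 1/2) - rGamma (s / 2 + 1) / (2 * (1 - s)))) holomorphic_on - {1}"
    by (intro holomorphic_intros) auto
  thus ?thesis by (rule holomorphic_transform) (auto simp: zeta_cont_def)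
qed

text \<open>Riemann's splitting of the Mellin integral. The half u < 0 is reflected by the
  functional equation of theta, whose elementary terms integrate to 1/(s-1) and -1/s.\<close>

lemma theta_mellin_eq_integral:
  assumes s: "Re s > 1"
  shows "(\<integral>u. 2 * exp (s * of_real u) * theta_tail (exp (2 * of_real u)) \<partial>lborel) =
           theta_mellin (s - 1/2) + 1 / (s - 1) - 1 / s"
proof -
  let ?T = "\<lambda>u. 2 * exp (s * of_real u) * theta_tail (exp (2 * complex_of_real u))"
  define G where "G = (\<lambda>z u. complex_of_real (theta_kernel u * u ^ 0) * exp (z * of_real u))"
  define X where "X = (\<lambda>a u. indicator {0..} u *\<^sub>R exp (- a * complex_of_real u))"
  \<comment> \<open>The integrand on the negative half line as a function of v = - u: two pure
    exponentials and the theta term with s replaced by 1 - s.\<close>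
  define H where "H = (\<lambda>u. X (s - 1) u - X s u + G (1/2 - s) u / 2)"
  have G: "has_bochner_integral lborel (G z) (theta.transform 0 z)" for z
    unfolding G_def theta.transform_def has_bochner_integral_iff by (intro conjI refl theta.transform_integrable)
  have "has_bochner_integral lborel H (1 / (s - 1) - 1 / s + theta.transform 0 (1/2 - s) / 2)"
    unfolding H_def X_def
    by (intro has_bochner_integral_add has_bochner_integral_diff has_bochner_integral_divide_zero G exp_half_line_integral)
       (use s in auto)
  hence "has_bochner_integral lborel (\<lambda>u. H (0 + (-1) * u)) ((1 / (s - 1) - 1 / s + theta.transform 0 (1/2 - s) / 2) /\<^sub>R \<bar>-1\<bar>)"
    by (subst (asm) lborel_has_bochner_integral_real_affine_iff[where c = "-1" and t = 0]) auto
  hence "has_bochner_integral lborel (\<lambda>u. G (s - 1/2) u / 2 + H (- u))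
      (theta.transform 0 (s - 1/2) / 2 + (1 / (s - 1) - 1 / s + theta.transform 0 (1/2 - s) / 2))"
    by (intro has_bochner_integral_add has_bochner_integral_divide_zero G) simp
  hence "(\<integral>u. G (s - 1/2) u / 2 + H (- u) \<partial>lborel) = theta_mellin (s - 1/2) + 1 / (s - 1) - 1 / s"
    by (simp add: has_bochner_integral_iff theta_mellin_def add_divide_distrib)
  moreover have "(\<integral>u. ?T u \<partial>lborel) = (\<integral>u. G (s - 1/2) u / 2 + H (- u) \<partial>lborel)"
  proof (rule integral_cong_AE)
    have "AE u in lborel. u \<noteq> (0::real)" by (rule AE_lborel_singleton)
    thus "AE u in lborel. ?T u = G (s - 1/2) u / 2 + H (- u)"
    proof eventually_elim
      case (elim u)
      show ?case
      proof (cases "u > 0")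
        case True
        hence "?T u = G (s - 1/2) u / 2"
          using theta_kernel_complex(1)[of u]
          by (simp add: G_def exp_diff[symmetric] exp_add[symmetric] algebra_simps)
        thus ?thesis using True by (simp add: H_def X_def G_def theta_kernel_def)
      next
        case False
        define v where "v = - u"
        have v: "v > 0" using False elim by (simp add: v_def)
        have "\<bar>Im (complex_of_real v)\<bar> < pi / 4" by simp
        have "csqrt (exp (2 * complex_of_real v)) = exp (of_real v)"
          by (simp add: exp_double csqrt_square Re_exp)
        hence "2 * theta_tail (exp (- (2 * complex_of_real v))) = exp (of_real v) * (1 + 2 * theta_tail (exp (2 * of_real v))) - 1"
          using theta_functional_equation[OF Re_exp_double_pos[of "of_real v"]]
          by (simp add: exp_minus field_simps)
        hence "?T u = exp (- s * of_real v) * (exp (of_real v) * (1 + 2 * theta_tail (exp (2 * of_real v))) - 1)"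
          unfolding v_def by (simp add: mult_ac)
        also have "\<dots> = exp (- (s - 1) * of_real v) - exp (- s * of_real v)
             + exp (- (s - 1) * of_real v) * (2 * theta_tail (exp (2 * of_real v)))"
          by (simp add: exp_diff exp_minus ring_distribs divide_simps)
        also have "exp (- (s - 1) * of_real v) * (2 * theta_tail (exp (2 * of_real v))) = G (1/2 - s) v / 2"
          using v theta_kernel_complex(1)[of v]
          by (simp add: G_def exp_diff[symmetric] exp_add[symmetric] algebra_simps)
        finally have T: "?T u = exp (- (s - 1) * of_real v) - exp (- s * of_real v) + G (1/2 - s) v / 2" .
        have "indicator {0..} v = (1::real)" using v by simp
        hence "?T u = H v" unfolding H_def X_def T by (simp only: scaleR_one)
        thus ?thesis using v by (simp add: G_def v_def theta_kernel_def)
      qed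
    qed
    have "continuous_on UNIV (\<lambda>u. theta_tail (exp (2 * complex_of_real u)))"
      by (rule continuous_on_compose2[OF holomorphic_on_imp_continuous_on[OF theta_tail_holomorphic]])
         (auto intro!: continuous_intros simp: Re_exp)
    hence [measurable]: "(\<lambda>u. theta_tail (exp (2 * complex_of_real u))) \<in> borel_measurable borel"
      by (rule borel_measurable_continuous_onI)
    show "?T \<in> borel_measurable lborel" by measurable
    show "(\<lambda>u. G (s - 1/2) u / 2 + H (- u)) \<in> borel_measurable lborel"
      unfolding G_def H_def X_def by measurable
  qed
  ultimately show ?thesis by simp
qed

text \<open>Summing the Gamma integrals for c = pi n^2 under the integral sign yields the Mellin
  integral of theta.\<close>

lemma zeta_cont_sums:
  assumes s: "Re s > 1"
  shows "(\<lambda>n. 1 / of_nat (Suc n) powr s) sums zeta_cont s"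
proof -
  define c where "c = (\<lambda>n. pi * real (Suc n) ^ 2)"
  have c: "c n > 0" "ln (c n) = ln pi + 2 * ln (real (Suc n))" for n by (simp_all add: c_def ln_mult ln_realpow)
  define F where "F = (\<lambda>z n u. 2 * exp (2 * (z / 2) * complex_of_real u) * exp (- of_real (c n * exp (2 * u))))"
  have hb: "has_bochner_integral lborel (F z n) (Gamma (z / 2) * exp (- (z / 2) * of_real (ln (c n))))" if "Re z > 1" for z n
    unfolding F_def by (rule gamma_exp_integral) (use that c in auto)
  \<comment> \<open>The norm of the integrand at s is the integrand at the real point
    \<open>Re s\<close>, so the L1 norms are again Gamma integrals and add up to a convergent series
    of powers with exponent \<open>- Re s\<close>. This justifies the interchange.\<close>
  have nrm: "complex_of_real (norm (F s n u)) = F (of_real (Re s)) n u" for n u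
    by (simp add: F_def norm_mult norm_exp_eq_Re exp_of_real[symmetric])
  have I: "complex_of_real (\<integral>u. norm (F s n u) \<partial>lborel) = Gamma (of_real (Re s / 2)) * exp (- of_real (Re s / 2 * ln (c n)))" for n
  proof -
    have "complex_of_real (\<integral>u. norm (F s n u) \<partial>lborel) = (\<integral>u. F (of_real (Re s)) n u \<partial>lborel)"
      unfolding nrm[symmetric] by simp
    thus ?thesis using hb[of "of_real (Re s)" n] s by (simp add: has_bochner_integral_iff)
  qed
  have "(\<lambda>n. integral\<^sup>L lborel (F s n)) sums (\<integral>u. (\<Sum>n. F s n u) \<partial>lborel)"
  proof (rule sums_integral)
    show "integrable lborel (F s n)" for n using hb[OF s] by (simp add: has_bochner_integral_iff)
    show "AE u in lborel. summable (\<lambda>n. norm (F s n u))"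
    proof (rule AE_I2)
      fix u :: real
      have "summable (\<lambda>n. norm (2 * exp (s * of_real u)) * norm (exp (- of_real (pi * real (Suc n) ^ 2) * complex_of_real (exp (2 * u)))))"
        by (intro summable_mult theta_tail_summable) simp
      thus "summable (\<lambda>n. norm (F s n u))" by (simp add: F_def c_def norm_mult mult_ac)
    qed
    have "(\<integral>u. norm (F s n u) \<partial>lborel) = norm (Gamma (complex_of_real (Re s / 2))) * exp (- (Re s / 2) * ln pi) * real (Suc n) powr (- Re s)" for n
    proof -
      have "(\<integral>u. norm (F s n u) \<partial>lborel) = norm (complex_of_real (\<integral>u. norm (F s n u) \<partial>lborel))" by simp
      also have "\<dots> = norm (Gamma (complex_of_real (Re s / 2))) * exp (- (Re s / 2 * ln (c n)))"
        unfolding I norm_mult norm_exp_eq_Re by simp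
      also have "exp (- (Re s / 2 * ln (c n))) = exp (- (Re s / 2) * ln pi) * real (Suc n) powr (- Re s)"
        by (simp add: c powr_def exp_add[symmetric] algebra_simps add_divide_distrib)
      finally show ?thesis by (simp only: mult.assoc)
    qed
    moreover have "summable (\<lambda>n. real (Suc n) powr (- Re s))"
      using s by (subst summable_Suc_iff) (simp add: summable_real_powr_iff)
    ultimately show "summable (\<lambda>n. \<integral>u. norm (F s n u) \<partial>lborel)"
      by (simp add: summable_mult)
  qed
  moreover have "(\<Sum>n. F s n u) = 2 * exp (s * of_real u) * theta_tail (exp (2 * of_real u))" for u
  proof -
    have "summable (\<lambda>n. exp (- of_real (pi * real (Suc n) ^ 2) * complex_of_real (exp (2 * u))))"
      by (rule summable_norm_cancel[OF theta_tail_summable]) simp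
    from suminf_mult[OF this, of "2 * exp (s * of_real u)"] show ?thesis
      by (simp add: F_def c_def theta_tail_def exp_of_real[symmetric] mult_ac)
  qed
  ultimately have "(\<lambda>n. integral\<^sup>L lborel (F s n)) sums (theta_mellin (s - 1/2) + 1 / (s - 1) - 1 / s)"
    using theta_mellin_eq_integral[OF s] by simp
  hence "(\<lambda>n. exp (s / 2 * of_real (ln pi)) * rGamma (s / 2) * integral\<^sup>L lborel (F s n)) sums
     (exp (s / 2 * of_real (ln pi)) * rGamma (s / 2) * (theta_mellin (s - 1/2) + 1 / (s - 1) - 1 / s))"
    by (rule sums_mult)
  moreover have "exp (s / 2 * of_real (ln pi)) * rGamma (s / 2) * integral\<^sup>L lborel (F s n) = 1 / of_nat (Suc n) powr s" for n
  proof -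
    have "s / 2 \<notin> \<int>\<^sub>\<le>\<^sub>0" using s by (auto elim!: nonpos_Ints_cases simp: complex_eq_iff)
    hence g: "rGamma (s / 2) * Gamma (s / 2) = 1" by (simp add: rGamma_inverse_Gamma Gamma_eq_zero_iff)
    have "exp (s / 2 * of_real (ln pi)) * rGamma (s / 2) * integral\<^sup>L lborel (F s n) =
       (rGamma (s / 2) * Gamma (s / 2)) * (exp (s / 2 * of_real (ln pi)) * exp (- (s / 2) * of_real (ln (c n))))"
      using hb[OF s, of n] by (simp add: has_bochner_integral_iff mult_ac)
    also have "\<dots> = exp (- (s * of_real (ln (real (Suc n)))))"
      unfolding g c by (simp add: exp_add[symmetric] algebra_simps del: of_nat_Suc)
    also have "\<dots> = 1 / of_nat (Suc n) powr s"
      by (simp add: powr_def exp_minus field_simps Ln_of_nat del: of_nat_Suc)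
    finally show ?thesis .
  qed
  moreover have "exp (s / 2 * of_real (ln pi)) * rGamma (s / 2) * (theta_mellin (s - 1/2) + 1 / (s - 1) - 1 / s) = zeta_cont s"
  proof -
    have s0: "s \<noteq> 0" "s \<noteq> 1" using s by auto
    have alg: "s / 2 * R * (1 / (s - 1) - 1 / s) = - (R / (2 * (1 - s)))" for R
    proof -
      have "1 / (s - 1) - 1 / s = 1 / (s * (s - 1))" using s0 by (simp add: divide_simps)
      moreover have "R / (2 * (1 - s)) = - (R / (2 * (s - 1)))"
        by (metis minus_diff_eq minus_divide_right mult_minus_right)
      ultimately show ?thesis using s0 by simp
    qed
    have "rGamma (s / 2) * (1 / (s - 1) - 1 / s) = - (rGamma (s / 2 + 1) / (2 * (1 - s)))"
      using alg[of "rGamma (s / 2 + 1)"] by (simp only: rGamma_plus1)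
    moreover have "exp (s / 2 * of_real (ln pi)) * rGamma (s / 2) * (theta_mellin (s - 1/2) + 1 / (s - 1) - 1 / s) =
       exp (s / 2 * of_real (ln pi)) * (rGamma (s / 2) * theta_mellin (s - 1/2) + rGamma (s / 2) * (1 / (s - 1) - 1 / s))"
      by (simp add: algebra_simps)
    ultimately show ?thesis using s0 unfolding zeta_cont_def by simp
  qed
  ultimately show ?thesis by simp
qed

lemma riemann_zeta_eq: "riemann_zeta = zeta_cont"
  unfolding riemann_zeta_def
proof (rule the_equality)
  show "zeta_cont holomorphic_on - {1} \<and> zeta_cont 1 = 0 \<and>
    (\<forall>s. 1 < Re s \<longrightarrow> (\<lambda>n. 1 / of_nat (Suc n) powr s) sums zeta_cont s)"
    using zeta_cont_holomorphic zeta_cont_sums by (simp add: zeta_cont_def)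
  fix f assume f: "f holomorphic_on - {1} \<and> f 1 = 0 \<and>
    (\<forall>s. 1 < Re s \<longrightarrow> (\<lambda>n. 1 / of_nat (Suc n) powr s) sums f s)"
  show "f = zeta_cont"
  proof
    fix s
    show "f s = zeta_cont s"
    proof (cases "s = 1")
      case False
      show ?thesis
      proof (rule analytic_continuation_open[of "{s. Re s > 1}" "- {1}" f zeta_cont s])
        show "{s. Re s > 1} \<noteq> {}" by (auto intro!: exI[of _ 2])
        show "connected (- {1::complex})" by (rule connected_punctured_universe) simp
        show "f z = zeta_cont z" if "z \<in> {s. Re s > 1}" for z
          using f zeta_cont_sums[of z] that sums_unique2 by blast
      qed (use f False zeta_cont_holomorphic open_halfspace_Re_gt in auto)
    qed (use f in \<open>simp add: zeta_cont_def\<close>)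
  qed
qed

section \<open>Hardy's theorem: infinitely many zeros on the critical line\<close>

text \<open>The completed zeta function $\pi^{-s/2}\,\Gamma(s/2)\,\zeta(s)$ at $s = 1/2 + it$.\<close>

definition xi_line :: "real \<Rightarrow> real" where
  "xi_line t = (\<integral>u. theta_kernel u * cos (t * u) \<partial>lborel) - 1 / (1/4 + t\<^sup>2)"

lemma theta_kernel_cos_integrable: "integrable lborel (\<lambda>u. theta_kernel u * cos (t * u))"
  by (rule Bochner_Integration.integrable_bound[OF theta.abs_int[of 0]])
     (auto simp: abs_mult mult_left_le)

lemma theta_kernel_u_sin_integrable: "integrable lborel (\<lambda>u. theta_kernel u * u * sin (t * u))"
proof (rule Bochner_Integration.integrable_bound[OF theta.abs_int[of 1]])
  show "AE u in lborel. norm (theta_kernel u * u * sin (t * u)) \<le> norm (\<bar>theta_kernel u\<bar> * exp (1 * u))"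
  proof (rule AE_I2)
    fix u :: real
    show "norm (theta_kernel u * u * sin (t * u)) \<le> norm (\<bar>theta_kernel u\<bar> * exp (1 * u))"
    proof (cases "u < 0")
      case False
      hence "\<bar>u\<bar> * \<bar>sin (t * u)\<bar> \<le> exp u * 1" using theta.power_le[of u 1] by (intro mult_mono) auto
      hence "\<bar>theta_kernel u\<bar> * (\<bar>u\<bar> * \<bar>sin (t * u)\<bar>) \<le> \<bar>theta_kernel u\<bar> * exp u" by (intro mult_left_mono) auto
      thus ?thesis by (simp add: abs_mult mult_ac)
    qed (simp add: theta.neg)
  qed
qed measurable

lemma theta_mellin_line:
  "theta_mellin (\<i> * of_real t) = of_real (\<integral>u. theta_kernel u * cos (t * u) \<partial>lborel)"
proof -
  have "theta_mellin (\<i> * of_real t) = (\<integral>u. (of_real (theta_kernel u * u ^ 0) * exp (\<i> * of_real t * of_real u)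
     + of_real (theta_kernel u * u ^ 0) * exp (- (\<i> * of_real t) * of_real u)) / 2 \<partial>lborel)"
    unfolding theta_mellin_def theta.transform_def
    by (subst Bochner_Integration.integral_add[symmetric, OF theta.transform_integrable theta.transform_integrable]) simp
  also have "\<dots> = (\<integral>u. complex_of_real (theta_kernel u * cos (t * u)) \<partial>lborel)"
    by (intro Bochner_Integration.integral_cong refl)
       (simp add: cos_of_real[symmetric] cos_exp_eq mult_ac distrib_left)
  finally show ?thesis by (simp only: integral_complex_of_real)
qed

lemma theta_mellin_line_deriv:
  "(theta.transform 1 (\<i> * of_real t) - theta.transform 1 (- (\<i> * of_real t))) / 2 =
     \<i> * of_real (\<integral>u. theta_kernel u * u * sin (t * u) \<partial>lborel)"
proof -
  have "(theta.transform 1 (\<i> * of_real t) - theta.transform 1 (- (\<i> * of_real t))) / 2 =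
    (\<integral>u. (of_real (theta_kernel u * u ^ 1) * exp (\<i> * of_real t * of_real u)
     - of_real (theta_kernel u * u ^ 1) * exp (- (\<i> * of_real t) * of_real u)) / 2 \<partial>lborel)"
    unfolding theta.transform_def
    by (subst Bochner_Integration.integral_diff[symmetric, OF theta.transform_integrable theta.transform_integrable]) simp
  also have "\<dots> = (\<integral>u. \<i> * complex_of_real (theta_kernel u * u * sin (t * u)) \<partial>lborel)"
    by (intro Bochner_Integration.integral_cong refl)
       (simp add: sin_of_real[symmetric] sin_exp_eq field_simps)
  also have "\<dots> = \<i> * (\<integral>u. complex_of_real (theta_kernel u * u * sin (t * u)) \<partial>lborel)"
    by (rule integral_mult_right_zero)
  finally show ?thesis by (simp only: integral_complex_of_real)
qed

lemma zeta_cont_line: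
  assumes s: "s = Complex (1/2) t"
  shows "zeta_cont s = exp (s / 2 * of_real (ln pi)) * rGamma (s / 2) * of_real (xi_line t)"
proof -
  have s0: "s \<noteq> 0" "s \<noteq> 1" using s by (auto simp: complex_eq_iff)
  have ss: "s * (1 - s) = of_real (1/4 + t\<^sup>2)" by (simp add: s complex_eq_iff power2_eq_square field_simps)
  have "rGamma (s / 2 + 1) / (2 * (1 - s)) = rGamma (s / 2) / (s * (1 - s))"
    unfolding rGamma_plus1[of "s / 2", symmetric] using s0 by simp
  moreover have "s - 1/2 = \<i> * of_real t" by (simp add: s complex_eq_iff)
  ultimately have "zeta_cont s = exp (s / 2 * of_real (ln pi)) * (rGamma (s / 2) * theta_mellin (\<i> * of_real t) - rGamma (s / 2) / of_real (1/4 + t\<^sup>2))"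
    using s0 by (simp add: zeta_cont_def ss)
  thus ?thesis unfolding theta_mellin_line xi_line_def
    by (simp only: of_real_diff of_real_divide of_real_1) (simp only: right_diff_distrib mult.assoc times_divide_eq_right mult_1_right)
qed

text \<open>For v >= 0 the kernel is \<open>theta_kernel v / 2 - exp (- v / 2)\<close>. The
  exponential contributes -1/(1/2 - i t), and together with its mirror image this is the term
  -1/(1/4 + t^2) of \<open>xi_line\<close>.\<close>

lemma phi_kernel_fourier:
  "has_bochner_integral lborel (\<lambda>v. phi_kernel (of_real v) * exp (\<i> * of_real (t * v))) (of_real (xi_line t))"
proof -
  define X where "X = (\<lambda>a u. indicator {0..} u *\<^sub>R exp (- a * complex_of_real u))"
  define G where "G = (\<lambda>z u. complex_of_real (theta_kernel u * u ^ 0) * exp (z * of_real u))"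
  define P where "P = (\<lambda>t u. G (\<i> * of_real t) u / 2 - X (1/2 - \<i> * of_real t) u)"
  have G: "has_bochner_integral lborel (G z) (theta.transform 0 z)" for z
    unfolding G_def theta.transform_def has_bochner_integral_iff by (intro conjI refl theta.transform_integrable)
  have P: "has_bochner_integral lborel (P t) (theta.transform 0 (\<i> * of_real t) / 2 - 1 / (1/2 - \<i> * of_real t))" for t
    unfolding P_def X_def
    by (intro has_bochner_integral_diff has_bochner_integral_divide_zero exp_half_line_integral G) auto
  have "has_bochner_integral lborel (\<lambda>u. P (-t) (0 + (-1) * u)) ((theta.transform 0 (\<i> * of_real (-t)) / 2 - 1 / (1/2 - \<i> * of_real (-t))) /\<^sub>R \<bar>-1\<bar>)"
    using P[of "-t"] by (subst (asm) lborel_has_bochner_integral_real_affine_iff[where c = "-1" and t = 0]) auto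
  from has_bochner_integral_add[OF P[of t] this]
  have "has_bochner_integral lborel (\<lambda>u. P t u + P (-t) (-u))
     (theta_mellin (\<i> * of_real t) - (1 / (1/2 - \<i> * of_real t) + 1 / (1/2 + \<i> * of_real t)))"
    by (simp add: theta_mellin_def add_divide_distrib algebra_simps)
  also have "1 / (1/2 - \<i> * of_real t) + 1 / (1/2 + \<i> * of_real t) = of_real (1 / (1/4 + t\<^sup>2))"
  proof -
    have n: "1/2 - \<i> * of_real t \<noteq> 0" "1/2 + \<i> * of_real t \<noteq> 0" by (auto simp: complex_eq_iff)
    have "(1/2 - \<i> * of_real t) * (1/2 + \<i> * of_real t) = of_real (1/4 + t\<^sup>2)"
      by (simp add: complex_eq_iff power2_eq_square)
    moreover have "1 / a + 1 / b = (a + b) / (a * b)" if "a \<noteq> 0" "b \<noteq> 0" for a b :: complex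
      using that by (simp add: field_simps)
    ultimately show ?thesis using n by simp
  qed
  also have "theta_mellin (\<i> * of_real t) - of_real (1 / (1/4 + t\<^sup>2)) = of_real (xi_line t)"
    by (simp add: theta_mellin_line xi_line_def)
  finally have R: "has_bochner_integral lborel (\<lambda>u. P t u + P (-t) (-u)) (of_real (xi_line t))" .
  have pos: "P t v = phi_kernel (of_real v) * exp (\<i> * of_real (t * v))" if "v \<ge> 0" for v t
  proof -
    have e: "- (1/2 - \<i> * of_real t) * complex_of_real v = - of_real v / 2 + \<i> * of_real (t * v)"
      by (simp add: algebra_simps)
    have "X (1/2 - \<i> * of_real t) v = exp (- of_real v / 2) * exp (\<i> * of_real (t * v))"
      unfolding X_def e exp_add using that by simp
    moreover have "G (\<i> * of_real t) v / 2 = (phi_kernel (of_real v) + exp (- of_real v / 2)) * exp (\<i> * of_real (t * v))"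
      unfolding G_def using theta_kernel_complex(2)[OF that] by (simp add: mult.assoc)
    ultimately show ?thesis unfolding P_def by (simp only: distrib_right add_diff_cancel_right')
  qed
  have eq: "phi_kernel (of_real v) * exp (\<i> * of_real (t * v)) = P t v + P (-t) (-v)" if "v \<noteq> 0" for v
  proof (cases "v > 0")
    case True
    hence "P (-t) (-v) = 0" by (simp add: P_def G_def X_def theta.neg)
    thus ?thesis using pos[of v t] True by simp
  next
    case False
    hence "P t v = 0" using that by (simp add: P_def G_def X_def theta.neg)
    thus ?thesis using pos[of "-v" "-t"] False phi_kernel_minus[of "of_real v"] by simp
  qed
  have [measurable]: "(\<lambda>v. phi_kernel (of_real v)) \<in> borel_measurable borel"
    using continuous_on_phi_kernel_line[of 0] by (intro borel_measurable_continuous_onI) (simp add: complex_of_real_def)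
  have "AE v in lborel. v \<noteq> (0::real)" by (rule AE_lborel_singleton)
  hence "AE v in lborel. P t v + P (-t) (-v) = phi_kernel (of_real v) * exp (\<i> * of_real (t * v))"
    by eventually_elim (use eq in auto)
  thus ?thesis
    by (rule has_bochner_integralI_AE[rotated, OF _ _ R] has_bochner_integral_cong_AE[THEN iffD1, rotated 2, OF _ R])
      (auto simp: P_def G_def X_def)
qed

section \<open>Contour shift and Fourier inversion for \<open>phi_kernel\<close>\<close>

lemma symmetric_interval_integral_tendsto:
  fixes f :: "real \<Rightarrow> 'a :: {banach, second_countable_topology}"
  assumes "integrable lborel f"
  shows "((\<lambda>R. LINT x:{-R..R}|lborel. f x) \<longlongrightarrow> (\<integral>x. f x \<partial>lborel)) at_top"
  unfolding set_lebesgue_integral_def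
proof (rule integral_dominated_convergence_at_top[where w = "\<lambda>x. norm (f x)"])
  show "\<forall>\<^sub>F R in at_top. AE x in lborel. norm (indicat_real {-R..R} x *\<^sub>R f x) \<le> norm (f x)"
    by (intro always_eventually allI AE_I2) (auto simp: indicator_def)
  show "AE x in lborel. ((\<lambda>R. indicat_real {-R..R} x *\<^sub>R f x) \<longlongrightarrow> f x) at_top"
  proof (rule AE_I2, rule tendsto_eventually)
    fix x :: real
    show "\<forall>\<^sub>F R in at_top. indicat_real {-R..R} x *\<^sub>R f x = f x"
      using eventually_ge_at_top[of "\<bar>x\<bar>"] by eventually_elim (auto simp: indicator_def)
  qed
qed (use assms in auto)

lemma exp_decay_integrable: "integrable lborel (\<lambda>v::real. exp (- \<bar>v\<bar> / 2))"
proof -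
  have 1: "integrable lborel (\<lambda>u. indicator {0..} u *\<^sub>R exp (- (1/2) * complex_of_real u))"
    using exp_half_line_integral[of "1/2"] by (simp add: has_bochner_integral_iff)
  from lborel_integrable_real_affine[OF integrable_norm[OF 1], of "-1" 0]
  have "integrable lborel (\<lambda>u. norm (indicator {0..} (-u) *\<^sub>R exp (- (1/2) * complex_of_real (-u))))" by simp
  from Bochner_Integration.integrable_add[OF integrable_norm[OF 1] this]
  show ?thesis by (rule Bochner_Integration.integrable_bound) (auto simp: norm_exp_eq_Re indicator_def)
qed

lemma phi_kernel_line_integrable:
  assumes a: "\<bar>a\<bar> < pi / 4"
  shows "integrable lborel (\<lambda>v. phi_kernel (Complex v a) * exp (\<i> * of_real (t * v)))"
    and "(\<lambda>v. phi_kernel (Complex v a)) \<in> borel_measurable borel"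
proof -
  show [measurable]: "(\<lambda>v. phi_kernel (Complex v a)) \<in> borel_measurable borel"
    by (intro borel_measurable_continuous_onI continuous_on_phi_kernel_line a)
  obtain C where C: "C \<ge> 0" "\<And>u. \<bar>Im u\<bar> \<le> \<bar>a\<bar> \<Longrightarrow> norm (phi_kernel u) \<le> C * exp (- \<bar>Re u\<bar> / 2)"
    using phi_kernel_bound[of "\<bar>a\<bar>"] a by auto
  show "integrable lborel (\<lambda>v. phi_kernel (Complex v a) * exp (\<i> * of_real (t * v)))"
    by (rule Bochner_Integration.integrable_bound[OF integrable_mult_right[OF exp_decay_integrable, of C]])
       (use C(1) C(2)[of "Complex _ a"] in \<open>auto simp: norm_mult norm_exp_eq_Re\<close>)
qed

text \<open>Moving the line of integration to Im = a replaces exp (i t v) by exp (i t v) exp (- a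
  t). It follows that \<open>xi_line\<close> decays like exp (- a t) for every a < pi/4, and that
  the kernel near the edge of the strip is visible in it.\<close>

lemma phi_kernel_shifted_fourier:
  assumes a: "\<bar>a\<bar> < pi / 4"
  shows "(\<integral>v. phi_kernel (Complex v a) * exp (\<i> * of_real (t * v)) \<partial>lborel) = of_real (exp (a * t) * xi_line t)"
proof -
  let ?S = "{u. \<bar>Im u\<bar> < pi / 4}"
  define F where "F = (\<lambda>z. phi_kernel z * exp (\<i> * of_real t * z))"
  have S: "?S = {u. Im u < pi / 4} \<inter> {u. Im u > - (pi / 4)}" by auto
  have oS: "open ?S" unfolding S by (intro open_Int open_halfspace_Im_lt open_halfspace_Im_gt)
  have cS: "convex ?S" unfolding S by (intro convex_Int convex_halfspace_Im_lt convex_halfspace_Im_gt)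
  have hF: "F holomorphic_on ?S" unfolding F_def by (intro holomorphic_intros phi_kernel_holomorphic)
  \<comment> \<open>With a primitive on the convex strip both horizontal integrals are differences
    of values of P, and comparing them leaves only the two vertical sides.\<close>
  obtain P where P: "\<And>z. z \<in> ?S \<Longrightarrow> (P has_field_derivative F z) (at z)"
    using holomorphic_convex_primitive'[OF cS oS hF] at_within_open[OF _ oS] by metis
  obtain C where C: "C \<ge> 0" "\<And>u. \<bar>Im u\<bar> \<le> \<bar>a\<bar> \<Longrightarrow> norm (phi_kernel u) \<le> C * exp (- \<bar>Re u\<bar> / 2)"
    using phi_kernel_bound[of "\<bar>a\<bar>"] a by auto
  have line: "(LINT v:{-R..R}|lborel. F (Complex v b)) = P (Complex R b) - P (Complex (-R) b)"
    if b: "\<bar>b\<bar> < pi / 4" and R: "R \<ge> 0" for b R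
  proof -
    have "((\<lambda>v. F (Complex v b)) has_integral (P (Complex R b) - P (Complex (-R) b))) {-R..R}"
    proof (rule fundamental_theorem_of_calculus)
      fix v assume "v \<in> {-R..R}"
      have "((\<lambda>v. Complex v b) has_vector_derivative 1) (at v within {-R..R})"
        unfolding Complex_eq by (auto intro!: derivative_eq_intros)
      from field_vector_diff_chain_within[OF this, of P] P[of "Complex v b"] b
      show "((\<lambda>v. P (Complex v b)) has_vector_derivative F (Complex v b)) (at v within {-R..R})"
        by (auto simp: o_def intro: has_field_derivative_at_within)
    qed (use R in auto)
    moreover have "(LINT v:{-R..R}|lborel. F (Complex v b)) = integral {-R..R} (\<lambda>v. F (Complex v b))"
    proof (intro set_borel_integral_eq_integral borel_integrable_atLeastAtMost')
      have "continuous_on {-R..R} (\<lambda>v. exp (\<i> * of_real t * Complex v b))"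
        unfolding Complex_eq by (intro continuous_intros)
      thus "continuous_on {-R..R} (\<lambda>v. F (Complex v b))" unfolding F_def
        by (intro continuous_on_mult continuous_on_subset[OF continuous_on_phi_kernel_line[OF b]]) auto
    qed
    ultimately show ?thesis by (simp add: integral_unique)
  qed
  have side: "norm (P (Complex x a) - P (Complex x 0)) \<le> C * exp (- \<bar>x\<bar> / 2) * exp \<bar>t * a\<bar> * \<bar>a\<bar>" for x
  proof -
    define Z where "Z = closed_segment (Complex x 0) (Complex x a)"
    have Z: "Re z = x" "\<bar>Im z\<bar> \<le> \<bar>a\<bar>" if zZ: "z \<in> Z" for z
    proof -
      obtain u where u: "0 \<le> u" "u \<le> 1" "z = (1 - u) *\<^sub>R Complex x 0 + u *\<^sub>R Complex x a"
        using zZ unfolding Z_def closed_segment_def by blast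
      have "Re z = (1 - u) * x + u * x" "Im z = u * a" by (simp_all add: u(3))
      thus "Re z = x" "\<bar>Im z\<bar> \<le> \<bar>a\<bar>" using u(1,2) by (auto simp: algebra_simps abs_mult mult_left_le_one_le)
    qed
    have "norm (P (Complex x a) - P (Complex x 0)) \<le> (C * exp (- \<bar>x\<bar> / 2) * exp \<bar>t * a\<bar>) * norm (Complex x a - Complex x 0)"
    proof (rule field_differentiable_bound[where S = Z and f' = F])
      fix z assume z: "z \<in> Z"
      show "(P has_field_derivative F z) (at z within Z)"
        using P[of z] Z[OF z] a by (auto intro: has_field_derivative_at_within)
      have "- (t * Im z) \<le> \<bar>t\<bar> * \<bar>Im z\<bar>" using abs_ge_minus_self[of "t * Im z"] by (simp only: abs_mult)
      also have "\<dots> \<le> \<bar>t * a\<bar>" unfolding abs_mult by (intro mult_left_mono Z(2)[OF z]) auto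
      finally have "- (t * Im z) \<le> \<bar>t * a\<bar>" .
      hence "norm (phi_kernel z) * exp (- (t * Im z)) \<le> (C * exp (- \<bar>x\<bar> / 2)) * exp \<bar>t * a\<bar>"
        using C(1) C(2)[of z] Z[OF z] by (intro mult_mono mult_nonneg_nonneg) auto
      thus "norm (F z) \<le> C * exp (- \<bar>x\<bar> / 2) * exp \<bar>t * a\<bar>"
        by (simp add: F_def norm_mult norm_exp_eq_Re)
    qed (auto simp: Z_def)
    also have "Complex x a - Complex x 0 = \<i> * of_real a" by (simp add: complex_eq_iff)
    finally show ?thesis by (simp add: norm_mult)
  qed
  have eF: "F (Complex v b) = exp (- (t * b)) * (phi_kernel (Complex v b) * exp (\<i> * of_real (t * v)))" for v b
  proof -
    have "\<i> * of_real t * Complex v b = of_real (- (t * b)) + \<i> * of_real (t * v)" by (simp add: complex_eq_iff)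
    thus ?thesis unfolding F_def by (simp only: exp_add exp_of_real) simp
  qed
  have intF: "integrable lborel (\<lambda>v. F (Complex v b))" if "\<bar>b\<bar> < pi / 4" for b
    unfolding eF by (intro integrable_mult_right phi_kernel_line_integrable that)
  have "((\<lambda>R. (LINT v:{-R..R}|lborel. F (Complex v a)) - (LINT v:{-R..R}|lborel. F (Complex v 0))) \<longlongrightarrow>
      (\<integral>v. F (Complex v a) \<partial>lborel) - (\<integral>v. F (Complex v 0) \<partial>lborel)) at_top"
    by (intro tendsto_diff symmetric_interval_integral_tendsto intF a) simp
  moreover have "((\<lambda>R. (LINT v:{-R..R}|lborel. F (Complex v a)) - (LINT v:{-R..R}|lborel. F (Complex v 0))) \<longlongrightarrow> 0) at_top"
  proof (rule Lim_null_comparison)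
    show "\<forall>\<^sub>F R in at_top. norm ((LINT v:{-R..R}|lborel. F (Complex v a)) - (LINT v:{-R..R}|lborel. F (Complex v 0)))
        \<le> 2 * (C * exp (- R / 2) * exp \<bar>t * a\<bar> * \<bar>a\<bar>)"
      using eventually_ge_at_top[of 0]
    proof eventually_elim
      case (elim R)
      have "(LINT v:{-R..R}|lborel. F (Complex v a)) - (LINT v:{-R..R}|lborel. F (Complex v 0)) =
         (P (Complex R a) - P (Complex R 0)) - (P (Complex (-R) a) - P (Complex (-R) 0))"
        using line[OF a elim] line[of 0 R] elim by simp
      also have "norm \<dots> \<le> norm (P (Complex R a) - P (Complex R 0)) + norm (P (Complex (-R) a) - P (Complex (-R) 0))"
        by (rule norm_triangle_ineq4)
      finally show ?case using side[of R] side[of "-R"] elim by simp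
    qed
    have "((\<lambda>R::real. exp (- R / 2)) \<longlongrightarrow> 0) at_top" by real_asymp
    from tendsto_mult_left[OF this, of "2 * C * exp \<bar>t * a\<bar> * \<bar>a\<bar>"]
    show "((\<lambda>R. 2 * (C * exp (- R / 2) * exp \<bar>t * a\<bar> * \<bar>a\<bar>)) \<longlongrightarrow> 0) at_top" by (simp add: mult_ac)
  qed
  ultimately have "(\<integral>v. F (Complex v a) \<partial>lborel) - (\<integral>v. F (Complex v 0) \<partial>lborel) = 0"
    by (rule tendsto_unique[rotated]) simp
  moreover have "(\<integral>v. F (Complex v 0) \<partial>lborel) = of_real (xi_line t)"
    using phi_kernel_fourier[of t] unfolding eF by (simp add: has_bochner_integral_iff flip: complex_of_real_def)
  ultimately have "of_real (exp (- (t * a))) * (\<integral>v. phi_kernel (Complex v a) * exp (\<i> * of_real (t * v)) \<partial>lborel) = of_real (xi_line t)"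
    unfolding eF by simp
  hence "of_real (exp (a * t)) * (of_real (exp (- (t * a))) * (\<integral>v. phi_kernel (Complex v a) * exp (\<i> * of_real (t * v)) \<partial>lborel)) = of_real (exp (a * t)) * of_real (xi_line t)"
    by (simp only:)
  moreover have "complex_of_real (exp (a * t)) * of_real (exp (- (t * a))) = 1"
    by (simp add: exp_minus mult.commute flip: of_real_mult)
  ultimately show ?thesis by (simp add: mult.assoc[symmetric])
qed

lemma gaussian_integral:
  "has_bochner_integral lborel (\<lambda>w. complex_of_real (exp (- w\<^sup>2))) (of_real (sqrt pi))"
  using gaussian_fourier[of 1 0] by simp

lemma gaussian_integrable: "a > 0 \<Longrightarrow> integrable lborel (\<lambda>x::real. exp (- a * x\<^sup>2))"
  using gaussian_fourier[of a 0] integrable_norm[of lborel "\<lambda>x. complex_of_real (exp (- a * x\<^sup>2))"]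
  by (simp add: has_bochner_integral_iff)

lemma xi_line_continuous: "continuous_on A xi_line"
proof -
  have "continuous_on A (\<lambda>t. Re (theta_mellin (\<i> * of_real t)) - 1 / (1/4 + t\<^sup>2))"
    by (intro continuous_intros continuous_on_compose2[OF holomorphic_on_imp_continuous_on[OF theta_mellin_holomorphic[of "\<lambda>z. z" UNIV]]])
       (auto intro!: continuous_intros holomorphic_intros simp: sum_power2_eq_zero_iff add_nonneg_eq_0_iff)
  thus ?thesis unfolding theta_mellin_line by (simp add: xi_line_def[abs_def])
qed

lemma xi_line_even: "xi_line (- t) = xi_line t"
  by (simp add: xi_line_def)

lemma xi_line_exp_bounded:
  assumes "\<bar>a\<bar> < pi / 4"
  obtains B where "B \<ge> 0" "\<And>t. \<bar>exp (a * t) * xi_line t\<bar> \<le> B"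
proof
  let ?B = "\<integral>v. norm (phi_kernel (Complex v a)) \<partial>lborel"
  show "?B \<ge> 0" by (rule Bochner_Integration.integral_nonneg) auto
  fix t
  have "\<bar>exp (a * t) * xi_line t\<bar> = norm (\<integral>v. phi_kernel (Complex v a) * exp (\<i> * of_real (t * v)) \<partial>lborel)"
    unfolding phi_kernel_shifted_fourier[OF assms] by (simp only: norm_of_real)
  also have "\<dots> \<le> (\<integral>v. norm (phi_kernel (Complex v a) * exp (\<i> * of_real (t * v))) \<partial>lborel)"
    by (rule integral_norm_bound)
  also have "\<dots> = ?B" by (simp add: norm_mult norm_exp_eq_Re)
  finally show "\<bar>exp (a * t) * xi_line t\<bar> \<le> ?B" .
qed

text \<open>Fourier inversion damped by a Gaussian. By Fubini it becomes the convolution of the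
  kernel with an approximate identity of width h; the coefficient h^2 / 4 is the one whose transform
  is exp (- (v - y)^2 / h^2).\<close>

lemma phi_kernel_regularised:
  assumes a: "\<bar>a\<bar> < pi / 4" and h: "h > 0"
  shows "(\<integral>t. of_real (exp (a * t) * xi_line t * exp (- (h\<^sup>2 / 4) * t\<^sup>2)) * exp (- (\<i> * of_real (y * t))) \<partial>lborel)
     = of_real (2 * sqrt pi) * (\<integral>w. phi_kernel (Complex (y + h * w) a) * of_real (exp (- w\<^sup>2)) \<partial>lborel)"
proof -
  define e where "e = h\<^sup>2 / 4"
  have e: "e > 0" using h by (simp add: e_def)
  define f where "f = (\<lambda>v t. phi_kernel (Complex v a) * (complex_of_real (exp (- e * t\<^sup>2)) * exp (\<i> * of_real (t * (v - y)))))"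
  note [measurable] = phi_kernel_line_integrable(2)[OF a]
  have int1: "integrable lborel (\<lambda>v. phi_kernel (Complex v a))"
    using phi_kernel_line_integrable(1)[OF a, of 0] by simp
  have g: "has_bochner_integral lborel (\<lambda>t. complex_of_real (exp (- e * t\<^sup>2)) * exp (\<i> * of_real (t * z)))
       (of_real (sqrt (pi / e) * exp (- z\<^sup>2 / (4 * e))))" for z
    by (rule gaussian_fourier[OF e])
  have "integrable (lborel \<Otimes>\<^sub>M lborel) (case_prod f)"
  proof (rule lborel_pair.Fubini_integrable)
    show "case_prod f \<in> borel_measurable (lborel \<Otimes>\<^sub>M lborel)" unfolding f_def by measurable
    have "(\<integral>t. norm (case_prod f (v, t)) \<partial>lborel) = norm (phi_kernel (Complex v a)) * (\<integral>t. exp (- e * t\<^sup>2) \<partial>lborel)" for v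
      by (simp add: f_def norm_mult norm_exp_eq_Re)
    thus "integrable lborel (\<lambda>v. \<integral>t. norm (case_prod f (v, t)) \<partial>lborel)"
      using int1 by simp
    show "AE v in lborel. integrable lborel (\<lambda>t. case_prod f (v, t))"
      unfolding f_def case_prod_conv
      by (intro AE_I2 integrable_mult_right) (use g in \<open>simp only: has_bochner_integral_iff\<close>)
  qed
  hence "(\<integral>t. (\<integral>v. f v t \<partial>lborel) \<partial>lborel) = (\<integral>v. (\<integral>t. f v t \<partial>lborel) \<partial>lborel)"
    by (rule lborel_pair.Fubini_integral)
  also have "(\<lambda>t. \<integral>v. f v t \<partial>lborel) = (\<lambda>t. of_real (exp (a * t) * xi_line t * exp (- e * t\<^sup>2)) * exp (- (\<i> * of_real (y * t))))"
  proof
    fix t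
    have "(\<integral>v. f v t \<partial>lborel) = (\<integral>v. (of_real (exp (- e * t\<^sup>2)) * exp (- (\<i> * of_real (y * t)))) *
         (phi_kernel (Complex v a) * exp (\<i> * of_real (t * v))) \<partial>lborel)"
    proof (intro Bochner_Integration.integral_cong refl)
      fix v
      have "\<i> * of_real (t * (v - y)) = \<i> * of_real (t * v) + (- (\<i> * complex_of_real (y * t)))" by (simp add: algebra_simps)
      hence "exp (\<i> * of_real (t * (v - y))) = exp (\<i> * of_real (t * v)) * exp (- (\<i> * complex_of_real (y * t)))"
        by (simp only: exp_add)
      thus "f v t = (of_real (exp (- e * t\<^sup>2)) * exp (- (\<i> * of_real (y * t)))) * (phi_kernel (Complex v a) * exp (\<i> * of_real (t * v)))"
        unfolding f_def by (simp only: mult_ac)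
    qed
    also have "\<dots> = (of_real (exp (- e * t\<^sup>2)) * exp (- (\<i> * of_real (y * t)))) * of_real (exp (a * t) * xi_line t)"
      by (subst integral_mult_right_zero) (simp only: phi_kernel_shifted_fourier[OF a])
    finally show "(\<integral>v. f v t \<partial>lborel) = of_real (exp (a * t) * xi_line t * exp (- e * t\<^sup>2)) * exp (- (\<i> * of_real (y * t)))"
      by (simp only: of_real_mult mult_ac)
  qed
  also have "(\<lambda>v. \<integral>t. f v t \<partial>lborel) = (\<lambda>v. phi_kernel (Complex v a) * of_real (sqrt (pi / e) * exp (- (v - y)\<^sup>2 / (4 * e))))"
  proof
    fix v
    show "(\<integral>t. f v t \<partial>lborel) = phi_kernel (Complex v a) * of_real (sqrt (pi / e) * exp (- (v - y)\<^sup>2 / (4 * e)))"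
      unfolding f_def using g[of "v - y"] by (subst integral_mult_right_zero) (simp add: has_bochner_integral_iff)
  qed
  also have "(\<integral>v. phi_kernel (Complex v a) * of_real (sqrt (pi / e) * exp (- (v - y)\<^sup>2 / (4 * e))) \<partial>lborel) =
      \<bar>h\<bar> *\<^sub>R (\<integral>w. phi_kernel (Complex (y + h * w) a) * of_real (sqrt (pi / e) * exp (- ((y + h * w) - y)\<^sup>2 / (4 * e))) \<partial>lborel)"
    by (rule lborel_integral_real_affine) (use h in auto)
  also have "(\<lambda>w. phi_kernel (Complex (y + h * w) a) * of_real (sqrt (pi / e) * exp (- ((y + h * w) - y)\<^sup>2 / (4 * e)))) =
     (\<lambda>w. of_real (2 * sqrt pi / h) * (phi_kernel (Complex (y + h * w) a) * of_real (exp (- w\<^sup>2))))"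
  proof
    fix w
    have "sqrt (pi / e) = 2 * sqrt pi / h" using h by (simp add: e_def real_sqrt_divide real_sqrt_mult)
    moreover have "- ((y + h * w) - y)\<^sup>2 / (4 * e) = - w\<^sup>2" using h by (simp add: e_def power_mult_distrib)
    ultimately show "phi_kernel (Complex (y + h * w) a) * of_real (sqrt (pi / e) * exp (- ((y + h * w) - y)\<^sup>2 / (4 * e))) =
      of_real (2 * sqrt pi / h) * (phi_kernel (Complex (y + h * w) a) * of_real (exp (- w\<^sup>2)))"
      by (simp only: of_real_mult mult_ac)
  qed
  also have "\<bar>h\<bar> *\<^sub>R (\<integral>w. of_real (2 * sqrt pi / h) * (phi_kernel (Complex (y + h * w) a) * of_real (exp (- w\<^sup>2))) \<partial>lborel) =
     of_real (2 * sqrt pi) * (\<integral>w. phi_kernel (Complex (y + h * w) a) * of_real (exp (- w\<^sup>2)) \<partial>lborel)"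
    unfolding integral_mult_right_zero using h by (simp add: scaleR_conv_of_real)
  finally show ?thesis unfolding e_def .
qed

text \<open>Width h = 1/(n+1) tending to 0. The damped integrals stay in the statement because the
  positivity argument compares them at each fixed n.\<close>

lemma phi_kernel_inversion:
  assumes a: "\<bar>a\<bar> < pi / 4"
  shows "(\<lambda>n. \<integral>t. of_real (exp (a * t) * xi_line t * exp (- ((1 / real (Suc n))\<^sup>2 / 4) * t\<^sup>2)) * exp (- (\<i> * of_real (y * t))) \<partial>lborel)
           \<longlonglongrightarrow> of_real (2 * pi) * phi_kernel (Complex y a)"
proof -
  obtain C where C: "C \<ge> 0" "\<And>u. \<bar>Im u\<bar> \<le> \<bar>a\<bar> \<Longrightarrow> norm (phi_kernel u) \<le> C * exp (- \<bar>Re u\<bar> / 2)"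
    using phi_kernel_bound[of "\<bar>a\<bar>"] a by auto
  have Cb: "norm (phi_kernel (Complex v a)) \<le> C" for v
  proof -
    have "norm (phi_kernel (Complex v a)) \<le> C * exp (- \<bar>v\<bar> / 2)" using C(2)[of "Complex v a"] by simp
    also have "\<dots> \<le> C * 1" using C(1) by (intro mult_left_mono) auto
    finally show ?thesis by simp
  qed
  note [measurable] = phi_kernel_line_integrable(2)[OF a]
  have cont: "continuous_on UNIV (\<lambda>v. phi_kernel (Complex v a))" by (rule continuous_on_phi_kernel_line[OF a])
  have "(\<lambda>n. \<integral>w. phi_kernel (Complex (y + 1 / real (Suc n) * w) a) * complex_of_real (exp (- w\<^sup>2)) \<partial>lborel)
      \<longlonglongrightarrow> (\<integral>w. phi_kernel (Complex y a) * complex_of_real (exp (- w\<^sup>2)) \<partial>lborel)"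
  proof (rule integral_dominated_convergence[where w = "\<lambda>w. C * exp (- 1 * w\<^sup>2)"])
    show "integrable lborel (\<lambda>w. C * exp (- 1 * w\<^sup>2))" by (intro integrable_mult_right gaussian_integrable) simp
    show "AE w in lborel. (\<lambda>n. phi_kernel (Complex (y + 1 / real (Suc n) * w) a) * complex_of_real (exp (- w\<^sup>2)))
        \<longlonglongrightarrow> phi_kernel (Complex y a) * complex_of_real (exp (- w\<^sup>2))"
    proof (rule AE_I2, rule tendsto_mult_right)
      fix w :: real
      have "(\<lambda>n. y + 1 / real (Suc n) * w) \<longlonglongrightarrow> y" by real_asymp
      thus "(\<lambda>n. phi_kernel (Complex (y + 1 / real (Suc n) * w) a)) \<longlonglongrightarrow> phi_kernel (Complex y a)"
        by (rule continuous_on_tendsto_compose[OF cont]) auto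
    qed
    show "AE w in lborel. norm (phi_kernel (Complex (y + 1 / real (Suc n) * w) a) * complex_of_real (exp (- w\<^sup>2))) \<le> C * exp (- 1 * w\<^sup>2)" for n
      by (intro AE_I2) (simp add: norm_mult Cb mult_right_mono)
  qed measurable
  also have "(\<integral>w. phi_kernel (Complex y a) * complex_of_real (exp (- w\<^sup>2)) \<partial>lborel) = phi_kernel (Complex y a) * of_real (sqrt pi)"
    using gaussian_integral by (subst integral_mult_right_zero) (simp only: has_bochner_integral_iff)
  finally have "(\<lambda>n. of_real (2 * sqrt pi) * (\<integral>w. phi_kernel (Complex (y + 1 / real (Suc n) * w) a) * complex_of_real (exp (- w\<^sup>2)) \<partial>lborel))
      \<longlonglongrightarrow> of_real (2 * sqrt pi) * (phi_kernel (Complex y a) * of_real (sqrt pi))"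
    by (rule tendsto_mult_left)
  moreover have "of_real (2 * sqrt pi) * (phi_kernel (Complex y a) * of_real (sqrt pi)) = of_real (2 * pi) * phi_kernel (Complex y a)"
  proof -
    have "of_real (2 * sqrt pi) * (phi_kernel (Complex y a) * of_real (sqrt pi)) = of_real (2 * (sqrt pi * sqrt pi)) * phi_kernel (Complex y a)"
      by (simp only: of_real_mult mult_ac)
    thus ?thesis by simp
  qed
  moreover have "(\<lambda>n. \<integral>t. of_real (exp (a * t) * xi_line t * exp (- ((1 / real (Suc n))\<^sup>2 / 4) * t\<^sup>2)) * exp (- (\<i> * of_real (y * t))) \<partial>lborel) =
     (\<lambda>n. of_real (2 * sqrt pi) * (\<integral>w. phi_kernel (Complex (y + 1 / real (Suc n) * w) a) * complex_of_real (exp (- w\<^sup>2)) \<partial>lborel))"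
    by (rule ext, rule phi_kernel_regularised[OF a]) simp
  ultimately show ?thesis by (simp only:)
qed

text \<open>The Fourier transform of a nonnegative function is largest in modulus at 0. The range
  where the sign is not known is bounded and adds a constant.\<close>

lemma phi_kernel_bound_if_eventually_signed:
  assumes T: "T \<ge> 0" and \<sigma>: "\<bar>\<sigma>\<bar> = 1" and sgn: "\<And>t. \<bar>t\<bar> \<ge> T \<Longrightarrow> \<sigma> * xi_line t \<ge> 0"
  obtains D where "\<And>a y. 0 \<le> a \<Longrightarrow> a < pi / 4 \<Longrightarrow> norm (phi_kernel (Complex y a)) \<le> norm (phi_kernel (Complex 0 a)) + D"
proof -
  obtain B where B: "B \<ge> 0" "\<And>t. \<bar>xi_line t\<bar> \<le> B" using xi_line_exp_bounded[of 0] by auto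
  \<comment> \<open>Where the sign is unknown, |f| <= \<sigma> f + 2 |f| with |f| at most B exp T,
    on an interval of length 2 T.\<close>
  define D' where "D' = 4 * T * (B * exp T)"
  have [measurable]: "xi_line \<in> borel_measurable borel"
    by (intro borel_measurable_continuous_onI xi_line_continuous)
  have ind: "integrable lborel (indicator {-T..T} :: real \<Rightarrow> real)" by (rule integrable_real_indicator) (use T in auto)
  have indI: "(\<integral>t. indicator {-T..T} t \<partial>lborel) = (2 * T :: real)" using T by simp
  have main: "2 * pi * norm (phi_kernel (Complex y a)) \<le> 2 * pi * norm (phi_kernel (Complex 0 a)) + D'"
    if a: "0 \<le> a" "a < pi / 4" for a y
  proof -
    have a': "\<bar>a\<bar> < pi / 4" using a by simp
    \<comment> \<open>This makes exp (a t) at most exp T on the bounded range for all admissible a,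
      so the final constant does not depend on a.\<close>
    have a1: "a \<le> 1" using a pi_less_4 by simp
    define f where "f = (\<lambda>n t. exp (a * t) * xi_line t * exp (- ((1 / real (Suc n))\<^sup>2 / 4) * t\<^sup>2))"
    define J where "J = (\<lambda>n y. \<integral>t. of_real (f n t) * exp (- (\<i> * of_real (y * t))) \<partial>lborel)"
    obtain Ba where Ba: "Ba \<ge> 0" "\<And>t. \<bar>exp (a * t) * xi_line t\<bar> \<le> Ba" using xi_line_exp_bounded[OF a'] by auto
    have fint: "integrable lborel (f n)" for n
    proof (rule Bochner_Integration.integrable_bound)
      show "integrable lborel (\<lambda>t. Ba * exp (- ((1 / real (Suc n))\<^sup>2 / 4) * t\<^sup>2))"
        by (intro integrable_mult_right gaussian_integrable) simp
      show "AE t in lborel. norm (f n t) \<le> norm (Ba * exp (- ((1 / real (Suc n))\<^sup>2 / 4) * t\<^sup>2))"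
      proof (rule AE_I2)
        fix t
        have "\<bar>exp (a * t) * xi_line t\<bar> * exp (- ((1 / real (Suc n))\<^sup>2 / 4) * t\<^sup>2) \<le> Ba * exp (- ((1 / real (Suc n))\<^sup>2 / 4) * t\<^sup>2)"
          by (intro mult_right_mono Ba) auto
        thus "norm (f n t) \<le> norm (Ba * exp (- ((1 / real (Suc n))\<^sup>2 / 4) * t\<^sup>2))"
          using Ba(1) by (simp add: f_def abs_mult)
      qed
    qed (unfold f_def, measurable)
    have "norm (J n y) \<le> norm (J n 0) + D'" for n
    proof -
      have "norm (J n y) \<le> (\<integral>t. norm (of_real (f n t) * exp (- (\<i> * of_real (y * t)))) \<partial>lborel)"
        unfolding J_def by (rule integral_norm_bound)
      also have "\<dots> = (\<integral>t. \<bar>f n t\<bar> \<partial>lborel)" by (simp add: norm_mult norm_exp_eq_Re)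
      also have "\<dots> \<le> (\<integral>t. \<sigma> * f n t + (2 * (B * exp T)) * indicator {-T..T} t \<partial>lborel)"
      proof (rule integral_mono)
        fix t
        show "\<bar>f n t\<bar> \<le> \<sigma> * f n t + (2 * (B * exp T)) * indicator {-T..T} t"
        proof (cases "\<bar>t\<bar> \<ge> T")
          case True
          have "\<sigma> * f n t = (\<sigma> * xi_line t) * (exp (a * t) * exp (- ((1 / real (Suc n))\<^sup>2 / 4) * t\<^sup>2))"
            unfolding f_def by (simp only: mult_ac)
          moreover have "0 \<le> exp (a * t) * exp (- ((1 / real (Suc n))\<^sup>2 / 4) * t\<^sup>2)" by simp
          ultimately have "\<sigma> * f n t \<ge> 0" using mult_nonneg_nonneg[OF sgn[OF True]] by (simp only:)
          hence "\<bar>f n t\<bar> = \<sigma> * f n t" using \<sigma> by (metis abs_mult abs_of_nonneg mult_1)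
          moreover have "2 * (B * exp T) * indicator {-T..T} t \<ge> 0" using B by simp
          ultimately show ?thesis by linarith
        next
          case False
          have "a * t \<le> 1 * T" using False a a1 T by (intro order_trans[OF mult_left_mono[of t "\<bar>t\<bar>"] mult_mono]) auto
          hence "exp (a * t) * \<bar>xi_line t\<bar> * exp (- ((1 / real (Suc n))\<^sup>2 / 4) * t\<^sup>2) \<le> exp T * B * 1"
            using B by (intro mult_mono) auto
          hence "\<bar>f n t\<bar> \<le> B * exp T" by (simp add: f_def abs_mult mult_ac)
          moreover have "\<bar>\<sigma> * f n t\<bar> = \<bar>f n t\<bar>" using \<sigma> by (simp add: abs_mult)
          moreover have "2 * (B * exp T) * indicator {-T..T} t = 2 * (B * exp T)"
          proof -
            have "t \<in> {-T..T}" using False unfolding atLeastAtMost_iff by linarith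
            thus ?thesis by simp
          qed
          ultimately show ?thesis by linarith
        qed
      qed (use fint ind in \<open>auto intro!: Bochner_Integration.integrable_add integrable_mult_right\<close>)
      also have "\<dots> = \<sigma> * (\<integral>t. f n t \<partial>lborel) + D'"
      proof -
        have "(\<integral>t. \<sigma> * f n t + (2 * (B * exp T)) * indicator {-T..T} t \<partial>lborel) =
          (\<integral>t. \<sigma> * f n t \<partial>lborel) + (\<integral>t. (2 * (B * exp T)) * indicator {-T..T} t \<partial>lborel)"
          by (intro Bochner_Integration.integral_add integrable_mult_right fint ind)
        thus ?thesis unfolding integral_mult_right_zero indI D'_def by (simp add: mult_ac)
      qed
      also have "\<sigma> * (\<integral>t. f n t \<partial>lborel) \<le> \<bar>\<integral>t. f n t \<partial>lborel\<bar>" using \<sigma> by (metis abs_ge_self abs_mult mult_1)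
      also have "\<dots> = norm (J n 0)" unfolding J_def by simp
      finally show ?thesis by simp
    qed
    moreover have "(\<lambda>n. norm (J n y)) \<longlonglongrightarrow> norm (of_real (2 * pi) * phi_kernel (Complex y a))" for y
      unfolding J_def f_def by (intro tendsto_norm phi_kernel_inversion a')
    ultimately have "norm (of_real (2 * pi) * phi_kernel (Complex y a)) \<le> norm (of_real (2 * pi) * phi_kernel (Complex 0 a)) + D'"
      by (intro LIMSEQ_le[of "\<lambda>n. norm (J n y)" _ "\<lambda>n. norm (J n 0) + D'"] tendsto_add tendsto_const) auto
    thus ?thesis by (simp add: norm_mult)
  qed
  have "norm (phi_kernel (Complex y a)) \<le> norm (phi_kernel (Complex 0 a)) + D' / (2 * pi)"
    if a: "0 \<le> a" "a < pi / 4" for a y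
    using main[OF that, of y] by (simp add: field_simps)
  thus thesis by (rule that)
qed

section \<open>The theta function near the boundary points i and 2i\<close>

lemma theta_tail_summable': "Re w > 0 \<Longrightarrow> summable (\<lambda>n. exp (- of_real (pi * real (Suc n) ^ 2) * w))"
  by (rule summable_norm_cancel[OF theta_tail_summable])

lemma theta_term_add_i:
  "exp (- of_real (pi * real m ^ 2) * (w + \<i>)) = (- 1) ^ m * exp (- of_real (pi * real m ^ 2) * w)"
proof -
  have "- of_real (pi * real m ^ 2) * (w + \<i>) = - of_real (pi * real m ^ 2) * w + of_nat (m ^ 2) * (- (\<i> * of_real pi))"
    by (simp add: algebra_simps)
  hence "exp (- of_real (pi * real m ^ 2) * (w + \<i>)) = exp (- of_real (pi * real m ^ 2) * w) * exp (- (\<i> * of_real pi)) ^ (m ^ 2)"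
    by (simp only: exp_add exp_of_nat_mult)
  moreover have "exp (- (\<i> * of_real pi)) = - 1" by (simp add: exp_minus)
  moreover have "(- 1 :: complex) ^ (m ^ 2) = (- 1) ^ m" by (cases "even m") auto
  ultimately show ?thesis by (simp only: mult.commute)
qed

text \<open>The shift multiplies term n by (-1)^n, as n^2 and n have the same parity. Adding the
  unshifted series doubles the even terms and cancels the odd ones, and the even terms form the
  series at 4 w.\<close>

lemma theta_tail_add_i:
  assumes w: "Re w > 0"
  shows "theta_tail (w + \<i>) = 2 * theta_tail (4 * w) - theta_tail w"
proof -
  let ?q = "\<lambda>w n. exp (- of_real (pi * real (Suc n) ^ 2) * w)"
  have q: "?q w sums theta_tail w" if "Re w > 0" for w
    unfolding theta_tail_def by (rule summable_sums[OF theta_tail_summable'[OF that]])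
  let ?f = "\<lambda>n. ?q (w + \<i>) n + ?q w n"
  have "?f sums (theta_tail (w + \<i>) + theta_tail w)" using w by (intro sums_add q) auto
  moreover have "(\<lambda>n. ?f (2 * n + 1)) = (\<lambda>n. 2 * ?q (4 * w) n)"
  \<comment> \<open>The series starts at index 1, so position 2n+1 carries the even frequency
    2(n+1).\<close>
  proof
    fix n
    have "- of_real (pi * real (Suc (2 * n + 1)) ^ 2) * w = - of_real (pi * real (Suc n) ^ 2) * (4 * w)"
      by (simp add: power2_eq_square algebra_simps)
    thus "?f (2 * n + 1) = 2 * ?q (4 * w) n" unfolding theta_term_add_i by (simp only:) simp
  qed
  hence "(\<lambda>n. ?f (2 * n + 1)) sums (2 * theta_tail (4 * w))"
    using sums_mult[OF q[of "4 * w"], of 2] w by simp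
  moreover have "((\<lambda>n. ?f (2 * n + 1)) sums c) = (?f sums c)" for c
  proof (rule sums_mono_reindex)
    show "strict_mono (\<lambda>n::nat. 2 * n + 1)" by (rule strict_monoI) simp
    fix n :: nat assume n: "n \<notin> range (\<lambda>n. 2 * n + 1)"
    have "even n" using n by (metis oddE rangeI)
    thus "?f n = 0" unfolding theta_term_add_i by simp
  qed
  ultimately have "theta_tail (w + \<i>) + theta_tail w = 2 * theta_tail (4 * w)"
    using sums_unique2 by blast
  thus ?thesis by (simp add: algebra_simps)
qed

lemma theta_tail_add_2i:
  assumes w: "Re w > 0"
  shows "theta_tail (w + 2 * \<i>) = theta_tail w"
proof -
  have e: "w + 2 * \<i> = (w + \<i>) + \<i>" by simp
  have "exp (- of_real (pi * real (Suc n) ^ 2) * (w + 2 * \<i>)) = exp (- of_real (pi * real (Suc n) ^ 2) * w)" for n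
    unfolding e theta_term_add_i by (simp add: mult.assoc[symmetric] power_mult_distrib[symmetric])
  thus ?thesis unfolding theta_tail_def by (simp only:)
qed

lemma norm_csqrt_sqrt: "norm (csqrt z) = sqrt (norm z)"
  by (metis norm_ge_zero norm_power power2_csqrt real_sqrt_unique)

lemma theta_tail_decay:
  assumes "Re w \<ge> 1/2"
  shows "norm (theta_tail w) \<le> 1 / (1 - exp (- pi / 2)) / Re w"
proof -
  have "norm (theta_tail w) \<le> exp (- pi * Re w) / (1 - exp (- pi * (1/2)))"
    by (rule theta_tail_norm_le) (use assms in auto)
  also have "exp (- pi * Re w) \<le> 1 / Re w"
  proof -
    have "Re w \<le> pi * Re w" using assms pi_gt3 by simp
    also have "\<dots> \<le> exp (pi * Re w)" using exp_ge_add_one_self[of "pi * Re w"] by linarith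
    finally show ?thesis using assms by (simp add: exp_minus field_simps)
  qed
  finally show ?thesis by (simp add: divide_right_mono mult.commute)
qed

text \<open>If \<open>xi_line\<close> had constant sign for large arguments, then by positivity \<open>phi_kernel\<close> on the line
  $\Im u = a$ would be dominated by its value at $u = ia$, which stays bounded as $a \to \pi/4$ because
  $\theta$ vanishes to infinite order at $w = i$. But $\theta$ blows up at $w = 2i$.\<close>

lemma xi_line_not_eventually_signed:
  assumes T: "T \<ge> 0" and \<sigma>: "\<bar>\<sigma>\<bar> = 1" and sgn: "\<And>t. \<bar>t\<bar> \<ge> T \<Longrightarrow> \<sigma> * xi_line t \<ge> 0"
  shows False
proof -
  obtain D where D: "\<And>a y. 0 \<le> a \<Longrightarrow> a < pi / 4 \<Longrightarrow> norm (phi_kernel (Complex y a)) \<le> norm (phi_kernel (Complex 0 a)) + D"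
    using phi_kernel_bound_if_eventually_signed[OF assms] by blast
  define K where "K = 1 / (1 - exp (- pi / 2))"
  have K: "K > 0" by (simp add: K_def)
  \<comment> \<open>Here b is the distance to the edge of the strip. The bound b <= 1/8 keeps all
    arguments in the range of \<open>theta_tail_decay\<close>, and sin b <= 1/(32 K) makes the theta
    tail used at 2i at most 1/4.\<close>
  have key: "1 / (4 * sqrt (sin b)) - 3 \<le> 64 * K + 2 + D"
    if b: "0 < b" "b \<le> 1/8" and bK: "sin b \<le> 1 / (32 * K)" for b
  proof -
    define a where "a = pi / 4 - b"
    have a: "0 \<le> a" "a < pi / 4" using b pi_gt3 by (auto simp: a_def)
    define s where "s = sin b"
    have s: "s > 0" unfolding s_def using b pi_gt3 by (intro sin_gt_zero) auto
    have s8: "s \<le> 1/8" using sin_x_le_x[of b] b by (simp add: s_def)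
    have cb: "cos b \<ge> 1/2" using b cos_monotone_0_pi_le[of b "pi / 3"] pi_gt3 by (simp add: cos_60)
    \<comment> \<open>Exactly exp (2 i a) - i: with a = pi/4 - b it is i (exp (- 2 i b) - 1) = 2 sin
      b exp (- i b).\<close>
    define \<delta> where "\<delta> = of_real (2 * s) * exp (- (\<i> * of_real b))"
    have nd: "norm \<delta> = 2 * s" using s by (simp add: \<delta>_def norm_mult norm_exp_eq_Re)
    have Rd: "Re \<delta> > 0" using s cb by (simp add: \<delta>_def Re_exp)
    have e1: "exp (2 * Complex 0 a) = \<delta> + \<i>"
    proof -
      have "2 * s * sin b = 1 - cos (2 * b)" by (simp add: s_def cos_double_sin power2_eq_square)
      moreover have "2 * s * cos b = sin (2 * b)" by (simp add: s_def sin_double)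
      moreover have "cos (2 * a) = sin (2 * b)" "sin (2 * a) = cos (2 * b)"
        by (simp_all add: a_def right_diff_distrib sin_diff cos_diff)
      ultimately show ?thesis by (simp add: complex_eq_iff \<delta>_def Re_exp Im_exp)
    qed
    \<comment> \<open>The real part ln 2 / 2 doubles exp (2 u), which carries the point near i to a
      point near 2i at the same a.\<close>
    have e2: "exp (2 * Complex (ln 2 / 2) a) = 2 * \<delta> + 2 * \<i>"
    proof -
      have "2 * Complex (ln 2 / 2) a = of_real (ln 2) + 2 * Complex 0 a" by (simp add: complex_eq_iff)
      hence "exp (2 * Complex (ln 2 / 2) a) = of_real (exp (ln 2)) * exp (2 * Complex 0 a)"
        by (simp only: exp_add exp_of_real)
      thus ?thesis unfolding e1 by simp
    qed
    have inv: "1 / \<delta> = of_real (1 / (2 * s)) * exp (\<i> * of_real b)" using s by (simp add: \<delta>_def exp_minus field_simps)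
    have R: "Re (1 / \<delta>) = cos b / (2 * s)" unfolding inv by (simp add: Re_exp)
    have R1: "Re (1 / \<delta>) \<ge> 1 / (4 * s)" unfolding R using cb s by (simp add: field_simps)
    have R2: "Re (1 / (2 * \<delta>)) \<ge> 1 / (8 * s)" "Re (1 / (4 * \<delta>)) \<ge> 1 / (16 * s)"
    proof -
      have "1 / (2 * \<delta>) = (1 / \<delta>) / 2" "1 / (4 * \<delta>) = (1 / \<delta>) / 4" by simp_all
      hence "Re (1 / (2 * \<delta>)) = Re (1 / \<delta>) / 2" "Re (1 / (4 * \<delta>)) = Re (1 / \<delta>) / 4"
        by (simp_all only: Re_divide_numeral)
      thus "Re (1 / (2 * \<delta>)) \<ge> 1 / (8 * s)" "Re (1 / (4 * \<delta>)) \<ge> 1 / (16 * s)" using R1 by (simp_all add: field_simps)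
    qed
    have tb: "norm (theta_tail w) \<le> K * (c * s)" if "Re w \<ge> 1 / (c * s)" "c > 0" "c \<le> 16" for w c
    proof -
      have cs: "0 < c * s" "c * s \<le> 2" using that s s8 mult_mono[of c 16 s "1/8"] by auto
      have h: "1 / (c * s) \<ge> 1/2" using cs by (simp add: field_simps)
      have "norm (theta_tail w) \<le> K / Re w" unfolding K_def by (rule theta_tail_decay) (use h that in linarith)
      also have "\<dots> \<le> K / (1 / (c * s))"
      proof (intro divide_left_mono mult_pos_pos)
        show "0 < 1 / (c * s)" using cs by simp
        thus "0 < Re w" using that(1) by linarith
      qed (use that K in auto)
      finally show ?thesis by simp
    qed
    have phi: "norm (phi_kernel u) \<le> norm (exp (u/2)) * norm (1 + 2 * theta_tail (exp (2 * u))) + norm (exp (u/2)) + norm (exp (-u/2))"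
      "norm (phi_kernel u) \<ge> norm (exp (u/2)) * norm (1 + 2 * theta_tail (exp (2 * u))) - norm (exp (u/2)) - norm (exp (-u/2))" for u
    proof -
      have eq: "phi_kernel u = exp (u/2) * (1 + 2 * theta_tail (exp (2 * u))) - (exp (u/2) + exp (-u/2))"
        by (simp add: phi_kernel_def algebra_simps)
      have t: "norm (exp (u/2) + exp (-u/2)) \<le> norm (exp (u/2)) + norm (exp (-u/2))" by (rule norm_triangle_ineq)
      show "norm (phi_kernel u) \<le> norm (exp (u/2)) * norm (1 + 2 * theta_tail (exp (2 * u))) + norm (exp (u/2)) + norm (exp (-u/2))"
        using norm_triangle_ineq4[of "exp (u/2) * (1 + 2 * theta_tail (exp (2 * u)))" "exp (u/2) + exp (-u/2)"] t
        unfolding eq norm_mult by linarith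
      show "norm (phi_kernel u) \<ge> norm (exp (u/2)) * norm (1 + 2 * theta_tail (exp (2 * u))) - norm (exp (u/2)) - norm (exp (-u/2))"
        using norm_triangle_ineq2[of "exp (u/2) * (1 + 2 * theta_tail (exp (2 * u)))" "exp (u/2) + exp (-u/2)"] t
        unfolding eq norm_mult by linarith
    qed
    \<comment> \<open>After the functional equation the theta value near i, times the square root of
      \<delta>, is a difference of two values near infinity. Their leading terms 1 cancel, and what
      remains is of order s against a square root of order sqrt s.\<close>
    have upper: "norm (phi_kernel (Complex 0 a)) \<le> 64 * K + 2"
    proof -
      have "csqrt (4 * \<delta>) = csqrt ((2 * csqrt \<delta>)\<^sup>2)" by (simp add: power_mult_distrib)
      also have "\<dots> = 2 * csqrt \<delta>" by (rule csqrt_square) (use csqrt_principal[of \<delta>] in auto)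
      finally have c4: "csqrt (4 * \<delta>) = 2 * csqrt \<delta>" .
      have "csqrt \<delta> * (1 + 2 * theta_tail (\<delta> + \<i>)) =
          csqrt (4 * \<delta>) * (1 + 2 * theta_tail (4 * \<delta>)) - csqrt \<delta> * (1 + 2 * theta_tail \<delta>)"
        unfolding theta_tail_add_i[OF Rd] c4 by (simp add: algebra_simps)
      also have "\<dots> = (1 + 2 * theta_tail (1 / (4 * \<delta>))) - (1 + 2 * theta_tail (1 / \<delta>))"
        using theta_functional_equation[of "4 * \<delta>"] theta_functional_equation[OF Rd] Rd by simp
      also have "\<dots> = 2 * theta_tail (1 / (4 * \<delta>)) - 2 * theta_tail (1 / \<delta>)" by simp
      finally have "norm (csqrt \<delta> * (1 + 2 * theta_tail (\<delta> + \<i>))) = norm (2 * theta_tail (1 / (4 * \<delta>)) - 2 * theta_tail (1 / \<delta>))" by (simp only:)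
      also have "\<dots> \<le> 2 * norm (theta_tail (1 / (4 * \<delta>))) + 2 * norm (theta_tail (1 / \<delta>))"
        by (rule order_trans[OF norm_triangle_ineq4]) (simp add: norm_mult)
      also have "\<dots> \<le> 2 * (K * (16 * s)) + 2 * (K * (4 * s))"
        using tb[of 16 "1 / (4 * \<delta>)"] tb[of 4 "1 / \<delta>"] R1 R2 by simp
      also have "\<dots> \<le> 64 * K * s" using K s by simp
      finally have "sqrt (2 * s) * norm (1 + 2 * theta_tail (\<delta> + \<i>)) \<le> 64 * K * s"
        by (simp add: norm_mult norm_csqrt_sqrt nd)
      also have "\<dots> \<le> 64 * K * sqrt (2 * s)"
      proof -
        have "s * s \<le> 2 * s" using s s8 by (intro mult_right_mono) auto
        hence "s \<le> sqrt (2 * s)" using s by (intro real_le_rsqrt) (simp add: power2_eq_square)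
        thus ?thesis using K by (intro mult_left_mono) auto
      qed
      finally have "norm (1 + 2 * theta_tail (\<delta> + \<i>)) \<le> 64 * K" using s by (simp add: mult.commute)
      thus ?thesis using phi(1)[of "Complex 0 a"] unfolding e1 by (simp add: norm_exp_eq_Re)
    qed
    \<comment> \<open>By the period 2i the argument becomes 2 \<delta>, where the functional
      equation gives a value of order 1 / sqrt s with no cancellation.\<close>
    have lower: "norm (phi_kernel (Complex (ln 2 / 2) a)) \<ge> 1 / (4 * sqrt s) - 3"
    proof -
      let ?u = "Complex (ln 2 / 2) a"
      have Rd2: "Re (2 * \<delta>) > 0" using Rd by simp
      have "norm (theta_tail (1 / (2 * \<delta>))) \<le> K * (8 * s)" by (rule tb) (use R2 in auto)
      also have "\<dots> \<le> 1/4" using bK K unfolding s_def[symmetric] by (simp add: field_simps)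
      finally have t: "norm (theta_tail (1 / (2 * \<delta>))) \<le> 1/4" .
      have "1 - norm (2 * theta_tail (1 / (2 * \<delta>))) \<le> norm (1 + 2 * theta_tail (1 / (2 * \<delta>)))"
        using norm_triangle_ineq2[of 1 "- (2 * theta_tail (1 / (2 * \<delta>)))"] by simp
      hence "1/2 \<le> norm (1 + 2 * theta_tail (1 / (2 * \<delta>)))" using t by (simp add: norm_mult)
      also have "\<dots> = sqrt (4 * s) * norm (1 + 2 * theta_tail (2 * \<delta>))"
        unfolding theta_functional_equation[OF Rd2] norm_mult norm_csqrt_sqrt by (simp add: norm_mult nd)
      also have "2 * \<delta> = exp (2 * ?u) - 2 * \<i>" unfolding e2 by simp
      also have "theta_tail \<dots> = theta_tail (exp (2 * ?u))"
        using theta_tail_add_2i[OF Rd2] unfolding e2 by simp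
      finally have "1/2 \<le> sqrt (4 * s) * norm (1 + 2 * theta_tail (exp (2 * ?u)))" .
      hence th: "1 / (4 * sqrt s) \<le> norm (1 + 2 * theta_tail (exp (2 * ?u)))"
        using s by (simp add: real_sqrt_mult field_simps)
      have n1: "norm (exp (?u / 2)) = exp (ln 2 / 4)" "norm (exp (- ?u / 2)) = exp (- ln 2 / 4)" by (simp_all add: norm_exp_eq_Re)
      have g1: "norm (exp (?u / 2)) \<ge> 1" unfolding n1 by simp
      have l2: "norm (exp (?u / 2)) \<le> 2" "norm (exp (- ?u / 2)) \<le> 1"
      proof -
        have "exp (ln 2 / 4) \<le> exp (ln (2::real))" by (subst exp_le_cancel_iff) simp
        thus "norm (exp (?u / 2)) \<le> 2" unfolding n1 by simp
        show "norm (exp (- ?u / 2)) \<le> 1" unfolding n1 by simp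
      qed
      have "1 * norm (1 + 2 * theta_tail (exp (2 * ?u))) \<le> norm (exp (?u / 2)) * norm (1 + 2 * theta_tail (exp (2 * ?u)))"
        using g1 by (intro mult_right_mono) auto
      thus ?thesis using phi(2)[of ?u] th l2 by linarith
    qed
    show ?thesis using D[OF a, of "ln 2 / 2"] upper lower unfolding s_def by linarith
  qed
  have "filterlim (\<lambda>b::real. 1 / (4 * sqrt (sin b)) - 3) at_top (at_right 0)" by real_asymp
  hence "eventually (\<lambda>b. 1 / (4 * sqrt (sin b)) - 3 > 64 * K + 2 + D) (at_right 0)"
    unfolding filterlim_at_top_dense by (rule spec)
  moreover have "((\<lambda>b::real. sin b) \<longlongrightarrow> 0) (at_right 0)" by real_asymp
  hence "eventually (\<lambda>b::real. sin b < 1 / (32 * K)) (at_right 0)"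
    using K by (intro order_tendstoD(2)) auto
  moreover have "eventually (\<lambda>b::real. b \<in> {0<..<1/8}) (at_right 0)" by (intro eventually_at_right_real) simp
  ultimately have "eventually (\<lambda>b::real. False) (at_right 0)"
    by eventually_elim (use key in force)
  thus False by simp
qed

theorem infinite_xi_line_zeros: "infinite {t. t > 0 \<and> xi_line t = 0}"
proof
  assume fin: "finite {t. t > 0 \<and> xi_line t = 0}"
  then obtain T0 where T0: "\<And>t. t > 0 \<Longrightarrow> xi_line t = 0 \<Longrightarrow> t \<le> T0"
    using bdd_above_finite[OF fin] by (auto simp: bdd_above_def)
  define T where "T = max T0 0 + 1"
  have T: "T > 0" "T > T0" by (auto simp: T_def)
  have nz: "xi_line t \<noteq> 0" if "t \<ge> T" for t using T0[of t] that T by auto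
  define \<sigma> where "\<sigma> = sgn (xi_line T)"
  have \<sigma>: "\<bar>\<sigma>\<bar> = 1" "\<sigma> * xi_line T > 0" using nz[of T] by (auto simp: \<sigma>_def sgn_if)
  have pos: "\<sigma> * xi_line t \<ge> 0" if t: "t \<ge> T" for t
  proof (rule ccontr)
    assume "\<not> \<sigma> * xi_line t \<ge> 0"
    hence "\<exists>x. T \<le> x \<and> x \<le> t \<and> \<sigma> * xi_line x = 0"
      using \<sigma> t by (intro IVT2') (auto intro!: continuous_intros xi_line_continuous)
    thus False using nz \<sigma>(1) by auto
  qed
  show False
  proof (rule xi_line_not_eventually_signed[of T \<sigma>])
    fix t assume "\<bar>t\<bar> \<ge> T"
    thus "\<sigma> * xi_line t \<ge> 0" using pos[of t] pos[of "-t"] xi_line_even[of t] by (cases "t \<ge> 0") auto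
  qed (use T \<sigma> in auto)
qed

section \<open>The Riemann--Siegel theta function\<close>

text \<open>On real arguments the real part of a power series can be taken coefficient by
  coefficient, so a holomorphic function near x yields a real power series.\<close>

lemma has_fps_expansion_Re:
  assumes F: "F holomorphic_on S" "open S" "complex_of_real x \<in> S"
    and f: "eventually (\<lambda>h. f (x + h) = Re (F (of_real (x + h)))) (nhds (0::real))"
  shows "\<exists>G. (\<lambda>h::real. f (x + h)) has_fps_expansion G"
proof -
  let ?S = "(\<lambda>z. z - of_real x) ` S"
  have "(\<lambda>h. F (of_real x + h)) holomorphic_on ?S"
    by (rule holomorphic_on_compose_gen[unfolded o_def, OF _ F(1)]) (auto intro!: holomorphic_intros)
  moreover have "open ?S" using open_translation[OF F(2), of "- complex_of_real x"] by (simp add: image_def)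
  moreover have "0 \<in> ?S" using F(3) by (auto simp: image_iff)
  ultimately have "(\<lambda>h. F (of_real x + h)) has_fps_expansion fps_expansion (\<lambda>h. F (of_real x + h)) 0"
    by (intro has_fps_expansion_fps_expansion)
  then obtain Fc where Fc: "(\<lambda>h. F (of_real x + h)) has_fps_expansion Fc" by blast
  define G where "G = Abs_fps (\<lambda>n. Re (fps_nth Fc n))"
  have r: "fps_conv_radius Fc > 0" and ev: "eventually (\<lambda>z. eval_fps Fc z = F (of_real x + z)) (nhds 0)"
    using Fc by (auto simp: has_fps_expansion_def)
  have "eventually (\<lambda>z. z \<in> eball 0 (fps_conv_radius Fc)) (nhds (0::complex))"
    using r by (intro eventually_nhds_in_open) (auto simp: zero_ereal_def)
  hence ev': "eventually (\<lambda>z. (\<lambda>n. fps_nth Fc n * z ^ n) sums F (of_real x + z)) (nhds 0)"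
    using ev by eventually_elim (metis in_eball_iff diff_0 dist_0_norm sums_eval_fps)
  have "filterlim complex_of_real (nhds 0) (nhds (0::real))"
    using tendsto_of_real[of "\<lambda>h. h" 0 "nhds 0", where ?'a = complex] by (simp add: filterlim_ident)
  from eventually_compose_filterlim[OF ev' this]
  have "eventually (\<lambda>h. (\<lambda>n. fps_nth Fc n * complex_of_real h ^ n) sums F (of_real x + of_real h)) (nhds 0)" .
  hence "eventually (\<lambda>h. (\<lambda>n. fps_nth G n * h ^ n) sums f (x + h)) (nhds 0)"
    using f
  proof eventually_elim
    case (elim h)
    have "(\<lambda>n. Re (fps_nth Fc n * complex_of_real h ^ n)) sums Re (F (of_real x + of_real h))"
      by (rule sums_Re[OF elim(1)])
    moreover have "Re (fps_nth Fc n * complex_of_real h ^ n) = fps_nth G n * h ^ n" for n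
    proof -
      have "fps_nth G n = Re (fps_nth Fc n)" by (simp add: G_def)
      thus ?thesis by (simp flip: of_real_power)
    qed
    ultimately show ?case by (simp only: elim(2) of_real_add)
  qed
  hence "(\<lambda>h. f (x + h)) has_fps_expansion G" by (rule has_fps_expansionI)
  thus ?thesis by blast
qed

lemma real_analytic_imp_continuous: "real_analytic f \<Longrightarrow> continuous_on UNIV f"
proof (rule continuous_at_imp_continuous_on, rule ballI)
  fix x assume "real_analytic f"
  then obtain F where "(\<lambda>h. f (x + h)) has_fps_expansion F" unfolding real_analytic_def by blast
  hence "isCont (\<lambda>h. f (x + h)) 0" by (rule has_fps_expansion_imp_continuous)
  hence "isCont (\<lambda>y. (\<lambda>h. f (x + h)) (y - x)) x"
    by (intro isCont_o2[where g = "\<lambda>h. f (x + h)" and f = "\<lambda>y. y - x"]) auto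
  thus "isCont f x" by simp
qed

text \<open>The difference of the two phases is continuous with values in 2 pi times the integers,
  hence constant. It serves the uniqueness of \<open>rs_theta\<close> and \<open>kappa\<close>, the
  comparison with a local logarithm, and the reflection formula.\<close>

lemma continuous_phase_unique_on:
  fixes f g :: "real \<Rightarrow> real"
  assumes "connected S" "continuous_on S f" "continuous_on S g"
    and "\<And>t. t \<in> S \<Longrightarrow> exp (\<i> * of_real (f t)) = exp (\<i> * of_real (g t))"
    and "x \<in> S" "t \<in> S"
  shows "f t - g t = f x - g x"
proof -
  have *: "\<exists>n::int. f t - g t = 2 * of_int n * pi" if tS: "t \<in> S" for t
  proof -
    obtain n :: int where "\<i> * of_real (f t) = \<i> * of_real (g t) + of_real (real_of_int (2 * n) * pi) * \<i>"
      using assms(4)[OF tS] unfolding exp_eq by blast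
    hence "Im (\<i> * of_real (f t)) = Im (\<i> * of_real (g t) + of_real (real_of_int (2 * n) * pi) * \<i>)" by (simp only:)
    thus ?thesis by (intro exI[of _ n]) (simp add: algebra_simps)
  qed
  have "(\<lambda>t. f t - g t) constant_on S"
  proof (rule continuous_discrete_range_constant)
    fix x assume x: "x \<in> S"
    show "\<exists>e>0. \<forall>y. y \<in> S \<and> f y - g y \<noteq> f x - g x \<longrightarrow> e \<le> norm (f y - g y - (f x - g x))"
    proof (intro exI[of _ "2 * pi"] conjI allI impI)
      fix y assume y: "y \<in> S \<and> f y - g y \<noteq> f x - g x"
      obtain m n :: int where mn: "f x - g x = 2 * of_int m * pi" "f y - g y = 2 * of_int n * pi"
        using *[of x] *[of y] x y by blast
      hence "n \<noteq> m" using y by auto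
      hence "1 \<le> \<bar>real_of_int (n - m)\<bar>" by (metis abs_ge_self linorder_not_less of_int_1_le_iff of_int_abs abs_less_iff zabs_less_one_iff eq_iff_diff_eq_0 linorder_le_less_linear)
      hence "2 * pi * 1 \<le> 2 * pi * \<bar>real_of_int (n - m)\<bar>" by (intro mult_left_mono) auto
      also have "\<dots> = norm (f y - g y - (f x - g x))"
      proof -
        have e: "2 * real_of_int n * pi - 2 * real_of_int m * pi = (2 * pi) * real_of_int (n - m)"
          by (simp add: algebra_simps)
        show ?thesis unfolding mn e real_norm_def abs_mult by simp
      qed
      finally show "2 * pi \<le> norm (f y - g y - (f x - g x))" by simp
    qed simp
  qed (use assms in \<open>auto intro!: continuous_intros\<close>)
  thus ?thesis using assms(5,6) by (auto simp: constant_on_def)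
qed

text \<open>The explicit form of \<open>rs_theta\<close>: \<open>ln_Gamma\<close> is holomorphic off
  the nonpositive reals and real at 1/4, so its imaginary part is the phase starting at 0.\<close>

definition theta_im :: "real \<Rightarrow> real" where
  "theta_im t = Im (ln_Gamma (Complex (1/4) (t/2))) - t / 2 * ln pi"

definition theta_d1 :: "real \<Rightarrow> real" where
  "theta_d1 t = Re (Digamma (Complex (1/4) (t/2))) / 2 - ln pi / 2"

definition theta_d2 :: "real \<Rightarrow> real" where
  "theta_d2 t = - Im (Polygamma 1 (Complex (1/4) (t/2))) / 4"

lemma quarter_line_not_nonpos: "Complex (1/4) y \<notin> \<real>\<^sub>\<le>\<^sub>0" "Complex (1/4) y \<notin> \<int>\<^sub>\<le>\<^sub>0" "Complex (1/4) y \<noteq> 0"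
proof -
  show 1: "Complex (1/4) y \<notin> \<real>\<^sub>\<le>\<^sub>0" by (simp add: complex_nonpos_Reals_iff)
  thus "Complex (1/4) y \<notin> \<int>\<^sub>\<le>\<^sub>0" using nonpos_Ints_subset_nonpos_Reals by blast
  show "Complex (1/4) y \<noteq> 0" by (simp add: complex_eq_iff)
qed

lemma quarter_line_deriv: "((\<lambda>t. Complex (1/4) (t/2)) has_vector_derivative \<i> / 2) (at t within A)"
  unfolding Complex_eq by (auto intro!: derivative_eq_intros simp: scaleR_conv_of_real)

lemma theta_im_deriv: "(theta_im has_real_derivative theta_d1 t) (at t)"
proof -
  have "((\<lambda>t. ln_Gamma (Complex (1/4) (t/2))) has_vector_derivative \<i> / 2 * Digamma (Complex (1/4) (t/2))) (at t)"
    using field_vector_diff_chain_at[OF quarter_line_deriv has_field_derivative_ln_Gamma_complex[OF quarter_line_not_nonpos(1)]]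
    by (simp add: o_def)
  hence "((\<lambda>t. Im (ln_Gamma (Complex (1/4) (t/2)))) has_vector_derivative Im (\<i> / 2 * Digamma (Complex (1/4) (t/2)))) (at t)"
    by (rule bounded_linear.has_vector_derivative[OF bounded_linear_Im])
  hence "((\<lambda>t. Im (ln_Gamma (Complex (1/4) (t/2)))) has_real_derivative Re (Digamma (Complex (1/4) (t/2))) / 2) (at t)"
    by (simp add: has_real_derivative_iff_has_vector_derivative)
  moreover have "((\<lambda>t. t / 2 * ln pi) has_real_derivative ln pi / 2) (at t)"
    by (auto intro!: derivative_eq_intros)
  ultimately show ?thesis unfolding theta_im_def[abs_def] theta_d1_def by (rule DERIV_diff)
qed

lemma theta_d1_deriv: "(theta_d1 has_real_derivative theta_d2 t) (at t)"
proof -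
  have "((\<lambda>t. Digamma (Complex (1/4) (t/2))) has_vector_derivative \<i> / 2 * Polygamma 1 (Complex (1/4) (t/2))) (at t)"
    using field_vector_diff_chain_at[OF quarter_line_deriv has_field_derivative_Polygamma[OF quarter_line_not_nonpos(2)], of 0]
    by (simp add: o_def)
  hence "((\<lambda>t. Re (Digamma (Complex (1/4) (t/2)))) has_vector_derivative Re (\<i> / 2 * Polygamma 1 (Complex (1/4) (t/2)))) (at t)"
    by (rule bounded_linear.has_vector_derivative[OF bounded_linear_Re])
  hence "((\<lambda>t. Re (Digamma (Complex (1/4) (t/2)))) has_real_derivative - Im (Polygamma 1 (Complex (1/4) (t/2))) / 2) (at t)"
    by (simp add: has_real_derivative_iff_has_vector_derivative)
  from DERIV_diff[OF DERIV_cdivide[OF this, of 2] DERIV_const[of "ln pi / 2"]]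
  show ?thesis unfolding theta_d1_def[abs_def] theta_d2_def by simp
qed

text \<open>In the trigamma series each z + k lies in the open first quadrant, so its square lies in
  the upper half-plane and the inverse square in the lower.\<close>

lemma theta_d2_pos:
  assumes t: "t > 0"
  shows "theta_d2 t > 0"
proof -
  let ?z = "Complex (1/4) (t/2)"
  let ?f = "\<lambda>k. inverse ((?z + of_nat k) ^ 2)"
  have sm: "summable ?f" using Polygamma_converges'[of ?z 2] quarter_line_not_nonpos by simp
  have trm: "- Im (?f k) > 0" for k
  proof -
    have z: "?z + of_nat k = Complex (1/4 + real k) (t/2)" by (simp add: complex_eq_iff)
    define W where "W = Complex (1/4 + real k) (t/2) ^ 2"
    have "Im W = 2 * ((1/4 + real k) * (t/2))" by (simp add: W_def power2_eq_square)
    moreover have "0 < (1/4 + real k) * (t/2)" using t by (intro mult_pos_pos) auto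
    ultimately have W: "Im W > 0" by linarith
    hence "(Re W)\<^sup>2 + (Im W)\<^sup>2 > 0" by (simp add: sum_power2_gt_zero_iff)
    hence "Im W / ((Re W)\<^sup>2 + (Im W)\<^sup>2) > 0" using W by (rule divide_pos_pos[rotated])
    thus ?thesis unfolding z W_def[symmetric] by simp
  qed
  have "Polygamma 1 ?z = (\<Sum>k. ?f k)" by (simp add: Polygamma_def numeral_2_eq_2)
  hence "- Im (Polygamma 1 ?z) = (\<Sum>k. - Im (?f k))"
    using Im_suminf[OF sm] suminf_minus[OF summable_Im[OF sm]] by simp
  also have "\<dots> > 0" by (rule suminf_pos[OF summable_minus[OF summable_Im[OF sm]] trm])
  finally show ?thesis by (simp add: theta_d2_def)
qed

lemma Digamma_quarter_line_cnj: "Digamma (Complex (1/4) (- t/2)) = cnj (Digamma (Complex (1/4) (t/2)))"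
proof -
  let ?z = "Complex (1/4) (t/2)"
  have "(\<lambda>m. cnj (of_real (ln (real m)) - (\<Sum>n<m. inverse (?z + of_nat n)))) \<longlonglongrightarrow> cnj (Digamma ?z)"
    by (intro tendsto_cnj Digamma_LIMSEQ quarter_line_not_nonpos)
  moreover have "cnj ?z = Complex (1/4) (-t/2)" by (simp add: complex_eq_iff)
  moreover have "(\<lambda>m. of_real (ln (real m)) - (\<Sum>n<m. inverse (Complex (1/4) (-t/2) + of_nat n))) \<longlonglongrightarrow> Digamma (Complex (1/4) (-t/2))"
    by (intro Digamma_LIMSEQ quarter_line_not_nonpos)
  ultimately show ?thesis
    by (intro LIMSEQ_unique) (auto simp: cnj_sum)
qed

lemma theta_d1_even: "theta_d1 (- t) = theta_d1 t"
  using Digamma_quarter_line_cnj[of t] by (simp add: theta_d1_def)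

lemma rs_theta_eq: "rs_theta = theta_im"
  unfolding rs_theta_def
proof (rule the_equality)
  have an: "real_analytic theta_im"
    unfolding real_analytic_def
  proof
    fix x :: real
    \<comment> \<open>For these w the point 1/4 + i w / 2 has positive real part and so avoids the
      cut of \<open>ln_Gamma\<close>.\<close>
    let ?S = "{w. Im w < 1/2}"
    have S: "1/4 + \<i> * w / 2 \<notin> \<real>\<^sub>\<le>\<^sub>0" if "w \<in> ?S" for w
      using that by (auto simp: complex_nonpos_Reals_iff)
    have "(\<lambda>w. - \<i> * ln_Gamma (1/4 + \<i> * w / 2) - w / 2 * of_real (ln pi)) field_differentiable at w within ?S" if "w \<in> ?S" for w
      using S[OF that] unfolding field_differentiable_def
      by (intro exI) (rule derivative_eq_intros refl | simp)+
    hence h: "(\<lambda>w. - \<i> * ln_Gamma (1/4 + \<i> * w / 2) - w / 2 * of_real (ln pi)) holomorphic_on ?S"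
      by (auto simp: holomorphic_on_def)
    have e: "theta_im t = Re (- \<i> * ln_Gamma (1/4 + \<i> * of_real t / 2) - of_real t / 2 * of_real (ln pi))" for t
    proof -
      have "1/4 + \<i> * of_real t / 2 = Complex (1/4) (t/2)" by (simp add: complex_eq_iff)
      thus ?thesis by (simp add: theta_im_def)
    qed
    show "\<exists>F. (\<lambda>h. theta_im (x + h)) has_fps_expansion F"
      by (rule has_fps_expansion_Re[OF h open_halfspace_Im_lt]) (auto simp: e)
  qed
  have G: "Gamma (Complex (1/4) (t/2)) = of_real (cmod (Gamma (Complex (1/4) (t/2)))) * exp (\<i> * of_real (theta_im t + t / 2 * ln pi))" for t
  proof -
    let ?l = "ln_Gamma (Complex (1/4) (t/2))"
    have "Gamma (Complex (1/4) (t/2)) = exp ?l" using quarter_line_not_nonpos by (simp add: Gamma_complex_altdef)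
    moreover have "exp ?l = of_real (exp (Re ?l)) * exp (\<i> * of_real (Im ?l))"
      using arg_cong[OF complex_eq[of ?l], of exp] by (simp only: exp_add exp_of_real)
    ultimately show ?thesis by (simp add: norm_mult norm_exp_eq_Re theta_im_def)
  qed
  have "ln_Gamma (Complex (1/4) 0) = of_real (ln_Gamma (1/4))"
    using ln_Gamma_complex_of_real[of "1/4"] by (simp add: complex_of_real_def)
  hence z: "theta_im 0 = 0" by (simp add: theta_im_def)
  show "real_analytic theta_im \<and> theta_im 0 = 0 \<and> (\<forall>t. Gamma (Complex (1 / 4) (t / 2)) =
      of_real (cmod (Gamma (Complex (1 / 4) (t / 2)))) * exp (\<i> * of_real (theta_im t + t / 2 * ln pi)))"
    using an z G by blast
  fix \<theta> assume \<theta>: "real_analytic \<theta> \<and> \<theta> 0 = 0 \<and> (\<forall>t. Gamma (Complex (1 / 4) (t / 2)) =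
      of_real (cmod (Gamma (Complex (1 / 4) (t / 2)))) * exp (\<i> * of_real (\<theta> t + t / 2 * ln pi)))"
  show "\<theta> = theta_im"
  proof
    fix t
    have "\<theta> t - theta_im t = \<theta> 0 - theta_im 0"
    proof (rule continuous_phase_unique_on[where S = UNIV])
      show "continuous_on UNIV \<theta>" "continuous_on UNIV theta_im"
        using \<theta> an by (auto intro: real_analytic_imp_continuous)
      fix t
      let ?G = "Gamma (Complex (1/4) (t/2))"
      have "?G \<noteq> 0" using quarter_line_not_nonpos by (simp add: Gamma_eq_zero_iff)
      moreover have "of_real (cmod ?G) * exp (\<i> * of_real (\<theta> t + t / 2 * ln pi)) = of_real (cmod ?G) * exp (\<i> * of_real (theta_im t + t / 2 * ln pi))"
        using \<theta> G[of t] by metis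
      ultimately have "exp (\<i> * of_real (\<theta> t + t / 2 * ln pi)) = exp (\<i> * of_real (theta_im t + t / 2 * ln pi))" by simp
      thus "exp (\<i> * of_real (\<theta> t)) = exp (\<i> * of_real (theta_im t))"
        by (simp add: distrib_left exp_add)
    qed auto
    thus "\<theta> t = theta_im t" using \<theta> z by simp
  qed
qed

lemma deriv_rs_theta: "deriv rs_theta t = theta_d1 t"
  unfolding rs_theta_eq by (rule DERIV_imp_deriv[OF theta_im_deriv])

text \<open>The midpoint rule for 1/x on a unit segment centred at w. As a function of the
  half-length v the error has derivative 2 v^2 / (w (w + v) (w - v)); here |w + v| >= |w| and |w -
  v| >= Im w, and integrating up to v = 1/2 gives the factor 1/12.\<close>

lemma Ln_diff_bound:
  assumes w: "Re w > 0" "Im w > 0"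
  shows "norm (Ln (w + 1/2) - Ln (w - 1/2) - 1 / w) \<le> 1 / (12 * (norm w)\<^sup>2 * Im w)"
proof -
  define f where "f = (\<lambda>v::real. Ln (w + of_real v) - Ln (w - of_real v) - of_real (2 * v) / w)"
  define f' where "f' = (\<lambda>v::real. 1 / (w + of_real v) + 1 / (w - of_real v) - 2 / w)"
  define \<phi> where "\<phi> = (\<lambda>v::real. 2 * v ^ 3 / (3 * ((norm w)\<^sup>2 * Im w)))"
  define \<phi>' where "\<phi>' = (\<lambda>v::real. 2 * v\<^sup>2 / ((norm w)\<^sup>2 * Im w))"
  have w0: "w \<noteq> 0" using w by auto
  have nz: "w + of_real v \<notin> \<real>\<^sub>\<le>\<^sub>0" "w - of_real v \<notin> \<real>\<^sub>\<le>\<^sub>0" "w + of_real v \<noteq> 0" "w - of_real v \<noteq> 0" for v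
    using w by (auto simp: complex_nonpos_Reals_iff complex_eq_iff)
  have df: "(f has_vector_derivative f' v) (at v)" for v
  proof -
    have a: "((\<lambda>v. w + of_real v) has_vector_derivative 1) (at v)" "((\<lambda>v. w - of_real v) has_vector_derivative -1) (at v)"
      by (auto intro!: derivative_eq_intros)
    have 1: "((\<lambda>v. Ln (w + of_real v)) has_vector_derivative 1 * (1 / (w + of_real v))) (at v)"
      using field_vector_diff_chain_at[OF a(1) has_field_derivative_Ln[OF nz(1)]] by (simp add: o_def inverse_eq_divide)
    have 2: "((\<lambda>v. Ln (w - of_real v)) has_vector_derivative (-1) * (1 / (w - of_real v))) (at v)"
      using field_vector_diff_chain_at[OF a(2) has_field_derivative_Ln[OF nz(2)]] by (simp add: o_def inverse_eq_divide)
    have 3: "((\<lambda>v. of_real (2 * v) / w) has_vector_derivative 2 / w) (at v)"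
      using w0 by (auto intro!: derivative_eq_intros simp: scaleR_conv_of_real)
    from has_vector_derivative_diff[OF has_vector_derivative_diff[OF 1 2] 3]
    show ?thesis unfolding f_def f'_def by simp
  qed
  have "norm (f (1/2) - f 0) \<le> \<phi> (1/2) - \<phi> 0"
  proof (rule differentiable_bound_general[where f' = f' and \<phi>' = \<phi>'])
    show "continuous_on {0..1/2} f"
      using df by (intro continuous_at_imp_continuous_on ballI has_vector_derivative_continuous)
    show "continuous_on {0..1/2} \<phi>" unfolding \<phi>_def using w0 w by (intro continuous_intros) auto
    fix v :: real assume v: "0 < v" "v < 1/2"
    show "(f has_vector_derivative f' v) (at v)" by (rule df)
    have "(\<phi> has_real_derivative \<phi>' v) (at v)"
      unfolding \<phi>_def \<phi>'_def using w0 w by (auto intro!: derivative_eq_intros simp: field_simps power2_eq_square power3_eq_cube)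
    thus "(\<phi> has_vector_derivative \<phi>' v) (at v)" by (simp add: has_real_derivative_iff_has_vector_derivative)
    have alg: "1 / (W + V) + 1 / (W - V) - 2 / W = 2 * V\<^sup>2 / (W * ((W + V) * (W - V)))"
      if "W \<noteq> 0" "W + V \<noteq> 0" "W - V \<noteq> 0" for W V :: complex
      using that by (simp add: divide_simps) (simp add: power2_eq_square algebra_simps)
    have "f' v = 2 * (of_real v)\<^sup>2 / (w * ((w + of_real v) * (w - of_real v)))"
      unfolding f'_def using w0 nz[of v] by (intro alg)
    hence "norm (f' v) = 2 * v\<^sup>2 / (norm w * (norm (w + of_real v) * norm (w - of_real v)))"
      by (simp add: norm_divide norm_mult norm_power)
    also have "\<dots> \<le> 2 * v\<^sup>2 / (norm w * (norm w * Im w))"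
    proof (intro divide_left_mono mult_left_mono mult_mono mult_pos_pos)
      have "(Re w)\<^sup>2 \<le> (Re w + v)\<^sup>2" using w v by (intro power_mono) auto
      thus "norm w \<le> norm (w + of_real v)" unfolding cmod_def by (intro real_sqrt_le_mono) auto
      show "Im w \<le> norm (w - of_real v)" using abs_Im_le_cmod[of "w - of_real v"] w by simp
    qed (use w w0 nz[of v] in auto)
    finally show "norm (f' v) \<le> \<phi>' v" by (simp add: \<phi>'_def power2_eq_square mult_ac)
  qed auto
  moreover have "f (1/2) - f 0 = Ln (w + 1/2) - Ln (w - 1/2) - 1 / w" by (simp add: f_def)
  moreover have "\<phi> (1/2) - \<phi> 0 = 1 / (12 * (norm w)\<^sup>2 * Im w)" by (simp add: \<phi>_def power3_eq_cube)
  ultimately show ?thesis by simp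
qed

text \<open>The Digamma series is compared with a telescoping sum of logarithms by the midpoint
  rule. At w = z + n the error bound 1 / (12 |w|^2 Im w) is a multiple of - Im (1 / w), so the
  errors add up to a multiple of Im (Digamma z) itself.\<close>

lemma Digamma_approx:
  assumes z: "Re z > 0" "Im z > 0"
  shows "norm (Digamma z - Ln (z - 1/2)) \<le> Im (Digamma z) / (12 * (Im z)\<^sup>2)"
proof -
  define y where "y = Im z"
  have y: "y > 0" using z by (simp add: y_def)
  define D where "D = (\<lambda>m. of_real (ln (real m)) - (\<Sum>n<m. inverse (z + of_nat n)))"
  have D: "D \<longlonglongrightarrow> Digamma z" unfolding D_def by (rule Digamma_LIMSEQ) (use z in auto)
  define e where "e = (\<lambda>n. Ln ((z + of_nat n) + 1/2) - Ln ((z + of_nat n) - 1/2) - 1 / (z + of_nat n))"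
  have e: "norm (e n) \<le> - Im (inverse (z + of_nat n)) / (12 * y\<^sup>2)" for n
  proof -
    have "norm (e n) \<le> 1 / (12 * (norm (z + of_nat n))\<^sup>2 * Im (z + of_nat n))"
      unfolding e_def by (rule Ln_diff_bound) (use z in auto)
    also have "\<dots> = - Im (inverse (z + of_nat n)) / (12 * y\<^sup>2)"
      using y unfolding cmod_power2 by (simp add: y_def power2_eq_square)
    finally show ?thesis .
  qed
  have sum_e: "(\<Sum>n<m. e n) = Ln (z + of_nat m - 1/2) - Ln (z - 1/2) - (\<Sum>n<m. inverse (z + of_nat n))" for m
    by (induction m) (simp_all add: e_def inverse_eq_divide algebra_simps)
  have bnd: "norm (D m - Ln (z - 1/2) - (of_real (ln (real m)) - Ln (z + of_nat m - 1/2))) \<le> Im (D m) / (12 * y\<^sup>2)" for m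
  proof -
    have "D m - Ln (z - 1/2) - (of_real (ln (real m)) - Ln (z + of_nat m - 1/2)) = (\<Sum>n<m. e n)"
      unfolding sum_e by (simp add: D_def)
    hence "norm (D m - Ln (z - 1/2) - (of_real (ln (real m)) - Ln (z + of_nat m - 1/2))) = norm (\<Sum>n<m. e n)" by (simp only:)
    also have "\<dots> \<le> (\<Sum>n<m. - Im (inverse (z + of_nat n)) / (12 * y\<^sup>2))" by (rule sum_norm_le[OF e])
    also have "\<dots> = Im (D m) / (12 * y\<^sup>2)" unfolding sum_divide_distrib[symmetric] by (simp only: D_def sum_negf Im_sum minus_complex.sel Im_complex_of_real diff_0)
    finally show ?thesis .
  qed
  have "(\<lambda>m. of_real (ln (real m)) - Ln (z + of_nat m - 1/2)) \<longlonglongrightarrow> 0"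
  proof (rule Lim_transform_eventually)
    have "(\<lambda>m. 1 / real m) \<longlonglongrightarrow> 0" by real_asymp
    hence "(\<lambda>m. of_real (1 / real m) :: complex) \<longlonglongrightarrow> of_real 0" by (rule tendsto_of_real)
    hence "(\<lambda>m. 1 + (z - 1/2) * of_real (1 / real m)) \<longlonglongrightarrow> 1 + (z - 1/2) * of_real 0"
      by (intro tendsto_intros)
    hence "(\<lambda>m. - Ln (1 + (z - 1/2) * of_real (1 / real m))) \<longlonglongrightarrow> - Ln 1"
      by (intro tendsto_minus tendsto_Ln) auto
    thus "(\<lambda>m. - Ln (1 + (z - 1/2) * of_real (1 / real m))) \<longlonglongrightarrow> 0" by simp
    show "\<forall>\<^sub>F m in sequentially. - Ln (1 + (z - 1/2) * of_real (1 / real m)) = of_real (ln (real m)) - Ln (z + of_nat m - 1/2)"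
      using eventually_gt_at_top[of 0]
    proof eventually_elim
      case (elim m)
      have "z + of_nat m - 1/2 = of_real (real m) * (1 + (z - 1/2) * of_real (1 / real m))" using elim by (simp add: field_simps)
      moreover have "1 + (z - 1/2) * of_real (1 / real m) \<noteq> 0" using z elim by (auto simp: complex_eq_iff)
      ultimately show ?case using Ln_times_of_real[of "real m" "1 + (z - 1/2) * of_real (1 / real m)"] elim by simp
    qed
  qed
  hence "(\<lambda>m. norm (D m - Ln (z - 1/2) - (of_real (ln (real m)) - Ln (z + of_nat m - 1/2)))) \<longlonglongrightarrow> norm (Digamma z - Ln (z - 1/2) - 0)"
    by (intro tendsto_norm tendsto_diff D tendsto_const)
  moreover have "(\<lambda>m. Im (D m) / (12 * y\<^sup>2)) \<longlonglongrightarrow> Im (Digamma z) / (12 * y\<^sup>2)"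
    using y by (intro tendsto_divide tendsto_Im D tendsto_const) auto
  ultimately have "norm (Digamma z - Ln (z - 1/2) - 0) \<le> Im (Digamma z) / (12 * y\<^sup>2)"
    by (rule LIMSEQ_le) (use bnd in auto)
  thus ?thesis by (simp add: y_def)
qed

text \<open>The range of y is that of t/2 for t in [6.1, 6.4]. The approximating logarithm sits at
  -1/4 + i y, and 1.63 / 2 = 0.815 is the constant used later for the sign of W.\<close>

lemma Digamma_quarter_line:
  assumes y: "3.05 \<le> y" "y \<le> 3.2"
  shows "Im (Digamma (Complex (1/4) y)) / 2 \<ge> 0.815"
    and "\<bar>Re (Digamma (Complex (1/4) y)) - ln (1/16 + y\<^sup>2) / 2\<bar> \<le> 0.015"
proof -
  let ?z = "Complex (1/4) y"
  define I where "I = Im (Digamma ?z)"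
  have w: "?z - 1/2 = Complex (-1/4) y" by (simp add: complex_eq_iff)
  have w0: "Complex (-1/4) y \<noteq> 0" by (simp add: complex_eq_iff)
  define a where "a = arctan (1 / (4 * y))"
  have ImLn: "Im (Ln (Complex (-1/4) y)) = pi / 2 + a"
  proof -
    have "arctan (1 / (4 * y)) = pi / 2 - arctan (4 * y)"
    proof -
      have "4 * y > 0" using y by simp
      from arctan_inverse[OF this] show ?thesis unfolding inverse_eq_divide .
    qed
    thus ?thesis using Im_Ln_eq[OF w0] y by (simp add: a_def arctan_minus mult.commute)
  qed
  have ReLn: "Re (Ln (Complex (-1/4) y)) = ln (1/16 + y\<^sup>2) / 2"
  proof -
    have "0 < 1/16 + y\<^sup>2" by (simp add: add_pos_nonneg)
    thus ?thesis using w0 by (simp add: Re_Ln cmod_def power2_eq_square ln_sqrt)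
  qed
  have a1: "a \<le> 0.082"
  proof -
    have "a \<le> 1 / (4 * y)" unfolding a_def using y by (intro arctan_le_self) auto
    also have "\<dots> \<le> 1 / (4 * 3.05)" using y by (intro divide_left_mono) auto
    finally show ?thesis by simp
  qed
  \<comment> \<open>1/(4 y) >= 1/12.8 > 0.078, and two terms of the arctan series suffice at
    0.078.\<close>
  have a2: "a \<ge> 0.077"
  proof -
    have "(\<Sum>k<2 * 1. (- 1) ^ k * (1 / real (k * 2 + 1) * (0.078::real) ^ (k * 2 + 1))) \<le> arctan 0.078"
      by (rule arctan_lower_bound) auto
    hence "0.077 \<le> arctan (0.078::real)" by (simp add: numeral_2_eq_2 power3_eq_cube eval_nat_numeral)
    also have "\<dots> \<le> a" unfolding a_def arctan_le_iff using y by (simp add: field_simps)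
    finally show ?thesis .
  qed
  \<comment> \<open>12 * 3.05^2 = 111.63.\<close>
  have y2: "12 * y\<^sup>2 \<ge> 111.6"
  proof -
    have "3.05 * 3.05 \<le> y * y" using y by (intro mult_mono) auto
    thus ?thesis by (simp add: power2_eq_square)
  qed
  have main: "norm (Digamma ?z - Ln (Complex (-1/4) y)) \<le> I / (12 * y\<^sup>2)"
    using Digamma_approx[of ?z] y unfolding w I_def by simp
  have I0: "I \<ge> 0"
  proof -
    have "0 \<le> I / (12 * y\<^sup>2)" using main norm_ge_zero order_trans by blast
    moreover have "12 * y\<^sup>2 > 0" using y2 by linarith
    ultimately show ?thesis by (simp add: zero_le_divide_iff)
  qed
  have err: "I / (12 * y\<^sup>2) \<le> I / 111.6" using y2 I0 by (intro divide_left_mono mult_pos_pos) auto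
  have "\<bar>I - (pi / 2 + a)\<bar> \<le> I / 111.6"
    using abs_Im_le_cmod[of "Digamma ?z - Ln (Complex (-1/4) y)"] main err ImLn by (simp add: I_def)
  \<comment> \<open>The error is a fraction of I itself; both inequalities are linear in I and can
    be solved for it.\<close>
  hence "I - (pi / 2 + a) \<le> I / 111.6" "- (I - (pi / 2 + a)) \<le> I / 111.6" unfolding abs_le_iff by auto
  hence I: "I \<ge> 1.63" "I \<le> 1.67" using a1 a2 pi_approx by simp_all
  thus "Im (Digamma ?z) / 2 \<ge> 0.815" by (simp add: I_def)
  show "\<bar>Re (Digamma (Complex (1/4) y)) - ln (1/16 + y\<^sup>2) / 2\<bar> \<le> 0.015"
  proof -
    have "\<bar>Re (Digamma ?z) - Re (Ln (Complex (-1/4) y))\<bar> \<le> I / 111.6"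
      using order_trans[OF abs_Re_le_cmod[of "Digamma ?z - Ln (Complex (-1/4) y)"] order_trans[OF main err]] by (simp only: minus_complex.sel)
    also have "\<dots> \<le> 0.015" using I by simp
    finally show ?thesis unfolding ReLn .
  qed
qed

text \<open>Up to the Digamma error, theta' at 2 y is ln ((1/16 + y^2) / pi^2) / 4. The error 0.015
  becomes 0.03 in ln (1/16 + y^2), hence the factor exp 0.03 in the comparison with pi^2.\<close>

lemma theta_d1_at_bracket: "theta_d1 6.1 < 0" "theta_d1 6.4 > 0"
proof -
  have p1: "pi\<^sup>2 \<ge> 9.869" "pi\<^sup>2 \<le> 9.87"
  proof -
    have "3.14159 * 3.14159 \<le> pi * pi" using pi_approx by (intro mult_mono) auto
    thus "pi\<^sup>2 \<ge> 9.869" by (simp add: power2_eq_square)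
    have "pi * pi \<le> 3.1416 * 3.1416" using pi_approx by (intro mult_mono) auto
    thus "pi\<^sup>2 \<le> 9.87" by (simp add: power2_eq_square)
  qed
  have lm: "ln (A * exp c) = ln A + c" if "A > 0" for A c :: real using that by (simp add: ln_mult)
  have lp: "2 * ln pi = ln (pi\<^sup>2)" by (simp add: ln_realpow)
  have "Re (Digamma (Complex (1/4) 3.05)) \<le> ln (1/16 + 3.05\<^sup>2) / 2 + 0.015"
    using Digamma_quarter_line(2)[of "3.05"] unfolding abs_le_iff by simp
  moreover have "ln (1/16 + 3.05\<^sup>2) < ln (pi\<^sup>2) - (0.03::real)"
  proof -
    have "exp (0.03::real) \<le> 1 + 0.03 + 0.03\<^sup>2" by (rule exp_bound) auto
    hence "(1/16 + 3.05\<^sup>2) * exp (0.03::real) \<le> (1/16 + 3.05\<^sup>2) * (1 + 0.03 + 0.03\<^sup>2)" by (intro mult_left_mono) auto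
    also have "\<dots> < pi\<^sup>2" using p1 by (simp add: power2_eq_square)
    finally have "ln ((1/16 + 3.05\<^sup>2) * exp (0.03::real)) < ln (pi\<^sup>2)" by (subst ln_less_cancel_iff) (auto intro!: mult_pos_pos add_pos_pos)
    thus ?thesis by (subst (asm) lm) (simp_all add: add_pos_pos)
  qed
  ultimately show "theta_d1 6.1 < 0" using lp unfolding theta_d1_def by simp
  have "Re (Digamma (Complex (1/4) 3.2)) \<ge> ln (1/16 + 3.2\<^sup>2) / 2 - 0.015"
    using Digamma_quarter_line(2)[of "3.2"] unfolding abs_le_iff by simp
  moreover have "ln (1/16 + 3.2\<^sup>2) > ln (pi\<^sup>2) + (0.03::real)"
  proof -
    have "exp (0.03::real) \<le> 1 + 0.03 + 0.03\<^sup>2" by (rule exp_bound) auto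
    hence "pi\<^sup>2 * exp 0.03 \<le> 9.87 * (1 + 0.03 + 0.03\<^sup>2)" using p1 by (intro mult_mono) auto
    also have "\<dots> < (1/16 + 3.2\<^sup>2 :: real)" by (simp add: power2_eq_square)
    finally have "ln (pi\<^sup>2 * exp 0.03) < ln (1/16 + 3.2\<^sup>2)" by (subst ln_less_cancel_iff) (auto intro!: mult_pos_pos add_pos_pos)
    thus ?thesis by (subst (asm) lm) (simp_all add: add_pos_pos)
  qed
  ultimately show "theta_d1 6.4 > 0" using lp unfolding theta_d1_def by simp
qed

lemma theta_d1_mono:
  assumes "0 \<le> s" "s < t"
  shows "theta_d1 s < theta_d1 t"
proof (rule DERIV_pos_imp_increasing_open[OF assms(2)])
  show "\<exists>d. (theta_d1 has_real_derivative d) (at x) \<and> d > 0" if "s < x" "x < t" for x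
    using theta_d1_deriv[of x] theta_d2_pos[of x] that assms by auto
  show "continuous_on {s..t} theta_d1"
    by (intro continuous_at_imp_continuous_on ballI DERIV_isCont[OF theta_d1_deriv])
qed

lemma theta_d1_zero:
  obtains t0 where "6.1 < t0" "t0 < 6.4" "theta_d1 t0 = 0" "\<And>t. 0 \<le> t \<Longrightarrow> theta_d1 t = 0 \<longleftrightarrow> t = t0"
    "\<And>t. t > t0 \<Longrightarrow> theta_d1 t > 0"
proof -
  have "\<exists>x\<ge>6.1. x \<le> 6.4 \<and> theta_d1 x = 0"
    using theta_d1_at_bracket
    by (intro IVT') (auto intro!: continuous_at_imp_continuous_on DERIV_isCont[OF theta_d1_deriv])
  then obtain t0 where t0: "6.1 \<le> t0" "t0 \<le> 6.4" "theta_d1 t0 = 0" by blast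
  show thesis
  proof (rule that[of t0])
    have "t0 \<noteq> 6.1" "t0 \<noteq> 6.4" using t0(3) theta_d1_at_bracket by (metis less_irrefl)+
    thus "6.1 < t0" "t0 < 6.4" using t0 by (simp_all only: less_le) auto
    show "theta_d1 t = 0 \<longleftrightarrow> t = t0" if "0 \<le> t" for t
      using theta_d1_mono[of t t0] theta_d1_mono[of t0 t] t0 that by (cases t t0 rule: linorder_cases) auto
    show "theta_d1 t > 0" if "t > t0" for t using theta_d1_mono[of t0 t] t0 that by auto
  qed (rule t0)
qed

section \<open>Numerical bounds on the critical line below 6.4\<close>

lemma half_line_FTC:
  fixes f F :: "real \<Rightarrow> complex"
  assumes int: "integrable lborel (\<lambda>u. indicator {0..} u *\<^sub>R f u)"
    and deriv: "\<And>u. u \<ge> 0 \<Longrightarrow> (F has_vector_derivative f u) (at u)"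
    and cont: "continuous_on UNIV f" and lim: "(F \<longlongrightarrow> L) at_top"
  shows "(\<integral>u. indicator {0..} u *\<^sub>R f u \<partial>lborel) = L - F 0"
proof -
  have "((\<lambda>b. LINT u:{0..b}|lborel. f u) \<longlongrightarrow> (LINT u:{0..}|lborel. f u)) at_top"
    by (rule tendsto_set_lebesgue_integral_at_top) (use int in \<open>auto simp: set_integrable_def\<close>)
  moreover have "((\<lambda>b. LINT u:{0..b}|lborel. f u) \<longlongrightarrow> L - F 0) at_top"
  proof (rule Lim_transform_eventually)
    show "((\<lambda>b. F b - F 0) \<longlongrightarrow> L - F 0) at_top" by (intro tendsto_intros lim)
    show "\<forall>\<^sub>F b in at_top. F b - F 0 = (LINT u:{0..b}|lborel. f u)"
      using eventually_ge_at_top[of 0]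
    proof eventually_elim
      case (elim b)
      have "(f has_integral (F b - F 0)) {0..b}"
        by (rule fundamental_theorem_of_calculus[OF elim]) (use deriv in \<open>auto intro: has_vector_derivative_at_within\<close>)
      moreover have "(LINT u:{0..b}|lborel. f u) = integral {0..b} f"
        by (intro set_borel_integral_eq_integral borel_integrable_atLeastAtMost' continuous_on_subset[OF cont]) auto
      ultimately show ?case by (simp add: integral_unique)
    qed
  qed
  ultimately show ?thesis unfolding set_lebesgue_integral_def by (rule tendsto_unique[rotated]) simp
qed

lemma power_exp_bound:
  fixes a u :: real
  assumes a: "a > 0"
  obtains C where "C \<ge> 0" "\<And>u. u \<ge> 0 \<Longrightarrow> u ^ k * exp (- a * u) \<le> C * exp (- (a / 2) * u)"
proof -
  define c where "c = a / (2 * real (k + 1))"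
  have c: "c > 0" using a by (simp add: c_def)
  have kc: "real k * c \<le> a / 2" using a by (simp add: c_def field_simps)
  have "u ^ k * exp (- a * u) \<le> (1 / c) ^ k * exp (- (a / 2) * u)" if u: "u \<ge> 0" for u
  proof -
    have "c * u \<le> exp (c * u)" using exp_ge_add_one_self[of "c * u"] by linarith
    hence "u \<le> 1 / c * exp (c * u)" using c by (simp add: field_simps)
    hence "u ^ k \<le> (1 / c * exp (c * u)) ^ k" using u by (intro power_mono) auto
    also have "\<dots> = (1 / c) ^ k * exp (real k * (c * u))" by (simp only: power_mult_distrib exp_of_nat_mult)
    also have "\<dots> \<le> (1 / c) ^ k * exp (a / 2 * u)"
      using kc u c mult_right_mono[OF kc u] by (intro mult_left_mono) (auto simp: mult.assoc)
    finally have "u ^ k * exp (- a * u) \<le> (1 / c) ^ k * exp (a / 2 * u) * exp (- a * u)" by (intro mult_right_mono) auto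
    also have "\<dots> = (1 / c) ^ k * exp (- (a / 2) * u)" by (simp add: mult.assoc flip: exp_add)
    finally show ?thesis .
  qed
  thus thesis using c by (intro that[of "(1 / c) ^ k"]) auto
qed

lemma power_exp_integral:
  fixes \<mu> :: complex
  assumes \<mu>: "Re \<mu> > 0"
  shows "has_bochner_integral lborel (\<lambda>u. indicator {0..} u *\<^sub>R (of_real u ^ k * exp (- \<mu> * of_real u))) (fact k / \<mu> ^ Suc k)"
proof (induction k)
  case 0
  show ?case using exp_half_line_integral[OF \<mu>] by simp
next
  case (Suc k)
  have \<mu>0: "\<mu> \<noteq> 0" using \<mu> by auto
  obtain C where C: "C \<ge> 0" "\<And>u. u \<ge> 0 \<Longrightarrow> u ^ Suc k * exp (- Re \<mu> * u) \<le> C * exp (- (Re \<mu> / 2) * u)"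
    using power_exp_bound[OF \<mu>] by blast
  let ?g = "\<lambda>u. of_real u ^ Suc k * exp (- \<mu> * of_real u)"
  have "integrable lborel (\<lambda>u. indicator {0..} u *\<^sub>R exp (- of_real (Re \<mu> / 2) * complex_of_real u))"
    using exp_half_line_integral[of "of_real (Re \<mu> / 2)"] \<mu> by (simp add: has_bochner_integral_iff)
  from integrable_mult_right[OF integrable_norm[OF this], of C]
  have int: "integrable lborel (\<lambda>u. indicator {0..} u *\<^sub>R ?g u)"
  proof (rule Bochner_Integration.integrable_bound)
    show "AE u in lborel. norm (indicator {0..} u *\<^sub>R ?g u) \<le> norm (C * norm (indicator {0..} u *\<^sub>R exp (- of_real (Re \<mu> / 2) * complex_of_real u)))"
      using C by (intro AE_I2) (auto simp: indicator_def norm_mult norm_power norm_exp_eq_Re simp del: power_Suc)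
  qed measurable
  define F where "F = (\<lambda>u. - ?g u / \<mu>)"
  define f where "f = (\<lambda>u. ?g u - of_nat (Suc k) / \<mu> * (of_real u ^ k * exp (- \<mu> * of_real u)))"
  have "(\<integral>u. indicator {0..} u *\<^sub>R f u \<partial>lborel) = 0 - F 0"
  proof (rule half_line_FTC)
    have "integrable lborel (\<lambda>u. indicator {0..} u *\<^sub>R ?g u - of_nat (Suc k) / \<mu> * (indicator {0..} u *\<^sub>R (of_real u ^ k * exp (- \<mu> * of_real u))))"
      using Suc by (intro Bochner_Integration.integrable_diff int integrable_mult_right) (simp add: has_bochner_integral_iff)
    thus "integrable lborel (\<lambda>u. indicator {0..} u *\<^sub>R f u)"
      unfolding f_def by (simp only: scaleR_right_diff_distrib mult_scaleR_right)
    show "(F has_vector_derivative f u) (at u)" for u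
    proof -
      have "((\<lambda>z. - (z ^ Suc k * exp (- \<mu> * z)) / \<mu>) has_field_derivative f u) (at (of_real u))"
      proof -
        have 1: "((\<lambda>z. z ^ Suc k) has_field_derivative (1 + of_nat k) * (1 * (of_real u :: complex) ^ k)) (at (of_real u))"
          by (rule DERIV_power_Suc[OF DERIV_ident])
        have 2: "((\<lambda>z. exp (- \<mu> * z)) has_field_derivative - \<mu> * exp (- \<mu> * of_real u)) (at (of_real u))"
          by (auto intro!: derivative_eq_intros)
        have alg: "- (a * b * E + - \<mu> * E * P) / \<mu> = P * E - a / \<mu> * (b * E)" for a b E P
          using \<mu>0 by (simp add: field_simps)
        from DERIV_cdivide[OF DERIV_minus[OF DERIV_mult[OF 1 2]], of \<mu>]
        show ?thesis unfolding f_def of_nat_Suc mult_1 alg .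
      qed
      from has_vector_derivative_real_field[OF this] show ?thesis unfolding F_def .
    qed
    show "continuous_on UNIV f" unfolding f_def by (intro continuous_intros)
    have "((\<lambda>u. C * exp (- (Re \<mu> / 2) * u)) \<longlongrightarrow> 0) at_top" using \<mu> by real_asymp
    from tendsto_mult_left[OF this, of "1 / norm \<mu>"]
    have "((\<lambda>u. 1 / norm \<mu> * (C * exp (- (Re \<mu> / 2) * u))) \<longlongrightarrow> 0) at_top" by simp
    thus "(F \<longlongrightarrow> 0) at_top"
    proof (rule Lim_null_comparison[rotated])
      show "\<forall>\<^sub>F u in at_top. norm (F u) \<le> 1 / norm \<mu> * (C * exp (- (Re \<mu> / 2) * u))"
        using eventually_ge_at_top[of 0]
      proof eventually_elim
        case (elim u)
        have "norm (F u) = 1 / norm \<mu> * (u ^ Suc k * exp (- Re \<mu> * u))"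
          using elim by (simp add: F_def norm_divide norm_mult norm_power norm_exp_eq_Re del: power_Suc)
        also have "\<dots> \<le> 1 / norm \<mu> * (C * exp (- (Re \<mu> / 2) * u))" by (intro mult_left_mono C elim) auto
        finally show ?case .
      qed
    qed
  qed
  also have "F 0 = 0" by (simp add: F_def)
  finally have "(\<integral>u. indicator {0..} u *\<^sub>R f u \<partial>lborel) = 0" by simp
  moreover have "(\<integral>u. indicator {0..} u *\<^sub>R f u \<partial>lborel) = (\<integral>u. indicator {0..} u *\<^sub>R ?g u \<partial>lborel)
      - of_nat (Suc k) / \<mu> * (fact k / \<mu> ^ Suc k)"
  proof -
    have "(\<integral>u. indicator {0..} u *\<^sub>R f u \<partial>lborel) = (\<integral>u. indicator {0..} u *\<^sub>R ?g u
        - of_nat (Suc k) / \<mu> * (indicator {0..} u *\<^sub>R (of_real u ^ k * exp (- \<mu> * of_real u))) \<partial>lborel)"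
      unfolding f_def by (simp only: scaleR_right_diff_distrib mult_scaleR_right)
    also have "\<dots> = (\<integral>u. indicator {0..} u *\<^sub>R ?g u \<partial>lborel) - (\<integral>u. of_nat (Suc k) / \<mu> * (indicator {0..} u *\<^sub>R (of_real u ^ k * exp (- \<mu> * of_real u))) \<partial>lborel)"
      using Suc by (intro Bochner_Integration.integral_diff int integrable_mult_right) (simp add: has_bochner_integral_iff)
    finally show ?thesis unfolding integral_mult_right_zero using Suc by (simp only: has_bochner_integral_iff)
  qed
  ultimately have "(\<integral>u. indicator {0..} u *\<^sub>R ?g u \<partial>lborel) = of_nat (Suc k) / \<mu> * (fact k / \<mu> ^ Suc k)" by simp
  also have "\<dots> = fact (Suc k) / \<mu> ^ Suc (Suc k)" using \<mu>0 by (simp add: field_simps)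
  finally show ?case using int by (simp only: has_bochner_integral_iff)
qed

lemma power_exp_cos_integral:
  fixes l t :: real
  assumes l: "l > 0"
  shows "has_bochner_integral lborel (\<lambda>u. indicator {0..} u * (u ^ k * exp (- l * u) * cos (t * u))) (Re (fact k / Complex l (- t) ^ Suc k))"
    and "has_bochner_integral lborel (\<lambda>u. indicator {0..} u * (u ^ k * exp (- l * u) * sin (t * u))) (Im (fact k / Complex l (- t) ^ Suc k))"
proof -
  have P: "has_bochner_integral lborel (\<lambda>u. indicator {0..} u *\<^sub>R (of_real u ^ k * exp (- Complex l (- t) * of_real u))) (fact k / Complex l (- t) ^ Suc k)"
    by (rule power_exp_integral) (use l in simp)
  have "Re (of_real u ^ k * exp (- Complex l (- t) * of_real u)) = u ^ k * exp (- l * u) * cos (t * u)"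
    "Im (of_real u ^ k * exp (- Complex l (- t) * of_real u)) = u ^ k * exp (- l * u) * sin (t * u)" for u
    by (simp_all add: Re_exp Im_exp flip: of_real_power)
  thus "has_bochner_integral lborel (\<lambda>u. indicator {0..} u * (u ^ k * exp (- l * u) * cos (t * u))) (Re (fact k / Complex l (- t) ^ Suc k))"
    "has_bochner_integral lborel (\<lambda>u. indicator {0..} u * (u ^ k * exp (- l * u) * sin (t * u))) (Im (fact k / Complex l (- t) ^ Suc k))"
    using has_bochner_integral_bounded_linear[OF bounded_linear_Re P] has_bochner_integral_bounded_linear[OF bounded_linear_Im P]
    by (simp_all only: scaleR_complex.sel)
qed

lemma power_exp_real_integral:
  fixes l :: real
  assumes l: "l > 0"
  shows "has_bochner_integral lborel (\<lambda>u. indicator {0..} u * (u ^ k * exp (- l * u))) (fact k / l ^ Suc k)"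
proof -
  have "Complex l (- 0) = of_real l" by (simp add: complex_of_real_def)
  hence "fact k / Complex l (- 0) ^ Suc k = of_real (fact k / l ^ Suc k)" by simp
  hence "Re (fact k / Complex l (- 0) ^ Suc k) = fact k / l ^ Suc k" by (simp only: Re_complex_of_real)
  thus ?thesis using power_exp_cos_integral(1)[OF l, of k 0] by (simp only: mult_zero_left cos_zero mult_1_right)
qed

section \<open>Two-sided bounds for the theta kernel\<close>

lemma exp_ge_partial_sum:
  fixes x :: real
  assumes "x \<ge> 0"
  shows "(\<Sum>k\<le>n. x ^ k / fact k) \<le> exp x"
proof -
  have "exp x = (\<Sum>k. x ^ k / fact k)" by (simp add: exp_def divide_inverse mult.commute)
  moreover have "(\<Sum>k\<le>n. x ^ k / fact k) \<le> (\<Sum>k. x ^ k / fact k)"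
    using assms summable_exp[of x] by (intro sum_le_suminf) (auto simp: divide_inverse mult.commute)
  ultimately show ?thesis by simp
qed

lemma exp_one_ge: "exp (1::real) \<ge> 2.718"
  using exp_ge_partial_sum[of 1 6] by (simp add: eval_nat_numeral)

text \<open>The logarithm of the polynomial is compared with the exponent through derivatives;
  the hypotheses say that the resulting numerator has nonnegative coefficients.\<close>

lemma exp_kernel_poly_bound:
  fixes b d e u :: real
  assumes u: "u \<ge> 0" and b: "b \<ge> 0" "d \<ge> 0" "e \<ge> 0"
    and c1: "2 * d - b\<^sup>2 + 4 * pi \<ge> 0" and c2: "3 * e - b * d + 4 * pi * b + 4 * pi \<ge> 0"
    and c3: "- b * e + 4 * pi * d + 4 * pi * b \<ge> 0"
  shows "exp (- pi * (exp (2 * u) - 1)) \<le> exp (- (2 * pi + b) * u) * (1 + b * u + d * u\<^sup>2 + e * u ^ 3)"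
proof -
  define p where "p = (\<lambda>u::real. 1 + b * u + d * u\<^sup>2 + e * u ^ 3)"
  \<comment> \<open>What remains of pi (exp (2 u) - 1), with exp replaced by its cubic Taylor
    polynomial, after the linear part (2 pi + b) u has been split off.\<close>
  define q where "q = (\<lambda>u::real. - b * u + 2 * pi * u\<^sup>2 + 4 * pi / 3 * u ^ 3)"
  define H where "H = (\<lambda>u. p u * exp (q u))"
  have "H 0 \<le> H u"
  proof (rule DERIV_nonneg_imp_nondecreasing[OF u])
    fix x :: real assume x: "0 \<le> x" "x \<le> u"
    have "(H has_real_derivative (exp (q x) * ((b + 2 * d * x + 3 * e * x\<^sup>2) + p x * (- b + 4 * pi * x + 4 * pi * x\<^sup>2)))) (at x)"
      unfolding H_def p_def q_def by (auto intro!: derivative_eq_intros simp: power2_eq_square algebra_simps)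
    moreover have "(b + 2 * d * x + 3 * e * x\<^sup>2) + p x * (- b + 4 * pi * x + 4 * pi * x\<^sup>2) =
       (2 * d - b\<^sup>2 + 4 * pi) * x + (3 * e - b * d + 4 * pi * b + 4 * pi) * x\<^sup>2
       + (- b * e + 4 * pi * d + 4 * pi * b) * x ^ 3 + (4 * pi * e + 4 * pi * d) * x ^ 4 + 4 * pi * e * x ^ 5"
      by (simp add: p_def eval_nat_numeral algebra_simps)
    moreover have "\<dots> \<ge> 0"
    proof -
      have "0 \<le> (2 * d - b\<^sup>2 + 4 * pi) * x" by (rule mult_nonneg_nonneg[OF c1 x(1)])
      moreover have "0 \<le> (3 * e - b * d + 4 * pi * b + 4 * pi) * x\<^sup>2" by (rule mult_nonneg_nonneg[OF c2]) simp
      moreover have "0 \<le> (- b * e + 4 * pi * d + 4 * pi * b) * x ^ 3" by (rule mult_nonneg_nonneg[OF c3]) (use x in simp)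
      moreover have "0 \<le> (4 * pi * e + 4 * pi * d) * x ^ 4" "0 \<le> 4 * pi * e * x ^ 5" using b x by simp_all
      ultimately show ?thesis by linarith
    qed
    ultimately show "\<exists>y. (H has_real_derivative y) (at x) \<and> 0 \<le> y"
      by (intro exI conjI) (assumption, simp)
  qed
  hence "1 \<le> p u * exp (q u)" by (simp add: H_def p_def q_def)
  hence "exp (- (q u)) \<le> p u" by (simp add: exp_minus field_simps)
  hence 1: "exp (- b * u) * exp (- (q u)) \<le> exp (- b * u) * p u" by (intro mult_left_mono) auto
  have "(\<Sum>k\<le>3. (2 * u) ^ k / fact k) \<le> exp (2 * u)" using u by (intro exp_ge_partial_sum) auto
  hence "1 + 2 * u + 2 * u\<^sup>2 + 4 / 3 * u ^ 3 \<le> exp (2 * u)" by (simp add: eval_nat_numeral field_simps)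
  hence "pi * (2 * u + 2 * u\<^sup>2 + 4 / 3 * u ^ 3) \<le> pi * (exp (2 * u) - 1)" by (intro mult_left_mono) auto
  hence "- pi * (exp (2 * u) - 1) \<le> - (2 * pi * u) + (- b * u) + (- (q u))" by (simp add: q_def algebra_simps)
  hence "exp (- pi * (exp (2 * u) - 1)) \<le> exp (- (2 * pi * u) + (- b * u) + (- (q u)))" by (simp only: exp_le_cancel_iff)
  also have "\<dots> = exp (- (2 * pi * u)) * (exp (- b * u) * exp (- (q u)))" by (simp only: exp_add mult.assoc)
  also have "\<dots> \<le> exp (- (2 * pi * u)) * (exp (- b * u) * p u)" by (intro mult_left_mono 1) auto
  also have "\<dots> = exp (- (2 * pi + b) * u) * p u"
  proof -
    have "- (2 * pi + b) * u = - (2 * pi * u) + - b * u" by (simp add: algebra_simps)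
    thus ?thesis by (simp only: exp_add mult.assoc)
  qed
  finally show ?thesis by (simp add: p_def)
qed

text \<open>The n = 1 term of \<open>theta_kernel\<close>; the remaining terms add at most one part
  in 5000.\<close>

definition theta_kernel1 :: "real \<Rightarrow> real" where
  "theta_kernel1 u = indicator {0..} u * (4 * exp (u / 2) * exp (- pi * exp (2 * u)))"

lemma theta_kernel1_measurable [measurable]: "theta_kernel1 \<in> borel_measurable borel"
  unfolding theta_kernel1_def by measurable

lemma theta_kernel1_bounds:
  "0 \<le> theta_kernel1 u" "theta_kernel1 u \<le> theta_kernel u" "theta_kernel u \<le> 1.0002 * theta_kernel1 u"
proof -
  show "0 \<le> theta_kernel1 u" by (simp add: theta_kernel1_def)
  define X where "X = exp (2 * u)"
  define S where "S = (\<Sum>n. exp (- pi * real (Suc n) ^ 2 * X))"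
  have sm: "summable (\<lambda>n. exp (- pi * real (Suc n) ^ 2 * X))" by (rule theta_tail_of_real(2)) (simp add: X_def)
  have "(\<Sum>n\<in>{0}. exp (- pi * real (Suc n) ^ 2 * X)) \<le> S" unfolding S_def by (intro sum_le_suminf sm) auto
  hence S1: "exp (- pi * X) \<le> S" by simp
  thus "theta_kernel1 u \<le> theta_kernel u" by (simp add: theta_kernel1_def theta_kernel_def X_def S_def mult_left_mono)
  show "theta_kernel u \<le> 1.0002 * theta_kernel1 u"
  proof (cases "u \<ge> 0")
    case True
    hence X: "X \<ge> 1" by (simp add: X_def)
    \<comment> \<open>Since (n+1)^2 - 1 >= 3 n, the terms are dominated by a geometric series of
      ratio exp (- 3 pi).\<close>
    define q where "q = exp (- 3 * pi)"
    have "(2.7::real) ^ 9 \<le> exp 1 ^ 9" using exp_one_ge by (intro power_mono) auto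
    also have "\<dots> = exp (9::real)" by (simp flip: exp_of_nat_mult)
    also have "\<dots> \<le> exp (3 * pi)" using pi_gt3 by simp
    finally have q: "0 \<le> q" "q \<le> 0.0001999" by (simp_all add: q_def exp_minus field_simps eval_nat_numeral)
    have trm: "exp (- pi * real (Suc n) ^ 2 * X) \<le> exp (- pi * X) * q ^ n" for n
    proof -
      have "real n \<le> real n * real n" by (cases n) auto
      hence "3 * real n \<le> (real (Suc n) ^ 2 - 1) * 1" by (simp add: power2_eq_square algebra_simps)
      also have "\<dots> \<le> (real (Suc n) ^ 2 - 1) * X" using X by (intro mult_left_mono) (auto simp: power2_eq_square algebra_simps)
      finally have "pi * (3 * real n) \<le> pi * ((real (Suc n) ^ 2 - 1) * X)" by (intro mult_left_mono) auto
      hence "- pi * real (Suc n) ^ 2 * X \<le> - pi * X + real n * (- 3 * pi)" by (simp add: algebra_simps)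
      hence "exp (- pi * real (Suc n) ^ 2 * X) \<le> exp (- pi * X + real n * (- 3 * pi))" by (simp only: exp_le_cancel_iff)
      thus ?thesis by (simp only: exp_add exp_of_nat_mult q_def)
    qed
    have gs: "(\<lambda>n. exp (- pi * X) * q ^ n) sums (exp (- pi * X) * (1 / (1 - q)))"
      using q by (intro sums_mult geometric_sums) auto
    have "S \<le> exp (- pi * X) * (1 / (1 - q))"
      unfolding S_def sums_unique[OF gs] by (intro suminf_le trm sm sums_summable[OF gs])
    also have "\<dots> \<le> exp (- pi * X) * 1.0002" using q by (intro mult_left_mono) (auto simp: field_simps)
    finally have "4 * exp (u / 2) * S \<le> 4 * exp (u / 2) * (exp (- pi * X) * 1.0002)" by (intro mult_left_mono) auto
    thus ?thesis using True by (simp add: theta_kernel_def theta_kernel1_def X_def S_def mult_ac)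
  qed (simp add: theta_kernel_def theta_kernel1_def)
qed

lemma exp_pi_ge: "exp pi \<ge> 23.1"
proof -
  have "(1 + 0.1415 + 0.1415\<^sup>2 / 2 :: real) \<le> exp 0.1415" by (rule exp_lower_Taylor_quadratic) simp
  moreover have "(2.718::real) ^ 3 \<le> exp 1 ^ 3" using exp_one_ge by (intro power_mono) auto
  ultimately have "2.718 ^ 3 * (1 + 0.1415 + 0.1415\<^sup>2 / 2) \<le> exp 1 ^ 3 * exp (0.1415::real)"
    by (intro mult_mono) auto
  also have "\<dots> = exp (3 + 0.1415)" unfolding exp_add by (simp flip: exp_of_nat_mult)
  also have "\<dots> \<le> exp pi" unfolding exp_le_cancel_iff using pi_approx by simp
  finally show ?thesis by (simp add: eval_nat_numeral)
qed

text \<open>The value 5.783 is 2 pi - 1/2 rounded down: 2 pi from the exponent of the majorant, 1/2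
  from the factor exp (u / 2).\<close>

lemma theta_kernel1_le_poly:
  fixes b d e u :: real
  assumes "b \<ge> 0" "d \<ge> 0" "e \<ge> 0" "2 * d - b\<^sup>2 + 4 * pi \<ge> 0" "3 * e - b * d + 4 * pi * b + 4 * pi \<ge> 0"
    "- b * e + 4 * pi * d + 4 * pi * b \<ge> 0"
  shows "theta_kernel1 u \<le> 4 * exp (- pi) * (indicator {0..} u * (exp (- (5.783 + b) * u) * (1 + b * u + d * u\<^sup>2 + e * u ^ 3)))"
proof (cases "u \<ge> 0")
  case True
  define p where "p = 1 + b * u + d * u\<^sup>2 + e * u ^ 3"
  have p: "p \<ge> 0" using assms True by (simp add: p_def)
  have "exp (- pi * exp (2 * u)) = exp (- pi) * exp (- pi * (exp (2 * u) - 1))" by (simp add: algebra_simps flip: exp_add)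
  also have "\<dots> \<le> exp (- pi) * (exp (- (2 * pi + b) * u) * p)"
    unfolding p_def by (intro mult_left_mono exp_kernel_poly_bound True assms) auto
  finally have "4 * exp (u / 2) * exp (- pi * exp (2 * u)) \<le> 4 * exp (u / 2) * (exp (- pi) * (exp (- (2 * pi + b) * u) * p))"
    by (intro mult_left_mono) auto
  also have "\<dots> = 4 * exp (- pi) * (exp (u / 2 + - (2 * pi + b) * u) * p)" by (simp only: exp_add mult_ac)
  also have "\<dots> \<le> 4 * exp (- pi) * (exp (- (5.783 + b) * u) * p)"
  proof -
    have "5.783 * u \<le> (2 * pi - 1/2) * u" using pi_approx True by (intro mult_right_mono) auto
    hence "u / 2 + - (2 * pi + b) * u \<le> - (5.783 + b) * u" by (simp add: algebra_simps)
    thus ?thesis using p by (intro mult_left_mono mult_right_mono) auto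
  qed
  finally show ?thesis using True by (simp add: theta_kernel1_def p_def)
qed (simp add: theta_kernel1_def)

lemma theta_kernel1_integrable: "integrable lborel theta_kernel1"
proof (rule Bochner_Integration.integrable_bound)
  show "integrable lborel (\<lambda>u. \<bar>theta_kernel u\<bar> * exp (0 * u))" by (rule theta.abs_int)
  show "AE u in lborel. norm (theta_kernel1 u) \<le> norm (\<bar>theta_kernel u\<bar> * exp (0 * u))"
    using theta_kernel1_bounds by (intro AE_I2) (simp add: abs_of_nonneg theta_kernel_nonneg)
qed measurable

text \<open>With x = pi exp (2 u) the integral is 2 pi^(-1/4) times the incomplete Gamma function
  Gamma(1/4, pi). P/Q is the second convergent of its continued fraction, (x + 11/4) / ((x + 3/4) (x
  + 11/4) - 3/4), and it approximates from below.\<close>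

lemma theta_kernel1_integral_ge: "4 * exp (- pi) * 0.1328 \<le> (\<integral>u. theta_kernel1 u \<partial>lborel)"
proof -
  define X where "X = (\<lambda>u. pi * exp (2 * u))"
  define P where "P = (\<lambda>x::real. x + 11/4)"
  define Q where "Q = (\<lambda>x::real. x\<^sup>2 + 7/2 * x + 21/16)"
  define G where "G = (\<lambda>u. exp (- X u) * exp (u / 2) * (P (X u) / Q (X u)))"
  define G' where "G' = (\<lambda>u. exp (- X u) * exp (u / 2) * ((- 2 * X u + 1/2) * (P (X u) / Q (X u))
      + (2 * X u * Q (X u) - P (X u) * (2 * X u * (2 * X u + 7/2))) / (Q (X u))\<^sup>2))"
  have Xp: "X u > 0" for u by (simp add: X_def)
  have Qp: "Q x > 0" if "x > 0" for x using that by (simp add: Q_def add_pos_pos)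
  have XD: "(X has_real_derivative 2 * X u) (at u)" for u unfolding X_def by (auto intro!: derivative_eq_intros)
  have PD: "((\<lambda>u. P (X u)) has_real_derivative 2 * X u) (at u)" for u
    unfolding P_def using XD[of u] by (auto intro!: derivative_eq_intros)
  have QD: "((\<lambda>u. Q (X u)) has_real_derivative 2 * X u * (2 * X u + 7/2)) (at u)" for u
    unfolding Q_def using XD[of u] by (auto intro!: derivative_eq_intros simp: algebra_simps)
  have ED: "((\<lambda>u. exp (- X u) * exp (u / 2)) has_real_derivative exp (- X u) * exp (u / 2) * (- 2 * X u + 1/2)) (at u)" for u
    using XD[of u] by (auto intro!: derivative_eq_intros simp: algebra_simps)
  have RD: "((\<lambda>u. P (X u) / Q (X u)) has_real_derivative (2 * X u * Q (X u) - P (X u) * (2 * X u * (2 * X u + 7/2))) / (Q (X u) * Q (X u))) (at u)" for u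
    by (rule DERIV_divide[OF PD QD]) (use Qp[OF Xp[of u]] in simp)
  have GD: "(G has_real_derivative G' u) (at u)" for u
    using DERIV_mult[OF ED RD, of u] unfolding G_def G'_def by (simp add: power2_eq_square algebra_simps)
  have le: "- 2 * G' u \<le> 4 * exp (u / 2) * exp (- pi * exp (2 * u))" for u
  proof -
    define x where "x = X u"
    have x: "x > 0" "Q x > 0" using Xp Qp by (auto simp: x_def)
    \<comment> \<open>The defect of the convergent is the constant 21/4 over Q^2; its positivity is
      the lower bound.\<close>
    have "2 * (Q x)\<^sup>2 - ((2 * x - 1/2) * (P x * Q x) - (2 * x * Q x - P x * (2 * x * (2 * x + 7/2)))) = 21/4"
      unfolding P_def Q_def by (simp add: power2_eq_square field_simps)
    hence "(2 * x - 1/2) * (P x * Q x) - (2 * x * Q x - P x * (2 * x * (2 * x + 7/2))) \<le> 2 * (Q x)\<^sup>2" by linarith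
    hence "((2 * x - 1/2) * (P x * Q x) - (2 * x * Q x - P x * (2 * x * (2 * x + 7/2)))) / (Q x)\<^sup>2 \<le> 2"
      using x by (simp add: divide_le_eq)
    moreover have "((2 * x - 1/2) * (P x * Q x) - (2 * x * Q x - P x * (2 * x * (2 * x + 7/2)))) / (Q x)\<^sup>2 =
        - ((- 2 * x + 1/2) * (P x / Q x) + (2 * x * Q x - P x * (2 * x * (2 * x + 7/2))) / (Q x)\<^sup>2)"
    proof -
      have "P x / Q x = P x * Q x / (Q x)\<^sup>2" using x by (simp add: power2_eq_square)
      thus ?thesis by (simp only:) (simp add: diff_divide_distrib add_divide_distrib algebra_simps)
    qed
    ultimately have "- ((- 2 * x + 1/2) * (P x / Q x) + (2 * x * Q x - P x * (2 * x * (2 * x + 7/2))) / (Q x)\<^sup>2) \<le> 2" by simp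
    hence h1: "2 * (exp (- x) * exp (u / 2)) * - ((- 2 * x + 1/2) * (P x / Q x) + (2 * x * Q x - P x * (2 * x * (2 * x + 7/2))) / (Q x)\<^sup>2)
        \<le> 2 * (exp (- x) * exp (u / 2)) * 2" by (intro mult_left_mono) auto
    have h2: "- 2 * G' u = 2 * (exp (- x) * exp (u / 2)) * - ((- 2 * x + 1/2) * (P x / Q x) + (2 * x * Q x - P x * (2 * x * (2 * x + 7/2))) / (Q x)\<^sup>2)"
    proof -
      have "- 2 * (a * br) = 2 * a * - br" for a br :: real by simp
      thus ?thesis unfolding G'_def x_def .
    qed
    have h3: "exp (- pi * exp (2 * u)) = exp (- x)" by (simp add: x_def X_def)
    have "- 2 * G' u \<le> 2 * (exp (- x) * exp (u / 2)) * 2" unfolding h2 by (rule h1)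
    also have "\<dots> = 4 * exp (u / 2) * exp (- x)" by simp
    finally show ?thesis unfolding h3 .
  qed
  have "2 * G 0 - 2 * G b \<le> (\<integral>u. theta_kernel1 u \<partial>lborel)" if b: "b \<ge> 0" for b
  proof -
    let ?f = "\<lambda>u. 4 * exp (u / 2) * exp (- pi * exp (2 * u))"
    have hi: "((\<lambda>u. - 2 * G' u) has_integral ((- 2) * G b - (- 2) * G 0)) {0..b}"
    proof (rule fundamental_theorem_of_calculus[OF b])
      fix x assume "x \<in> {0..b}"
      show "((\<lambda>u. (- 2) * G u) has_vector_derivative - 2 * G' x) (at x within {0..b})"
        by (rule has_vector_derivative_at_within, subst has_real_derivative_iff_has_vector_derivative[symmetric])
           (rule DERIV_cmult[OF GD])
    qed
    have ci: "continuous_on {0..b} ?f" by (auto intro!: continuous_intros)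
    have "(- 2) * G b - (- 2) * G 0 \<le> integral {0..b} ?f"
      by (rule has_integral_le[OF hi integrable_integral[OF integrable_continuous_interval[OF ci]]]) (rule le)
    also have "integral {0..b} ?f = (LINT u:{0..b}|lborel. ?f u)"
      by (rule set_borel_integral_eq_integral(2)[symmetric]) (intro borel_integrable_atLeastAtMost' ci)
    also have "\<dots> \<le> (\<integral>u. theta_kernel1 u \<partial>lborel)"
      unfolding set_lebesgue_integral_def
    proof (rule integral_mono)
      show "integrable lborel (\<lambda>u. indicat_real {0..b} u *\<^sub>R ?f u)"
        using borel_integrable_atLeastAtMost'[OF ci] by (simp add: set_integrable_def)
      show "indicat_real {0..b} u *\<^sub>R ?f u \<le> theta_kernel1 u" for u
        by (auto simp: theta_kernel1_def indicator_def)
    qed (rule theta_kernel1_integrable)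
    finally show ?thesis by simp
  qed
  moreover have "(G \<longlongrightarrow> 0) at_top" unfolding G_def X_def P_def Q_def by real_asymp
  hence "((\<lambda>b. 2 * G 0 - 2 * G b) \<longlongrightarrow> 2 * G 0 - 2 * 0) at_top" by (intro tendsto_intros)
  ultimately have "2 * G 0 - 2 * 0 \<le> (\<integral>u. theta_kernel1 u \<partial>lborel)"
    by (intro tendsto_upperbound) (auto intro: eventually_mono[OF eventually_ge_at_top[of 0]])
  moreover have "0.2656 \<le> P pi / Q pi"
  proof -
    have "pi * pi \<le> 3.1416 * 3.1416" using pi_approx by (intro mult_mono) auto
    hence "0.2656 * Q pi \<le> P pi" unfolding P_def Q_def power2_eq_square using pi_approx by simp
    thus ?thesis using Qp[of pi] by (simp add: le_divide_eq)
  qed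
  hence "2 * exp (- pi) * 0.2656 \<le> 2 * exp (- pi) * (P pi / Q pi)" by (intro mult_left_mono) auto
  ultimately show ?thesis by (simp add: G_def X_def)
qed

text \<open>Bounding the cosine by 1 is enough, but only just: at |t| = 6.4 the integral bound is
  about 0.0239 against 1/(1/4 + t^2) of about 0.0243. This calls for a cubic majorant.\<close>

lemma xi_line_neg:
  assumes t: "\<bar>t\<bar> \<le> 6.4"
  shows "xi_line t < 0"
proof -
  \<comment> \<open>Here b = 8.8, and d = 32.44, e = 54.15 lie just above the least values that the
    first two coefficient conditions of \<open>exp_kernel_poly_bound\<close> permit.\<close>
  define l :: real where "l = 5.783 + 8.8"
  let ?B = "\<lambda>k u. indicator {0..} u * (u ^ k * exp (- l * u))"
  have B: "has_bochner_integral lborel (?B k) (fact k / l ^ Suc k)" for k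
    by (rule power_exp_real_integral) (simp add: l_def)
  have hb: "has_bochner_integral lborel (\<lambda>u. 1.0002 * (4 * exp (- pi)) * (?B 0 u + 8.8 * ?B 1 u + 32.44 * ?B 2 u + 54.15 * ?B 3 u))
     (1.0002 * (4 * exp (- pi)) * (fact 0 / l ^ Suc 0 + 8.8 * (fact 1 / l ^ Suc 1) + 32.44 * (fact 2 / l ^ Suc 2) + 54.15 * (fact 3 / l ^ Suc 3)))"
    by (intro has_bochner_integral_mult_right has_bochner_integral_add B)
  have k1: "theta_kernel1 u \<le> 4 * exp (- pi) * (?B 0 u + 8.8 * ?B 1 u + 32.44 * ?B 2 u + 54.15 * ?B 3 u)" for u
  proof -
    have "theta_kernel1 u \<le> 4 * exp (- pi) * (indicator {0..} u * (exp (- (5.783 + 8.8) * u) * (1 + 8.8 * u + 32.44 * u\<^sup>2 + 54.15 * u ^ 3)))"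
      by (rule theta_kernel1_le_poly) (use pi_approx in \<open>simp_all add: power2_eq_square\<close>)
    thus ?thesis unfolding l_def[symmetric] by (simp add: algebra_simps)
  qed
  have "(\<integral>u. theta_kernel u * cos (t * u) \<partial>lborel) \<le> (\<integral>u. 1.0002 * (4 * exp (- pi)) * (?B 0 u + 8.8 * ?B 1 u + 32.44 * ?B 2 u + 54.15 * ?B 3 u) \<partial>lborel)"
  proof (rule integral_mono)
    show "integrable lborel (\<lambda>u. 1.0002 * (4 * exp (- pi)) * (?B 0 u + 8.8 * ?B 1 u + 32.44 * ?B 2 u + 54.15 * ?B 3 u))"
      using hb by (simp only: has_bochner_integral_iff)
    fix u
    have "theta_kernel u * cos (t * u) \<le> theta_kernel u * 1" by (intro mult_left_mono theta_kernel_nonneg) auto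
    also have "\<dots> \<le> 1.0002 * theta_kernel1 u" using theta_kernel1_bounds(3) by simp
    also have "\<dots> \<le> 1.0002 * (4 * exp (- pi) * (?B 0 u + 8.8 * ?B 1 u + 32.44 * ?B 2 u + 54.15 * ?B 3 u))"
      by (intro mult_left_mono k1) auto
    finally show "theta_kernel u * cos (t * u) \<le> 1.0002 * (4 * exp (- pi)) * (?B 0 u + 8.8 * ?B 1 u + 32.44 * ?B 2 u + 54.15 * ?B 3 u)"
      by (simp only: mult.assoc)
  qed (rule theta_kernel_cos_integrable)
  also have "\<dots> = 1.0002 * (4 * exp (- pi)) * (fact 0 / l ^ Suc 0 + 8.8 * (fact 1 / l ^ Suc 1) + 32.44 * (fact 2 / l ^ Suc 2) + 54.15 * (fact 3 / l ^ Suc 3))"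
    using hb by (simp only: has_bochner_integral_iff)
  also have "\<dots> \<le> 1.0002 * (4 * exp (- pi)) * 0.13807"
    by (intro mult_left_mono) (simp_all add: l_def eval_nat_numeral)
  also have "\<dots> \<le> 1.0002 * (4 * (1 / 23.1)) * 0.13807"
    using exp_pi_ge by (intro mult_left_mono mult_right_mono) (simp_all add: exp_minus field_simps)
  also have "\<dots> < 1 / (1/4 + 6.4\<^sup>2)" by (simp add: power2_eq_square)
  also have "\<dots> \<le> 1 / (1/4 + t\<^sup>2)"
  proof -
    have "t\<^sup>2 \<le> 6.4\<^sup>2" using t by (intro abs_le_square_iff[THEN iffD1]) simp
    thus ?thesis by (intro divide_left_mono mult_pos_pos) (auto simp: add_pos_nonneg)
  qed
  finally show ?thesis by (simp add: xi_line_def)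
qed

text \<open>The derivative of \<open>xi_line\<close>, taken under the integral sign;
  \<open>zeta_cont_line_deriv\<close> obtains it from the derivative of
  \<open>theta_mellin\<close>.\<close>

definition xi_line_d1 :: "real \<Rightarrow> real" where
  "xi_line_d1 t = 2 * t / (1/4 + t\<^sup>2)\<^sup>2 - (\<integral>u. theta_kernel u * u * sin (t * u) \<partial>lborel)"

section \<open>The logarithmic derivative of Xi between 6.1 and 6.4\<close>

lemma inverse_power_parts:
  fixes l t :: real
  assumes "l > 0"
  defines "p \<equiv> l / (l\<^sup>2 + t\<^sup>2)" and "q \<equiv> t / (l\<^sup>2 + t\<^sup>2)"
  shows "Re (fact k / Complex l (- t) ^ Suc k) = fact k * Re (Complex p q ^ Suc k)"
    "Im (fact k / Complex l (- t) ^ Suc k) = fact k * Im (Complex p q ^ Suc k)"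
proof -
  have "1 / Complex l (- t) = Complex p q" by (simp add: p_def q_def complex_eq_iff Re_divide Im_divide)
  hence "fact k / Complex l (- t) ^ Suc k = of_real (fact k) * Complex p q ^ Suc k"
    by (metis (no_types, lifting) divide_inverse inverse_eq_divide of_real_fact power_inverse)
  thus "Re (fact k / Complex l (- t) ^ Suc k) = fact k * Re (Complex p q ^ Suc k)"
    "Im (fact k / Complex l (- t) ^ Suc k) = fact k * Im (Complex p q ^ Suc k)"
    by (simp_all only: times_complex.sel Re_complex_of_real Im_complex_of_real mult_zero_left diff_zero add_0_right)
qed

text \<open>Here $p + iq = 1/(12.183 - it)$, and the left-hand side comes from integrating a quadratic majorant of
  the kernel against cosine and sine; it is bounded by interval arithmetic on four subintervals.\<close>

lemma log_deriv_rational_bound: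
  fixes t p q :: real
  assumes t: "(61/10) \<le> t" "t \<le> (32/5)"
  defines "p \<equiv> (12183/1000) / ((12183/1000)\<^sup>2 + t\<^sup>2)" and "q \<equiv> t / ((12183/1000)\<^sup>2 + t\<^sup>2)"
  shows "(163/200) * (p + (32/5) * (p\<^sup>2 - q\<^sup>2) + (142/5) * (p ^ 3 - 3 * p * q\<^sup>2))
       - (2 * p * q + (64/5) * (3 * p\<^sup>2 * q - q ^ 3) + (426/5) * (4 * p ^ 3 * q - 4 * p * q ^ 3)) + (459/50000)
       < (231/40) * ((163/200) / (1/4 + t\<^sup>2) - 2 * t / (1/4 + t\<^sup>2)\<^sup>2)"
proof -
  \<comment> \<open>Besides the enclosures of p and q: 142/5 and 426/5 are 2! and 3! times 71/5,
    459/50000 collects the error terms of the majorisation, and 231/40 = 23.1/4 stands for exp pi /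
    4. The numerical conditions avoid division in the enclosures of p and q.\<close>
  have main: ?thesis
    if t12: "t1 \<le> t" "t \<le> t2" "0 < t1" "t2 \<le> 12"
      and num: "p1 * ((12183/1000)\<^sup>2 + t2\<^sup>2) \<le> (12183/1000)" "(12183/1000) \<le> p2 * ((12183/1000)\<^sup>2 + t1\<^sup>2)"
        "q1 * ((12183/1000)\<^sup>2 + t1\<^sup>2) \<le> t1" "t2 \<le> q2 * ((12183/1000)\<^sup>2 + t2\<^sup>2)" "0 \<le> p1" "0 \<le> q1"
      and fin: "(163/200) * (p2 + (32/5) * (p2\<^sup>2 - q1\<^sup>2) + (142/5) * (p2 ^ 3 - 3 * p1 * q1\<^sup>2))
       - (2 * p1 * q1 + (64/5) * (3 * p1\<^sup>2 * q1 - q2 ^ 3) + (426/5) * (4 * p1 ^ 3 * q1 - 4 * p2 * q2 ^ 3)) + (459/50000)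
       < (231/40) * ((163/200) / (1/4 + t2\<^sup>2) - 2 * t2 / (1/4 + t1\<^sup>2)\<^sup>2)"
    for t1 t2 p1 p2 q1 q2 :: real
  proof -
    have sq: "t1\<^sup>2 \<le> t\<^sup>2" "t\<^sup>2 \<le> t2\<^sup>2" using t12 by (auto intro!: power_mono)
    define N where "N = (12183/1000)\<^sup>2 + t\<^sup>2"
    have N: "N > 0" by (simp add: N_def add_pos_nonneg)
    have p: "p1 \<le> p" "p \<le> p2"
    proof -
      have "p1 * N \<le> p1 * ((12183/1000)\<^sup>2 + t2\<^sup>2)" using sq num by (intro mult_left_mono) (auto simp: N_def)
      thus "p1 \<le> p" using num N unfolding p_def N_def[symmetric] by (simp add: le_divide_eq)
      have "p2 > 0"
      proof (rule ccontr)
        assume "\<not> p2 > 0"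
        hence "p2 * ((12183/1000)\<^sup>2 + t1\<^sup>2) \<le> 0" by (intro mult_nonpos_nonneg) auto
        from order_trans[OF num(2) this] show False by simp
      qed
      hence "p2 * ((12183/1000)\<^sup>2 + t1\<^sup>2) \<le> p2 * N" using sq by (intro mult_left_mono) (auto simp: N_def)
      thus "p \<le> p2" using num N unfolding p_def N_def[symmetric] by (simp add: divide_le_eq)
    qed
    \<comment> \<open>t / (l^2 + t^2) increases up to t = l, and 12 < 12.183; so q is enclosed by
      its end values.\<close>
    have inc: "s / ((12183/1000)\<^sup>2 + s\<^sup>2) \<le> r / ((12183/1000)\<^sup>2 + r\<^sup>2)" if "0 < s" "s \<le> r" "r \<le> 12" for s r :: real
    proof -
      have "s * r \<le> 12 * 12" using that by (intro mult_mono) auto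
      hence "0 \<le> (r - s) * ((12183/1000)\<^sup>2 - s * r)" using that by (intro mult_nonneg_nonneg) (auto simp: power2_eq_square)
      hence "s * ((12183/1000)\<^sup>2 + r\<^sup>2) \<le> r * ((12183/1000)\<^sup>2 + s\<^sup>2)" by (simp add: power2_eq_square field_simps)
      moreover have "(12183/1000)\<^sup>2 + s\<^sup>2 > 0" "(12183/1000)\<^sup>2 + r\<^sup>2 > 0" by (simp_all add: add_pos_nonneg)
      ultimately show ?thesis by (simp add: frac_le_eq divide_le_eq le_divide_eq mult.commute)
    qed
    have q: "q1 \<le> q" "q \<le> q2"
    proof -
      have P: "(12183/1000)\<^sup>2 + s\<^sup>2 > 0" for s :: real by (simp add: add_pos_nonneg)
      have "q1 \<le> t1 / ((12183/1000)\<^sup>2 + t1\<^sup>2)" using num(3) P[of t1] by (simp add: le_divide_eq)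
      also have "\<dots> \<le> q" unfolding q_def using t12 by (intro inc) auto
      finally show "q1 \<le> q" .
      have "q \<le> t2 / ((12183/1000)\<^sup>2 + t2\<^sup>2)" unfolding q_def using t12 by (intro inc) auto
      also have "\<dots> \<le> q2" using num(4) P[of t2] by (simp add: divide_le_eq)
      finally show "q \<le> q2" .
    qed
    have p0: "0 \<le> p" "0 \<le> q" "0 \<le> p1" "0 \<le> q1" using p q num by auto
    note bnds = p q p0
    have 1: "p\<^sup>2 \<le> p2\<^sup>2" "q1\<^sup>2 \<le> q\<^sup>2" "p ^ 3 \<le> p2 ^ 3" "q ^ 3 \<le> q2 ^ 3" using bnds by (auto intro!: power_mono)
    have 2: "p1 * q1\<^sup>2 \<le> p * q\<^sup>2" "p1 * q1 \<le> p * q" "p1\<^sup>2 * q1 \<le> p\<^sup>2 * q" "p1 ^ 3 * q1 \<le> p ^ 3 * q"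
      "p * q ^ 3 \<le> p2 * q2 ^ 3"
      using bnds by (auto intro!: mult_mono power_mono)
    have D: "0 < 1/4 + t1\<^sup>2" "1/4 + t1\<^sup>2 \<le> 1/4 + t\<^sup>2" "1/4 + t\<^sup>2 \<le> 1/4 + t2\<^sup>2" using sq by (auto simp: add_pos_nonneg)
    have 3: "(163/200) / (1/4 + t2\<^sup>2) \<le> (163/200) / (1/4 + t\<^sup>2)" using D by (intro divide_left_mono mult_pos_pos) auto
    have 4: "2 * t / (1/4 + t\<^sup>2)\<^sup>2 \<le> 2 * t2 / (1/4 + t1\<^sup>2)\<^sup>2"
      using D t12 by (intro frac_le power_mono zero_less_power) auto
    have lin: "(163/200) * a - b + (459/50000) < (231/40) * r"
      if "a \<le> a'" "b' \<le> b" "r' \<le> r" "(163/200) * a' - b' + (459/50000) < (231/40) * r'" for a a' b b' r r' :: real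
      using that by linarith
    show ?thesis unfolding mult.assoc
    proof (rule lin[OF _ _ _ fin[unfolded mult.assoc]])
      show "p + (32/5) * (p\<^sup>2 - q\<^sup>2) + (142/5) * (p ^ 3 - 3 * (p * q\<^sup>2))
        \<le> p2 + (32/5) * (p2\<^sup>2 - q1\<^sup>2) + (142/5) * (p2 ^ 3 - 3 * (p1 * q1\<^sup>2))"
        using 1 2 p by (intro add_mono mult_left_mono diff_mono) auto
      show "2 * (p1 * q1) + (64/5) * (3 * (p1\<^sup>2 * q1) - q2 ^ 3) + (426/5) * (4 * (p1 ^ 3 * q1) - 4 * (p2 * q2 ^ 3))
        \<le> 2 * (p * q) + (64/5) * (3 * (p\<^sup>2 * q) - q ^ 3) + (426/5) * (4 * (p ^ 3 * q) - 4 * (p * q ^ 3))"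
        using 1 2 by (intro add_mono mult_left_mono diff_mono) auto
      show "(163/200) / (1/4 + t2\<^sup>2) - 2 * t2 / (1/4 + t1\<^sup>2)\<^sup>2 \<le> (163/200) / (1/4 + t\<^sup>2) - 2 * t / (1/4 + t\<^sup>2)\<^sup>2"
        by (rule diff_mono[OF 3 4])
    qed
  qed
  have I0: ?thesis if "6.1 \<le> t" "t \<le> 6.175"
    by (rule main[of "6.1" "6.175" "0.065304" "0.065629" "0.032860" "0.033100", OF that]) (simp_all add: eval_nat_numeral)
  have I1: ?thesis if "6.175 \<le> t" "t \<le> 6.25"
    by (rule main[of "6.175" "6.25" "0.064980" "0.065305" "0.033099" "0.033336", OF that]) (simp_all add: eval_nat_numeral)
  have I2: ?thesis if "6.25 \<le> t" "t \<le> 6.325"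
    by (rule main[of "6.25" "6.325" "0.064654" "0.064981" "0.033335" "0.033567", OF that]) (simp_all add: eval_nat_numeral)
  have I3: ?thesis if "6.325 \<le> t" "t \<le> 6.4"
    by (rule main[of "6.325" "6.4" "0.064329" "0.064655" "0.033566" "0.033794", OF that]) (simp_all add: eval_nat_numeral)
  show ?thesis using I0 I1 I2 I3 t by linarith
qed

text \<open>As Xi is negative here, this says Xi'/Xi > -0.815. The integrand is the kernel times c
  cos(t u) - u sin(t u). The kernel is replaced by a majorant that integrates in closed form, and
  the replacement error is controlled by the lower bound for the integral of
  \<open>theta_kernel1\<close>.\<close>

lemma xi_line_log_deriv_bound:
  assumes t: "(61/10) \<le> t" "t \<le> (32/5)"
  shows "(163/200) * (- xi_line t) - xi_line_d1 t > 0"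
proof -
  define c :: real where "c = (163/200)"
  define l :: real where "l = (5783/1000) + (32/5)"
  define T where "T = 4 * exp (- pi)"
  \<comment> \<open>With e = 0 in \<open>theta_kernel1_le_poly\<close>, the first coefficient
    condition forces 2 d >= b^2 - 4 pi; the pair 6.4, 14.2 meets it almost with equality.\<close>
  define b :: real where "b = (32/5)"
  define d :: real where "d = (71/5)"
  have T: "T > 0" by (simp add: T_def)
  define B where "B = (\<lambda>k u. indicator {0..} u * (u ^ k * exp (- l * u)) :: real)"
  define BC where "BC = (\<lambda>k u. indicator {0..} u * (u ^ k * exp (- l * u) * cos (t * u)) :: real)"
  define BS where "BS = (\<lambda>k u. indicator {0..} u * (u ^ k * exp (- l * u) * sin (t * u)) :: real)"
  have l: "l > 0" by (simp add: l_def)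
  define z where "z = Complex (l / (l\<^sup>2 + t\<^sup>2)) (t / (l\<^sup>2 + t\<^sup>2))"
  have B: "has_bochner_integral lborel (B k) (fact k / l ^ Suc k)" for k
    unfolding B_def by (rule power_exp_real_integral[OF l])
  have BC: "has_bochner_integral lborel (BC k) (fact k * Re (z ^ Suc k))" for k
    using power_exp_cos_integral(1)[OF l, of k t] unfolding BC_def z_def inverse_power_parts(1)[OF l] .
  have BS: "has_bochner_integral lborel (BS k) (fact k * Im (z ^ Suc k))" for k
    using power_exp_cos_integral(2)[OF l, of k t] unfolding BS_def z_def inverse_power_parts(2)[OF l] .
  \<comment> \<open>T times \<open>Ek\<close> is the majorant times the trigonometric factor. T
    times \<open>Er\<close> bounds the replacement error, before c times
    \<open>theta_kernel1\<close> is subtracted.\<close>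
  define Ek where "Ek = (\<lambda>u. c * (BC 0 u + b * BC 1 u + d * BC 2 u) - (BS 1 u + b * BS 2 u + d * BS 3 u))"
  define Er where "Er = (\<lambda>u. (5001/5000) * c * (B 0 u + b * B 1 u + d * B 2 u) + 1 / (2 * c) * (B 2 u + b * B 3 u + d * B 4 u)
     + (1/5000) * (B 1 u + b * B 2 u + d * B 3 u))"
  define Ekv where "Ekv = c * (fact 0 * Re (z ^ Suc 0) + b * (fact 1 * Re (z ^ Suc 1)) + d * (fact 2 * Re (z ^ Suc 2)))
     - (fact 1 * Im (z ^ Suc 1) + b * (fact 2 * Im (z ^ Suc 2)) + d * (fact 3 * Im (z ^ Suc 3)))"
  define Erv where "Erv = (5001/5000) * c * (fact 0 / l ^ Suc 0 + b * (fact 1 / l ^ Suc 1) + d * (fact 2 / l ^ Suc 2))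
     + 1 / (2 * c) * (fact 2 / l ^ Suc 2 + b * (fact 3 / l ^ Suc 3) + d * (fact 4 / l ^ Suc 4))
     + (1/5000) * (fact 1 / l ^ Suc 1 + b * (fact 2 / l ^ Suc 2) + d * (fact 3 / l ^ Suc 3))"
  have Ek: "has_bochner_integral lborel Ek Ekv" unfolding Ek_def Ekv_def
    by (intro has_bochner_integral_mult_right has_bochner_integral_add has_bochner_integral_diff BC BS)
  have Er: "has_bochner_integral lborel Er Erv" unfolding Er_def Erv_def
    by (intro has_bochner_integral_mult_right has_bochner_integral_add B)
  have K1: "has_bochner_integral lborel theta_kernel1 (\<integral>u. theta_kernel1 u \<partial>lborel)"
    using theta_kernel1_integrable by (simp add: has_bochner_integral_iff)
  have hb: "has_bochner_integral lborel (\<lambda>u. T * Ek u + T * Er u - c * theta_kernel1 u) (T * Ekv + T * Erv - c * (\<integral>u. theta_kernel1 u \<partial>lborel))"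
    by (intro has_bochner_integral_mult_right has_bochner_integral_add has_bochner_integral_diff Ek Er K1)
  have pt: "c * (theta_kernel u * cos (t * u)) - theta_kernel u * u * sin (t * u) \<le> T * Ek u + T * Er u - c * theta_kernel1 u" for u
  proof (cases "u \<ge> 0")
    case True
    define k where "k = c * cos (t * u) - u * sin (t * u)"
    define E where "E = T * (exp (- l * u) * (1 + b * u + d * u\<^sup>2))"
    define K1 where "K1 = theta_kernel1 u"
    define K where "K = theta_kernel u"
    have K1: "0 \<le> K1" "K1 \<le> K" "K \<le> (5001/5000) * K1" using theta_kernel1_bounds by (simp_all add: K1_def K_def)
    have KE: "K1 \<le> E"
    proof -
      have kk: "K1 \<le> 4 * exp (- pi) * (indicator {0..} u * (exp (- (5.783 + 6.4) * u) * (1 + 6.4 * u + 14.2 * u\<^sup>2 + 0 * u ^ 3)))"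
        unfolding K1_def by (rule theta_kernel1_le_poly) (use pi_approx in \<open>simp_all add: power2_eq_square\<close>)
      have L: "(5.783 + 6.4 :: real) = l" by (simp add: l_def)
      show ?thesis using kk[unfolded L] True unfolding E_def T_def b_def d_def by (simp add: mult.assoc)
    qed
    have ka: "\<bar>k\<bar> \<le> c + u"
    proof -
      have "\<bar>k\<bar> \<le> \<bar>c * cos (t * u)\<bar> + \<bar>u * sin (t * u)\<bar>" unfolding k_def by (rule abs_triangle_ineq4)
      also have "\<dots> \<le> c * 1 + u * 1" unfolding abs_mult using True by (intro add_mono mult_mono) (auto simp: c_def)
      finally show ?thesis by simp
    qed
    \<comment> \<open>k is one component of the vector (c, u) after a rotation, so its square is at
      most c^2 + u^2, which is below the square of c + u^2 / (2 c).\<close>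
    have kb: "- k \<le> c + u\<^sup>2 / (2 * c)"
    proof (rule power2_le_imp_le)
      have "(- k)\<^sup>2 + (c * sin (t * u) + u * cos (t * u))\<^sup>2 = (c\<^sup>2 + u\<^sup>2) * ((sin (t * u))\<^sup>2 + (cos (t * u))\<^sup>2)"
      proof -
        have "(- (c * C - u * S))\<^sup>2 + (c * S + u * C)\<^sup>2 = (c\<^sup>2 + u\<^sup>2) * (S\<^sup>2 + C\<^sup>2)" for S C :: real
          by (simp add: power2_eq_square algebra_simps)
        thus ?thesis unfolding k_def .
      qed
      hence "(- k)\<^sup>2 \<le> c\<^sup>2 + u\<^sup>2" by (simp only: sin_cos_squared_add mult_1_right) (smt (verit) zero_le_power2)
      also have "\<dots> \<le> c\<^sup>2 + u\<^sup>2 + (u\<^sup>2 / (2 * c))\<^sup>2" by simp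
      also have "\<dots> = (c + u\<^sup>2 / (2 * c))\<^sup>2" by (simp add: power2_sum c_def)
      finally show "(- k)\<^sup>2 \<le> (c + u\<^sup>2 / (2 * c))\<^sup>2" .
    qed (simp add: c_def)
    have "(K - K1) * k \<le> ((1/5000) * E) * (c + u)"
    proof -
      have "(K - K1) * k \<le> (K - K1) * (c + u)" using ka K1 by (intro mult_left_mono) auto
      also have "\<dots> \<le> ((1/5000) * E) * (c + u)" using K1 KE True by (intro mult_right_mono) (auto simp: c_def)
      finally show ?thesis .
    qed
    moreover have "(E - K1) * (- k) \<le> (E - K1) * (c + u\<^sup>2 / (2 * c))" using kb KE by (intro mult_left_mono) auto
    moreover have "0 \<le> K1 * (u\<^sup>2 / (2 * c))" using K1 by (simp add: c_def)
    \<comment> \<open>The first summand is the higher theta terms, the second the computable main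
      part. In the third, E - K1 is nonnegative, so a one-sided bound for - k suffices.\<close>
    moreover have "K * k = (K - K1) * k + E * k + (E - K1) * (- k)" by (simp add: algebra_simps)
    moreover have "(E - K1) * (c + V) = c * E - c * K1 + E * V - K1 * V" for V by (simp add: algebra_simps)
    ultimately have "K * k \<le> E * k + (c * E - c * K1) + E * (u\<^sup>2 / (2 * c)) + (1/5000) * E * (c + u)"
      by (smt (verit))
    moreover have "c * (theta_kernel u * cos (t * u)) - theta_kernel u * u * sin (t * u) = K * k"
      by (simp add: K_def k_def algebra_simps)
    moreover have "T * Ek u = E * k"
      using True unfolding Ek_def E_def k_def BC_def BS_def by (simp add: eval_nat_numeral algebra_simps)
    moreover have "T * Er u = c * E + E * (u\<^sup>2 / (2 * c)) + (1/5000) * E * (c + u)"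
      using True unfolding Er_def E_def B_def by (simp add: eval_nat_numeral c_def field_simps)
    ultimately show ?thesis unfolding K1_def[symmetric] by linarith
  next
    case False
    thus ?thesis by (simp add: theta_kernel_def theta_kernel1_def Ek_def Er_def B_def BC_def BS_def)
  qed
  have A: "c * (\<integral>u. theta_kernel u * cos (t * u) \<partial>lborel) - (\<integral>u. theta_kernel u * u * sin (t * u) \<partial>lborel)
      \<le> T * Ekv + T * Erv - c * (\<integral>u. theta_kernel1 u \<partial>lborel)"
  proof -
    have "(\<integral>u. c * (theta_kernel u * cos (t * u)) - theta_kernel u * u * sin (t * u) \<partial>lborel) \<le> (\<integral>u. T * Ek u + T * Er u - c * theta_kernel1 u \<partial>lborel)"
    proof (rule integral_mono)
      show "integrable lborel (\<lambda>u. c * (theta_kernel u * cos (t * u)) - theta_kernel u * u * sin (t * u))"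
        by (intro Bochner_Integration.integrable_diff integrable_mult_right theta_kernel_cos_integrable theta_kernel_u_sin_integrable)
      show "integrable lborel (\<lambda>u. T * Ek u + T * Er u - c * theta_kernel1 u)"
        using hb by (simp only: has_bochner_integral_iff)
    qed (rule pt)
    moreover have "(\<integral>u. c * (theta_kernel u * cos (t * u)) - theta_kernel u * u * sin (t * u) \<partial>lborel) =
        (\<integral>u. c * (theta_kernel u * cos (t * u)) \<partial>lborel) - (\<integral>u. theta_kernel u * u * sin (t * u) \<partial>lborel)"
      by (intro Bochner_Integration.integral_diff integrable_mult_right theta_kernel_cos_integrable theta_kernel_u_sin_integrable)
    ultimately show ?thesis using hb by (simp add: has_bochner_integral_iff)
  qed
  have "c * (T * (83/625)) \<le> c * (\<integral>u. theta_kernel1 u \<partial>lborel)"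
    using theta_kernel1_integral_ge by (intro mult_left_mono) (simp_all add: T_def c_def)
  with A have A': "c * (\<integral>u. theta_kernel u * cos (t * u) \<partial>lborel) - (\<integral>u. theta_kernel u * u * sin (t * u) \<partial>lborel)
      \<le> T * (Ekv + (Erv - c * (83/625)))" by (simp add: algebra_simps)
  \<comment> \<open>83/625 = 0.1328 comes from \<open>theta_kernel1_integral_ge\<close>; the
    subtraction brings the first-order replacement error down to the gap between majorant and
    kernel.\<close>
  have C: "Erv - c * (83/625) \<le> (459/50000)"
    unfolding Erv_def l_def c_def b_def d_def by (simp add: eval_nat_numeral)
  have le: "l = (12183/1000)" by (simp add: l_def)
  define p where "p = (12183/1000) / ((12183/1000)\<^sup>2 + t\<^sup>2)"
  define q where "q = t / ((12183/1000)\<^sup>2 + t\<^sup>2)"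
  have zpq: "z = Complex p q" unfolding z_def p_def q_def le ..
  have "Ekv = (163/200) * (p + (32/5) * (p\<^sup>2 - q\<^sup>2) + (142/5) * (p ^ 3 - 3 * p * q\<^sup>2))
       - (2 * p * q + (64/5) * (3 * p\<^sup>2 * q - q ^ 3) + (426/5) * (4 * p ^ 3 * q - 4 * p * q ^ 3))"
    unfolding Ekv_def zpq c_def b_def d_def by (simp add: eval_nat_numeral field_simps)
  hence "Ekv + (Erv - c * (83/625)) < (231/40) * ((163/200) / (1/4 + t\<^sup>2) - 2 * t / (1/4 + t\<^sup>2)\<^sup>2)"
    using log_deriv_rational_bound[OF t] C unfolding p_def[symmetric] q_def[symmetric] by linarith
  hence "T * (Ekv + (Erv - c * (83/625))) < T * ((231/40) * ((163/200) / (1/4 + t\<^sup>2) - 2 * t / (1/4 + t\<^sup>2)\<^sup>2))"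
    using T by (rule mult_strict_left_mono)
  also have "\<dots> = (T * (231/40)) * ((163/200) / (1/4 + t\<^sup>2) - 2 * t / (1/4 + t\<^sup>2)\<^sup>2)" by (simp only: mult.assoc)
  also have "\<dots> \<le> 1 * ((163/200) / (1/4 + t\<^sup>2) - 2 * t / (1/4 + t\<^sup>2)\<^sup>2)"
  proof (rule mult_right_mono)
    show "T * (231/40) \<le> 1" using exp_pi_ge by (simp add: T_def exp_minus field_simps)
    have "(61/10) * (61/10) \<le> t * t" using t by (intro mult_mono) auto
    hence "2 * t \<le> (163/200) * (1/4 + t\<^sup>2)" using t by (simp add: power2_eq_square)
    moreover have D: "1/4 + t\<^sup>2 > 0" by (simp add: add_pos_nonneg)
    ultimately have "2 * t / (1/4 + t\<^sup>2)\<^sup>2 \<le> (163/200) * (1/4 + t\<^sup>2) / (1/4 + t\<^sup>2)\<^sup>2" by (intro divide_right_mono) auto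
    also have "\<dots> = (163/200) / (1/4 + t\<^sup>2)"
    proof -
      have "a * E / E\<^sup>2 = a / E" if "E > 0" for a E :: real using that by (simp add: power2_eq_square)
      thus ?thesis using D by blast
    qed
    finally show "0 \<le> (163/200) / (1/4 + t\<^sup>2) - 2 * t / (1/4 + t\<^sup>2)\<^sup>2" by simp
  qed
  finally show ?thesis using A' unfolding xi_line_def xi_line_d1_def c_def by (simp add: algebra_simps)
qed

section \<open>The phase of kappa\<close>

text \<open>At a zero of order n, f = (w - a)^n g and f' = (w - a)^(n-1) D with D(a) = n g(a), so
  f/f' = (w - a) g/D with derivative 1/n at a. Away from zeros of f the hypothesis on critical
  points excludes poles.\<close>

lemma holomorphic_log_deriv_reciprocal:
  assumes f: "f holomorphic_on A" "open A" "connected A" "a \<in> A" "\<exists>w\<in>A. f w \<noteq> 0"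
    and crit: "deriv f a = 0 \<Longrightarrow> f a = 0"
  obtains R r where "r > 0" "R holomorphic_on ball a r" "\<And>w. w \<in> ball a r \<Longrightarrow> R w = f w / deriv f w"
    "f a = 0 \<Longrightarrow> \<exists>n::nat. n > 0 \<and> (R has_field_derivative 1 / of_nat n) (at a)"
proof (cases "f a = 0")
  case False
  have hd: "deriv f holomorphic_on A" by (rule holomorphic_deriv[OF f(1,2)])
  have "open (A \<inter> deriv f -` (- {0}))"
    by (rule continuous_open_preimage[OF holomorphic_on_imp_continuous_on[OF hd] f(2)]) auto
  moreover have "a \<in> A \<inter> deriv f -` (- {0})" using False crit f(4) by auto
  ultimately obtain r where r: "r > 0" "ball a r \<subseteq> A \<inter> deriv f -` (- {0})"
    by (meson open_contains_ball)
  have "f holomorphic_on ball a r" "deriv f holomorphic_on ball a r"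
    using f(1) hd r(2) by (blast intro: holomorphic_on_subset)+
  hence "(\<lambda>w. f w / deriv f w) holomorphic_on ball a r"
    by (rule holomorphic_on_divide) (use r in auto)
  thus thesis using that[of r "\<lambda>w. f w / deriv f w"] r(1) False by auto
next
  case True
  define n where "n = nat (zorder f a)"
  define g where "g = zor_poly f a"
  obtain r where r: "zorder f a > 0" "r > 0" "g holomorphic_on cball a r"
    "\<And>w. w \<in> cball a r \<Longrightarrow> f w = g w * (w - a) ^ n \<and> g w \<noteq> 0"
    using zorder_exist_zero[OF f] True unfolding n_def g_def by auto
  have n: "n > 0" using r(1) by (simp add: n_def)
  then obtain m where m: "n = Suc m" by (cases n) auto
  have g: "g holomorphic_on ball a r" by (rule holomorphic_on_subset[OF r(3)]) auto
  have hd: "deriv g holomorphic_on ball a r" by (rule holomorphic_deriv[OF g]) auto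
  define D where "D = (\<lambda>w. of_nat n * g w + (w - a) * deriv g w)"
  have D: "D holomorphic_on ball a r" unfolding D_def by (intro holomorphic_intros g hd)
  have Da: "D a \<noteq> 0" using r(2) r(4)[of a] n by (simp add: D_def)
  have "open (ball a r \<inter> D -` (- {0}))"
    by (rule continuous_open_preimage[OF holomorphic_on_imp_continuous_on[OF D]]) auto
  moreover have "a \<in> ball a r \<inter> D -` (- {0})" using Da r(2) by auto
  ultimately obtain e where e: "e > 0" "ball a e \<subseteq> ball a r \<inter> D -` (- {0})"
    by (meson open_contains_ball)
  define H where "H = (\<lambda>w. g w / D w)"
  have H: "H holomorphic_on ball a e" unfolding H_def
    by (rule holomorphic_on_divide[OF holomorphic_on_subset[OF g] holomorphic_on_subset[OF D]]) (use e in auto)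
  have df: "deriv f w = (w - a) ^ m * D w" if w: "w \<in> ball a r" for w
  proof (rule DERIV_imp_deriv)
    have "(g has_field_derivative deriv g w) (at w)" by (rule holomorphic_derivI[OF g _ w]) auto
    moreover have "((\<lambda>w. (w - a) ^ n) has_field_derivative of_nat n * (1 * (w - a) ^ (n - Suc 0))) (at w)"
      by (rule DERIV_power) (auto intro!: derivative_eq_intros)
    ultimately have "((\<lambda>w. g w * (w - a) ^ n) has_field_derivative
        deriv g w * (w - a) ^ n + of_nat n * (1 * (w - a) ^ (n - Suc 0)) * g w) (at w)" by (rule DERIV_mult)
    hence "((\<lambda>w. g w * (w - a) ^ n) has_field_derivative (w - a) ^ m * D w) (at w)"
      by (rule DERIV_cong) (simp add: m D_def algebra_simps)
    moreover have ev: "eventually (\<lambda>w. g w * (w - a) ^ n = f w) (nhds w)"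
      by (rule eventually_nhds_in_open[of "ball a r", THEN eventually_mono]) (use w r(4) in auto)
    ultimately show "(f has_field_derivative (w - a) ^ m * D w) (at w)"
      using DERIV_cong_ev[OF refl ev refl] by blast
  qed
  show thesis
  proof (rule that[of e "\<lambda>w. (w - a) * H w"])
    show "(\<lambda>w. (w - a) * H w) holomorphic_on ball a e" by (intro holomorphic_intros H)
    fix w assume w: "w \<in> ball a e"
    hence w': "w \<in> ball a r" "w \<in> cball a r" "D w \<noteq> 0" using e by auto
    \<comment> \<open>At w = a the extension has value 0, as does the quotient: f vanishes there,
      and division by zero yields 0 if f' does too.\<close>
    show "(w - a) * H w = f w / deriv f w"
      unfolding df[OF w'(1)] using r(4)[OF w'(2)] w'(3) True by (cases "w = a") (auto simp: H_def m)
  next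
    have "(H has_field_derivative deriv H a) (at a)"
      by (rule holomorphic_derivI[OF H]) (use e in auto)
    hence "((\<lambda>w. (w - a) * H w) has_field_derivative H a) (at a)"
      by (auto intro!: derivative_eq_intros)
    moreover have "H a = 1 / of_nat n" using r(2) r(4)[of a] n by (simp add: H_def D_def)
    ultimately show "\<exists>n::nat. n > 0 \<and> ((\<lambda>w. (w - a) * H w) has_field_derivative 1 / of_nat n) (at a)"
      using n by auto
  qed (rule e)
qed

text \<open>A continuous logarithm gives \<kappa> globally; local holomorphic extensions of q make
  it analytic. The last clause gives the derivative of \<kappa> from any extension Q, so that the
  sign of a crossing can be read off a convenient one.\<close>

lemma analytic_phase:
  fixes q :: "real \<Rightarrow> complex"
  assumes loc: "\<And>a. \<exists>Q r. r > 0 \<and> Q holomorphic_on ball (of_real a) r \<and> (\<forall>t. \<bar>t - a\<bar> < r \<longrightarrow> Q (of_real t) = q t)"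
    and unit: "\<And>t. cmod (q t) = 1" and q0: "q x = exp (2 * of_real pi * \<i> * of_real c)"
  obtains \<kappa> where "real_analytic \<kappa>" "\<kappa> x = c" "\<And>t. exp (2 * of_real pi * \<i> * of_real (\<kappa> t)) = q t"
    "\<And>Q r a. r > 0 \<Longrightarrow> Q holomorphic_on ball (of_real a) r \<Longrightarrow> (\<And>t. \<bar>t - a\<bar> < r \<Longrightarrow> Q (of_real t) = q t) \<Longrightarrow>
       (\<kappa> has_real_derivative Re (deriv Q (of_real a) / (2 * of_real pi * \<i> * q a))) (at a)"
proof -
  have "isCont q a" for a
  proof -
    obtain Q r where Q: "r > 0" "Q holomorphic_on ball (of_real a) r" "\<forall>t. \<bar>t - a\<bar> < r \<longrightarrow> Q (of_real t) = q t"
      using loc by blast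
    have "isCont Q (of_real a)"
      using holomorphic_on_imp_continuous_on[OF Q(2)] Q(1) by (simp add: continuous_on_eq_continuous_at)
    hence "isCont (\<lambda>t. Q (of_real t)) a" by (intro isCont_o2[where g = Q and f = of_real]) auto
    moreover have "eventually (\<lambda>t. Q (of_real t) = q t) (nhds a)"
      by (rule eventually_nhds_in_open[of "ball a r", THEN eventually_mono]) (use Q in \<open>auto simp: dist_real_def\<close>)
    ultimately show ?thesis using isCont_cong[of "\<lambda>t. Q (of_real t)" q a] by simp
  qed
  hence "continuous_on UNIV q" by (simp add: continuous_at_imp_continuous_on)
  then obtain g where g: "continuous_on UNIV g" "\<And>t. q t = exp (g t)"
    using continuous_logarithm_on_contractible[of UNIV q] unit
    by (metis UNIV_I convex_UNIV convex_imp_contractible norm_zero zero_neq_one)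
  have Re: "Re (g t) = 0" for t using unit[of t] by (simp add: g(2))
  have qe: "q t = exp (\<i> * of_real (Im (g t)))" for t
    using Re[of t] complex_eq[of "g t"] by (simp add: g(2))
  obtain m :: int where m: "2 * of_real pi * \<i> * of_real c = \<i> * of_real (Im (g x)) + of_real (real_of_int (2 * m) * pi) * \<i>"
    using q0 unfolding qe[of x] exp_eq[symmetric] by (metis exp_eq)
  define \<kappa> where "\<kappa> = (\<lambda>t. Im (g t) / (2 * pi) + of_int m)"
  have ph: "2 * of_real pi * \<i> * of_real (\<kappa> t) = \<i> * of_real (2 * pi * \<kappa> t)" for t by simp
  have kx: "\<kappa> x = c" using arg_cong[OF m, of Im] by (simp add: \<kappa>_def field_simps)
  have kc: "continuous_on UNIV \<kappa>" unfolding \<kappa>_def by (intro continuous_intros g) simp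
  have ke: "exp (\<i> * of_real (2 * pi * \<kappa> t)) = q t" for t
  proof -
    have e: "\<i> * of_real (2 * pi * \<kappa> t) = \<i> * of_real (Im (g t)) + of_real (real_of_int (2 * m) * pi) * \<i>"
      by (simp add: \<kappa>_def complex_eq_iff field_simps)
    show ?thesis unfolding qe[of t] exp_eq using e by blast
  qed
  have local: "\<exists>F S. F holomorphic_on S \<and> open S \<and> of_real a \<in> S \<and> eventually (\<lambda>t. \<kappa> t = Re (F (of_real t))) (nhds a)
      \<and> (F has_field_derivative deriv Q (of_real a) / (2 * of_real pi * \<i> * q a)) (at (of_real a))"
    if Q: "r > 0" "Q holomorphic_on ball (of_real a) r" "\<And>t. \<bar>t - a\<bar> < r \<Longrightarrow> Q (of_real t) = q t" for Q r a
  proof -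
    have qa: "q a \<noteq> 0" using unit[of a] by auto
    have Qa: "Q (of_real a) = q a" using Q(3)[of a] Q(1) by simp
    \<comment> \<open>After division by q a the values near a are close to 1, where the principal
      logarithm is holomorphic and determines \<kappa> up to its value at a.\<close>
    define P where "P = (\<lambda>w. Q w / q a)"
    have P: "P holomorphic_on ball (of_real a) r" unfolding P_def
      by (rule holomorphic_on_divide[OF Q(2)]) (use qa in auto)
    have "open (ball (of_real a) r \<inter> P -` {w. Re w > 0})"
      by (rule continuous_open_preimage[OF holomorphic_on_imp_continuous_on[OF P]]) (auto simp: open_halfspace_Re_gt)
    moreover have "of_real a \<in> ball (of_real a) r \<inter> P -` {w. Re w > 0}" using Q(1) Qa qa by (simp add: P_def)
    ultimately obtain e where e: "e > 0" "ball (of_real a) e \<subseteq> ball (of_real a) r \<inter> P -` {w. Re w > 0}"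
      by (meson open_contains_ball)
    have Pe: "P w \<notin> \<real>\<^sub>\<le>\<^sub>0" if "w \<in> ball (of_real a) e" for w
    proof -
      have "Re (P w) > 0" using e that by auto
      thus ?thesis by (auto simp: complex_nonpos_Reals_iff)
    qed
    define F where "F = (\<lambda>w. of_real (\<kappa> a) + Ln (P w) / (2 * of_real pi * \<i>))"
    have F: "F holomorphic_on ball (of_real a) e" unfolding F_def
      using holomorphic_on_subset[OF P] e Pe by (intro holomorphic_intros) auto
    have ReF: "Re (F w) = \<kappa> a + Im (Ln (P w)) / (2 * pi)" for w
      by (simp add: F_def Re_divide power2_eq_square)
    have inb: "of_real t \<in> ball (complex_of_real a) e" if "t \<in> ball a e" for t
      using that by (simp add: dist_of_real)
    have kF: "\<kappa> t = Re (F (of_real t))" if t: "t \<in> ball a e" for t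
    proof -
      have "2 * pi * \<kappa> t - (2 * pi * \<kappa> a + Im (Ln (P (of_real t)))) = 2 * pi * \<kappa> a - (2 * pi * \<kappa> a + Im (Ln (P (of_real a))))"
      proof (rule continuous_phase_unique_on[of "ball a e"])
        show "continuous_on (ball a e) (\<lambda>t. 2 * pi * \<kappa> t)"
          by (intro continuous_intros continuous_on_subset[OF kc]) auto
        have "continuous_on (ball (of_real a) e) (\<lambda>w. Ln (P w))"
          by (intro holomorphic_on_imp_continuous_on holomorphic_on_Ln' ) (use holomorphic_on_subset[OF P] e Pe in auto)
        hence "continuous_on (ball a e) (\<lambda>t. Ln (P (of_real t)))"
          by (rule continuous_on_compose2) (use inb in \<open>auto intro!: continuous_intros\<close>)
        thus "continuous_on (ball a e) (\<lambda>t. 2 * pi * \<kappa> a + Im (Ln (P (of_real t))))"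
          by (rule continuous_on_add[OF continuous_on_const continuous_on_Im])
        fix t assume t: "t \<in> ball a e"
        have "\<bar>t - a\<bar> < r"
        proof -
          have "of_real t \<in> ball (complex_of_real a) r" using inb[OF t] e(2) by blast
          thus ?thesis by (simp add: dist_of_real dist_real_def abs_minus_commute)
        qed
        hence Pt: "P (of_real t) = q t / q a" using Q(3) by (simp add: P_def)
        have P0: "P (of_real t) \<noteq> 0" using Pe[OF inb[OF t]] by auto
        have nP: "norm (P (of_real t)) = 1" by (simp add: Pt norm_divide unit)
        have "Ln (P (of_real t)) = \<i> * of_real (Im (Ln (P (of_real t))))"
          using Re_Ln[OF P0] nP by (simp add: complex_eq_iff)
        hence L: "exp (\<i> * of_real (Im (Ln (P (of_real t))))) = q t / q a"
          using exp_Ln[OF P0] Pt by metis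
        have "exp (\<i> * of_real (2 * pi * \<kappa> a + Im (Ln (P (of_real t))))) =
            exp (\<i> * of_real (2 * pi * \<kappa> a)) * exp (\<i> * of_real (Im (Ln (P (of_real t)))))"
          by (simp only: of_real_add distrib_left exp_add)
        also have "\<dots> = q t" unfolding L ke using qa by simp
        finally show "exp (\<i> * of_real (2 * pi * \<kappa> t)) = exp (\<i> * of_real (2 * pi * \<kappa> a + Im (Ln (P (of_real t)))))"
          unfolding ke by simp
      qed (use t e in auto)
      moreover have "P (of_real a) = 1" using Qa qa by (simp add: P_def)
      ultimately have "2 * pi * \<kappa> t = 2 * pi * \<kappa> a + Im (Ln (P (of_real t)))" by simp
      thus ?thesis unfolding ReF by (simp add: field_simps)
    qed
    have "(Q has_field_derivative deriv Q (of_real a)) (at (of_real a))"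
      by (rule holomorphic_derivI[OF Q(2)]) (use Q(1) in auto)
    hence "(P has_field_derivative deriv Q (of_real a) / q a) (at (of_real a))"
      unfolding P_def by (rule DERIV_cdivide)
    moreover have P1: "P (of_real a) = 1" using Qa qa by (simp add: P_def)
    moreover have "(Ln has_field_derivative inverse (P (of_real a))) (at (P (of_real a)))"
      by (rule has_field_derivative_Ln) (simp add: P1)
    ultimately have "((\<lambda>w. Ln (P w)) has_field_derivative inverse (P (of_real a)) * (deriv Q (of_real a) / q a)) (at (of_real a))"
      using DERIV_chain2 by blast
    from DERIV_add[OF DERIV_const[of "of_real (\<kappa> a)"] DERIV_cdivide[OF this, of "2 * of_real pi * \<i>"]]
    have "(F has_field_derivative deriv Q (of_real a) / (2 * of_real pi * \<i> * q a)) (at (of_real a))"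
      unfolding F_def P1 by (simp add: mult_ac)
    moreover have "eventually (\<lambda>t. \<kappa> t = Re (F (of_real t))) (nhds a)"
      by (rule eventually_nhds_in_open[of "ball a e", THEN eventually_mono]) (use e kF in auto)
    ultimately show ?thesis using F e(1) by (intro exI[of _ F] exI[of _ "ball (of_real a) e"]) auto
  qed
  show thesis
  proof (rule that[of \<kappa>])
    show "real_analytic \<kappa>" unfolding real_analytic_def
    proof
      fix a
      obtain Q r where Q: "r > 0" "Q holomorphic_on ball (of_real a) r" "\<forall>t. \<bar>t - a\<bar> < r \<longrightarrow> Q (of_real t) = q t"
        using loc by blast
      obtain F S where F: "F holomorphic_on S" "open S" "of_real a \<in> S" "eventually (\<lambda>t. \<kappa> t = Re (F (of_real t))) (nhds a)"
        using local[OF Q(1,2)] Q(3) by blast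
      have "filterlim (\<lambda>h. a + h) (nhds a) (nhds 0)"
        using tendsto_add[OF tendsto_const[of a] filterlim_ident[of "nhds 0"]] by simp
      from eventually_compose_filterlim[OF F(4) this]
      show "\<exists>G. (\<lambda>h. \<kappa> (a + h)) has_fps_expansion G" by (rule has_fps_expansion_Re[OF F(1-3)])
    qed
    show "\<kappa> x = c" by (rule kx)
    show "exp (2 * of_real pi * \<i> * of_real (\<kappa> t)) = q t" for t unfolding ph by (rule ke)
    fix Q r a assume Q: "r > 0" "Q holomorphic_on ball (complex_of_real a) r" "\<And>t. \<bar>t - a\<bar> < r \<Longrightarrow> Q (of_real t) = q t"
    obtain F where F: "eventually (\<lambda>t. \<kappa> t = Re (F (of_real t))) (nhds a)"
      "(F has_field_derivative deriv Q (of_real a) / (2 * of_real pi * \<i> * q a)) (at (of_real a))"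
      using local[OF Q] by blast
    have "((\<lambda>t. F (of_real t)) has_vector_derivative deriv Q (of_real a) / (2 * of_real pi * \<i> * q a)) (at a)"
      by (rule has_vector_derivative_real_field[OF F(2)])
    hence "((\<lambda>t. Re (F (of_real t))) has_vector_derivative Re (deriv Q (of_real a) / (2 * of_real pi * \<i> * q a))) (at a)"
      by (rule bounded_linear.has_vector_derivative[OF bounded_linear_Re])
    hence "((\<lambda>t. Re (F (of_real t))) has_real_derivative Re (deriv Q (of_real a) / (2 * of_real pi * \<i> * q a))) (at a)"
      by (simp only: has_real_derivative_iff_has_vector_derivative)
    thus "(\<kappa> has_real_derivative Re (deriv Q (of_real a) / (2 * of_real pi * \<i> * q a))) (at a)"
      using DERIV_cong_ev[OF refl F(1) refl] by blast
  qed
qed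

text \<open>Just to the right of a the function exceeds c. A return would have a first point, at
  which f = c although f exceeds c immediately before, contradicting the positive derivative
  there.\<close>

lemma crossing_stays_above:
  fixes f :: "real \<Rightarrow> real"
  assumes cont: "continuous_on UNIV f"
    and der: "\<And>t. t \<ge> 0 \<Longrightarrow> f t = c \<Longrightarrow> \<exists>d>0. (f has_real_derivative d) (at t)"
    and a: "0 \<le> a" "f a \<ge> c" "a < t"
  shows "f t > c"
proof (rule ccontr)
  assume ft: "\<not> f t > c"
  obtain a' where a': "a \<le> a'" "a' < t" "f a' > c"
  proof (cases "f a = c")
    case True
    then obtain d where "d > 0" "(f has_real_derivative d) (at a)" using der a by blast
    then obtain e where e: "e > 0" "\<And>h. 0 < h \<Longrightarrow> h < e \<Longrightarrow> f a < f (a + h)"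
      using DERIV_pos_inc_right by blast
    define h where "h = min e (t - a) / 2"
    have "0 < h" "h < e" "a + h < t" using e a by (auto simp: h_def min_def field_simps)
    thus thesis using that[of "a + h"] e(2)[of h] True by auto
  next
    case False
    thus thesis using that[of a] a by auto
  qed
  define B where "B = {a'..t} \<inter> f -` {..c}"
  have "closed B" unfolding B_def
    by (rule continuous_closed_preimage[OF continuous_on_subset[OF cont]]) auto
  moreover have "bounded B" by (rule bounded_subset[of "{a'..t}"]) (auto simp: B_def)
  ultimately have "compact B" by (simp add: compact_eq_bounded_closed)
  moreover have "t \<in> B" using a' ft by (auto simp: B_def)
  ultimately obtain x where x: "x \<in> B" "\<And>y. y \<in> B \<Longrightarrow> x \<le> y"
    using compact_attains_inf[of B] by blast
  have xa: "a' < x" using x(1) a'(3) unfolding B_def by (cases "a' = x") auto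
  have fx: "f x = c"
  proof (rule ccontr)
    assume "f x \<noteq> c"
    hence "f x < c" using x(1) by (auto simp: B_def)
    then obtain y where y: "a' \<le> y" "y \<le> x" "f y = c"
      using IVT2'[of f x c a'] a' xa continuous_on_subset[OF cont] by auto
    hence "y \<in> B" using x(1) by (auto simp: B_def)
    hence "y = x" using x(2) y by force
    thus False using \<open>f x \<noteq> c\<close> y by simp
  qed
  have "x \<ge> 0" using xa a' a by linarith
  then obtain d where "d > 0" "(f has_real_derivative d) (at x)" using der fx by blast
  then obtain e where e: "e > 0" "\<And>h. 0 < h \<Longrightarrow> h < e \<Longrightarrow> f (x - h) < f x"
    using DERIV_pos_inc_left by blast
  define h where "h = min e (x - a') / 2"
  have h: "0 < h" "h < e" "a' < x - h" using e xa by (auto simp: h_def min_def field_simps)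
  hence "x - h \<in> B" using e(2)[of h] fx x(1) by (auto simp: B_def)
  thus False using x(2)[of "x - h"] h by simp
qed

text \<open>The order-theoretic core. Since integers are crossed only upwards, f is injective on the
  integer points in t >= 0. It takes the value 0 at t0 and 1, 2, ... on S without gaps, so the rank
  of a point of S is its value.\<close>

lemma integer_points_enumerate:
  fixes f :: "real \<Rightarrow> real" and S :: "real set"
  assumes cont: "continuous_on UNIV f"
    and der: "\<And>t. t \<ge> 0 \<Longrightarrow> f t \<in> \<int> \<Longrightarrow> \<exists>d>0. (f has_real_derivative d) (at t)"
    and Z: "\<And>t. t \<ge> 0 \<Longrightarrow> f t \<in> \<int> \<longleftrightarrow> t = t0 \<or> t \<in> S"
    and t0: "t0 > 0" and S: "\<And>t. t \<in> S \<Longrightarrow> t0 < t" and inf: "infinite S"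
    and f0: "f 0 = - 1/2" and refl: "\<And>t. f (- t) = - 1 - f t"
    and n: "n \<ge> 1"
  shows "f (THE t. t \<in> S \<and> card {u \<in> S. u \<le> t} = n) = real n \<and>
     (\<forall>t. f t = real n \<longrightarrow> t = (THE t. t \<in> S \<and> card {u \<in> S. u \<le> t} = n))"
proof -
  have cross: "f t > c" if "0 \<le> a" "f a \<ge> c" "a < t" "c \<in> \<int>" for a t c
    by (rule crossing_stays_above[OF cont _ that(1-3)]) (use der that(4) in auto)
  have gt: "f t > - 1" if "t \<ge> 0" for t
    using cross[of 0 "-1" t] f0 that by (cases "t = 0") auto
  \<comment> \<open>A value of at least 1 at t0 would give a zero of f strictly between 0 and t0,
    but t0 is the first integer point.\<close>
  have ft0: "f t0 = 0"
  proof -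
    have "f t0 \<in> \<int>" using Z[of t0] t0 by simp
    then obtain k :: int where k: "f t0 = of_int k" by (auto elim: Ints_cases)
    have "k \<ge> 0" using gt[of t0] t0 k by simp
    moreover have "\<not> k \<ge> 1"
    proof
      assume "k \<ge> 1"
      then obtain x where x: "0 \<le> x" "x \<le> t0" "f x = 0"
        using IVT'[of f 0 0 t0] f0 k t0 continuous_on_subset[OF cont] by force
      hence "x = t0 \<or> x \<in> S" using Z[of x] by simp
      thus False using S[of x] x k \<open>k \<ge> 1\<close> by auto
    qed
    ultimately show ?thesis using k by simp
  qed
  have pos: "f t > 0" if "t \<in> S" for t using cross[of t0 0 t] S[OF that] ft0 t0 by simp
  have S0: "t \<ge> 0" if "t \<in> S" for t using S[OF that] t0 by simp
  have nS: "t \<in> S" if "f t = real m" "m \<ge> 1" "t \<ge> 0" for t m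
    using Z[of t] that ft0 by auto
  have inj: "s = t" if "f s = f t" "s \<ge> 0" "t \<ge> 0" "f s \<in> \<int>" for s t
    using cross[of s "f s" t] cross[of t "f s" s] that by (cases s t rule: linorder_cases) auto
  have injS: "inj_on f S"
  proof (rule inj_onI)
    fix s t assume st: "s \<in> S" "t \<in> S" "f s = f t"
    moreover have "f s \<in> \<int>" using Z[of s] S0[OF st(1)] st(1) by blast
    ultimately show "s = t" using inj[of s t] S0 by blast
  qed
  have Sn: "\<exists>m\<ge>1. f t = real m" if tS: "t \<in> S" for t
  proof -
    obtain k :: int where k: "f t = of_int k" using Z[of t] S0[OF tS] tS by (auto elim: Ints_cases)
    thus ?thesis using pos[OF tS] by (intro exI[of _ "nat k"]) auto
  qed
  have reach: "\<exists>x. t0 \<le> x \<and> x \<le> t \<and> f x = real k" if "t \<in> S" "real k \<le> f t" for t k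
    using IVT'[of f t0 "real k" t] S[OF that(1)] that ft0 continuous_on_subset[OF cont] by force
  have card: "card {u \<in> S. u \<le> t} = m" if t: "t \<in> S" "f t = real m" for t m
  proof -
    have "bij_betw f {u \<in> S. u \<le> t} (real ` {1..m})"
      unfolding bij_betw_def
    proof
      show "inj_on f {u \<in> S. u \<le> t}" by (rule inj_on_subset[OF injS]) auto
      show "f ` {u \<in> S. u \<le> t} = real ` {1..m}"
      proof (intro equalityI subsetI)
        fix y assume "y \<in> f ` {u \<in> S. u \<le> t}"
        then obtain u where u: "u \<in> S" "u \<le> t" "y = f u" by blast
        obtain k where k: "k \<ge> 1" "f u = real k" using Sn u by blast
        have "k \<le> m"
        proof (rule ccontr)
          assume "\<not> k \<le> m"
          hence "u < t" using u k t by (cases "u = t") auto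
          from cross[of u "real k" t] this k S0 u have "f t > real k" by auto
          thus False using t \<open>\<not> k \<le> m\<close> by simp
        qed
        thus "y \<in> real ` {1..m}" using k u by auto
      next
        fix y assume "y \<in> real ` {1..m}"
        then obtain k where k: "y = real k" "1 \<le> k" "k \<le> m" by auto
        then obtain x where x: "t0 \<le> x" "x \<le> t" "f x = real k" using reach[of t k] t by auto
        hence "x \<in> S" using nS[of x k] k t0 by auto
        thus "y \<in> f ` {u \<in> S. u \<le> t}" using x k by force
      qed
    qed
    hence "card {u \<in> S. u \<le> t} = card (real ` {1..m})" by (rule bij_betw_same_card)
    also have "\<dots> = m" by (subst card_image) auto
    finally show ?thesis .
  qed
  obtain x where x: "x \<in> S" "f x = real n"
  proof -
    have "\<exists>t\<in>S. f t \<ge> real n"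
    proof (rule ccontr)
      assume no: "\<not> (\<exists>t\<in>S. f t \<ge> real n)"
      have "f ` S \<subseteq> real ` {..n}"
      proof
        fix y assume "y \<in> f ` S"
        then obtain t where t: "t \<in> S" "y = f t" by blast
        then obtain m where m: "f t = real m" using Sn by blast
        have "f t < real n" using no t by force
        thus "y \<in> real ` {..n}" using m t by auto
      qed
      hence "finite (f ` S)" by (rule finite_subset) simp
      thus False using injS inf finite_imageD by blast
    qed
    then obtain t where "t \<in> S" "f t \<ge> real n" by blast
    then obtain y where y: "t0 \<le> y" "f y = real n" using reach[of t n] by blast
    hence "y \<in> S" using nS[of y n] n t0 by auto
    thus thesis using that y by blast
  qed
  have eq: "(THE t. t \<in> S \<and> card {u \<in> S. u \<le> t} = n) = x"
  proof (rule the_equality)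
    show "x \<in> S \<and> card {u \<in> S. u \<le> x} = n" using x card by blast
    fix t assume t: "t \<in> S \<and> card {u \<in> S. u \<le> t} = n"
    then obtain m where "f t = real m" using Sn by blast
    hence "f t = f x" using card[of t m] t x by auto
    thus "t = x" using inj_onD[OF injS] t x(1) by blast
  qed
  have "t = x" if "f t = real n" for t
  proof -
    \<comment> \<open>For negative t the reflected value exceeds -1, which makes f t
      negative.\<close>
    have "t \<ge> 0"
    proof (rule ccontr)
      assume "\<not> t \<ge> 0"
      hence "f (- t) > - 1" by (intro gt) simp
      thus False using refl[of t] that n by simp
    qed
    thus ?thesis using inj[of t x] that x(2) S0[OF x(1)] by simp
  qed
  thus ?thesis unfolding eq using x(2) by blast
qed

section \<open>The logarithmic derivative of zeta on the critical line\<close>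

abbreviation critical_line :: "real \<Rightarrow> complex" where
  "critical_line t \<equiv> Complex (1/2) t"

text \<open>Meaningful only where \<open>xi_line\<close> does not vanish.\<close>

definition phase_d1 :: "real \<Rightarrow> real" where
  "phase_d1 t = Im (Digamma (Complex (1/4) (t/2))) / 2 + xi_line_d1 t / xi_line t"

text \<open>Zeta is the product of a Gamma factor P and the completed function L. The logarithmic
  derivative of P is (ln pi - Digamma (s/2)) / 2, whose real part on the line is - theta'; and as L
  is real on the line, its derivative in s is - i times a real number.\<close>

lemma zeta_cont_line_deriv:
  "(zeta_cont has_field_derivative exp (critical_line t / 2 * of_real (ln pi)) * rGamma (critical_line t / 2) *
     (- (Complex (theta_d1 t) (Im (Digamma (Complex (1/4) (t/2))) / 2)) * of_real (xi_line t) - \<i> * of_real (xi_line_d1 t)))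
     (at (critical_line t))"
proof -
  define s where "s = critical_line t"
  define P where "P = (\<lambda>s::complex. exp (s / 2 * of_real (ln pi)) * rGamma (s / 2))"
  define L where "L = (\<lambda>s::complex. theta_mellin (s - 1/2) - 1 / (s * (1 - s)))"
  have s0: "s \<noteq> 0" "s \<noteq> 1" by (auto simp: s_def complex_eq_iff)
  have sh: "s / 2 = Complex (1/4) (t/2)" by (simp add: s_def complex_eq_iff)
  have ss: "s * (1 - s) = of_real (1/4 + t\<^sup>2)" by (simp add: s_def complex_eq_iff power2_eq_square field_simps)
  have si: "s - 1/2 = \<i> * of_real t" by (simp add: s_def complex_eq_iff)
  have eq: "P w * L w = zeta_cont w" if w01: "w \<noteq> 0" "w \<noteq> 1" for w
  proof -
    have "rGamma (w / 2 + 1) / (2 * (1 - w)) = rGamma (w / 2) / (w * (1 - w))"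
      unfolding rGamma_plus1[of "w / 2", symmetric] using w01 by simp
    thus ?thesis using w01 by (simp add: P_def L_def zeta_cont_def right_diff_distrib)
  qed
  have "open (- {0, 1 :: complex})" by (intro open_Compl finite_imp_closed) auto
  hence ev: "eventually (\<lambda>w. P w * L w = zeta_cont w) (nhds s)"
    by (rule eventually_nhds_in_open[THEN eventually_mono]) (use s0 eq in auto)
  have "((\<lambda>s. rGamma (s / 2)) has_field_derivative - rGamma (s / 2) * Digamma (s / 2) * (1 / 2)) (at s)"
    by (rule DERIV_chain2[where f = rGamma, OF has_field_derivative_rGamma_no_nonpos_int])
       (use quarter_line_not_nonpos sh in \<open>auto intro!: derivative_eq_intros\<close>)
  moreover have "((\<lambda>s. exp (s / 2 * of_real (ln pi))) has_field_derivative exp (s / 2 * of_real (ln pi)) * (of_real (ln pi) / 2)) (at s)"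
    by (auto intro!: derivative_eq_intros)
  ultimately have "(P has_field_derivative exp (s / 2 * of_real (ln pi)) * (of_real (ln pi) / 2) * rGamma (s / 2) +
      - rGamma (s / 2) * Digamma (s / 2) * (1 / 2) * exp (s / 2 * of_real (ln pi))) (at s)"
    unfolding P_def by (intro DERIV_mult)
  moreover have alg: "E * (c / 2) * G + - G * D * (1 / 2) * E = E * G * (c / 2 - D / 2)" for E c G D :: complex
    by (simp add: algebra_simps)
  ultimately have dP: "(P has_field_derivative P s * (of_real (ln pi) / 2 - Digamma (s / 2) / 2)) (at s)"
    by (elim DERIV_cong) (simp only: P_def alg)
  have "((\<lambda>s. theta_mellin (s - 1/2)) has_field_derivative
      (theta.transform 1 (s - 1/2) - theta.transform 1 (- (s - 1/2))) / 2 * 1) (at s)"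
    by (rule DERIV_chain2[where f = theta_mellin, OF theta_mellin_deriv]) (auto intro!: derivative_eq_intros)
  hence d1: "((\<lambda>s. theta_mellin (s - 1/2)) has_field_derivative
      \<i> * of_real (\<integral>u. theta_kernel u * u * sin (t * u) \<partial>lborel)) (at s)"
    unfolding si theta_mellin_line_deriv by simp
  have d2: "((\<lambda>s. 1 / (s * (1 - s))) has_field_derivative - (1 - 2 * s) / (s * (1 - s))\<^sup>2) (at s)"
    using s0 by (auto intro!: derivative_eq_intros simp: power2_eq_square)
  have "1 - 2 * s = - \<i> * of_real (2 * t)" by (simp add: s_def complex_eq_iff)
  hence "- (1 - 2 * s) / (s * (1 - s))\<^sup>2 = \<i> * of_real (2 * t / (1/4 + t\<^sup>2)\<^sup>2)"
    unfolding ss by (simp only: of_real_divide of_real_power) simp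
  with DERIV_diff[OF d1 d2]
  have dL: "(L has_field_derivative - \<i> * of_real (xi_line_d1 t)) (at s)"
    unfolding L_def xi_line_d1_def by (simp only: of_real_diff right_diff_distrib) simp
  have Ls: "L s = of_real (xi_line t)"
    unfolding L_def si theta_mellin_line ss xi_line_def by simp
  have "Digamma (s / 2) / 2 - of_real (ln pi) / 2 = Complex (theta_d1 t) (Im (Digamma (Complex (1/4) (t/2))) / 2)"
    unfolding sh theta_d1_def by (simp add: complex_eq_iff)
  hence G: "of_real (ln pi) / 2 - Digamma (s / 2) / 2 = - Complex (theta_d1 t) (Im (Digamma (Complex (1/4) (t/2))) / 2)"
    by (metis minus_diff_eq)
  have "((\<lambda>w. P w * L w) has_field_derivative
     P s * - Complex (theta_d1 t) (Im (Digamma (Complex (1/4) (t/2))) / 2) * L s + - \<i> * of_real (xi_line_d1 t) * P s) (at s)"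
    using DERIV_mult[OF dP dL] unfolding G .
  moreover have "P s * - Complex (theta_d1 t) (Im (Digamma (Complex (1/4) (t/2))) / 2) * L s + - \<i> * of_real (xi_line_d1 t) * P s
     = P s * (- Complex (theta_d1 t) (Im (Digamma (Complex (1/4) (t/2))) / 2) * of_real (xi_line t) - \<i> * of_real (xi_line_d1 t))"
    unfolding Ls right_diff_distrib by (simp only: mult.assoc mult.commute[of _ "P s"]) simp
  ultimately have "((\<lambda>w. P w * L w) has_field_derivative
     P s * (- Complex (theta_d1 t) (Im (Digamma (Complex (1/4) (t/2))) / 2) * of_real (xi_line t) - \<i> * of_real (xi_line_d1 t))) (at s)"
    by (simp only:)
  hence "(zeta_cont has_field_derivative
     P s * (- Complex (theta_d1 t) (Im (Digamma (Complex (1/4) (t/2))) / 2) * of_real (xi_line t) - \<i> * of_real (xi_line_d1 t))) (at s)"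
    by (rule DERIV_cong_ev[OF refl ev refl, THEN iffD1])
  thus ?thesis unfolding P_def s_def .
qed

lemma critical_line_gamma_factor: "exp (critical_line t / 2 * of_real (ln pi)) * rGamma (critical_line t / 2) \<noteq> 0"
proof -
  have "critical_line t / 2 = Complex (1/4) (t/2)" by (simp add: complex_eq_iff)
  thus ?thesis using quarter_line_not_nonpos by (simp add: rGamma_eq_zero_iff)
qed

lemma zeta_cont_line_eq_0_iff: "zeta_cont (critical_line t) = 0 \<longleftrightarrow> xi_line t = 0"
  unfolding zeta_cont_line[OF refl] using critical_line_gamma_factor[of t] by simp

lemma zeta_cont_line_log_deriv:
  assumes "xi_line t \<noteq> 0"
  shows "deriv zeta_cont (critical_line t) = - Complex (theta_d1 t) (phase_d1 t) * zeta_cont (critical_line t)"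
proof -
  have "- Complex (theta_d1 t) (Im (Digamma (Complex (1/4) (t/2))) / 2) * of_real (xi_line t) - \<i> * of_real (xi_line_d1 t)
     = - Complex (theta_d1 t) (phase_d1 t) * of_real (xi_line t)"
    using assms by (simp add: complex_eq_iff phase_d1_def field_simps)
  thus ?thesis unfolding DERIV_imp_deriv[OF zeta_cont_line_deriv] zeta_cont_line[OF refl]
    by (simp only: mult_ac)
qed

lemma phase_d1_odd: "phase_d1 (- t) = - phase_d1 t"
proof -
  have "xi_line_d1 (- t) = - xi_line_d1 t" by (simp add: xi_line_d1_def)
  thus ?thesis using Digamma_quarter_line_cnj[of t] by (simp add: phase_d1_def xi_line_even)
qed

text \<open>The constant 163/200 = 0.815 separates the Digamma term from the logarithmic derivative
  of Xi.\<close>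

lemma phase_d1_pos:
  assumes t: "6.1 \<le> t" "t \<le> 6.4"
  shows "phase_d1 t > 0"
proof -
  have x: "xi_line t < 0" using xi_line_neg[of t] t by simp
  have "xi_line_d1 t < (163/200) * (- xi_line t)" using xi_line_log_deriv_bound[of t] t by simp
  hence "xi_line_d1 t / xi_line t > - (163/200)" using x by (simp add: field_simps)
  moreover have "Im (Digamma (Complex (1/4) (t/2))) / 2 \<ge> 163/200" using Digamma_quarter_line(1)[of "t/2"] t by simp
  ultimately show ?thesis by (simp add: phase_d1_def)
qed

text \<open>The real and imaginary parts of zeta'/zeta have no common zero. Hence zeta' vanishes on
  the line only at zeros of zeta, so that the phase of \<open>kappa\<close> has no poles.\<close>

lemma theta_d1_zero_phase_d1:
  assumes "theta_d1 t = 0"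
  shows "phase_d1 t \<noteq> 0" "xi_line t \<noteq> 0"
proof -
  obtain t0 where t0: "6.1 < t0" "t0 < 6.4" "\<And>t. 0 \<le> t \<Longrightarrow> theta_d1 t = 0 \<longleftrightarrow> t = t0"
    by (metis theta_d1_zero)
  have "\<bar>t\<bar> = t0" using t0(3)[of "\<bar>t\<bar>"] assms theta_d1_even[of t] by (auto simp: abs_if)
  hence t: "t = t0 \<or> t = - t0" by auto
  show "phase_d1 t \<noteq> 0" using t phase_d1_pos[of t0] t0(1,2) by (auto simp: phase_d1_odd)
  show "xi_line t \<noteq> 0" using xi_line_neg[of t] t t0(1,2) by auto
qed

lemma zeta_cont_line_deriv_eq_0:
  assumes "deriv zeta_cont (critical_line t) = 0"
  shows "zeta_cont (critical_line t) = 0"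
proof (rule ccontr)
  assume nz: "zeta_cont (critical_line t) \<noteq> 0"
  hence x: "xi_line t \<noteq> 0" by (simp add: zeta_cont_line_eq_0_iff)
  hence "Complex (theta_d1 t) (phase_d1 t) = 0"
    using zeta_cont_line_log_deriv[OF x] assms nz by simp
  hence "theta_d1 t = 0" "phase_d1 t = 0" by (auto simp: complex_eq_iff)
  thus False using theta_d1_zero_phase_d1 by blast
qed

definition kappa_phase :: "real \<Rightarrow> complex" where
  "kappa_phase t = 1 + 2 * of_real (theta_d1 t) * (zeta_cont (critical_line t) / deriv zeta_cont (critical_line t))"

lemma kappa_phase_nonzero:
  assumes "xi_line t \<noteq> 0"
  shows "Complex (theta_d1 t) (phase_d1 t) \<noteq> 0"
    and "kappa_phase t = - cnj (Complex (theta_d1 t) (phase_d1 t)) / Complex (theta_d1 t) (phase_d1 t)"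
proof -
  have z: "zeta_cont (critical_line t) \<noteq> 0" using assms by (simp add: zeta_cont_line_eq_0_iff)
  show nz: "Complex (theta_d1 t) (phase_d1 t) \<noteq> 0"
    using theta_d1_zero_phase_d1[of t] by (auto simp: complex_eq_iff)
  have "zeta_cont (critical_line t) / deriv zeta_cont (critical_line t) = - (1 / Complex (theta_d1 t) (phase_d1 t))"
    unfolding zeta_cont_line_log_deriv[OF assms] using z nz by (simp add: field_simps)
  hence "kappa_phase t = (Complex (theta_d1 t) (phase_d1 t) - 2 * of_real (theta_d1 t)) / Complex (theta_d1 t) (phase_d1 t)"
    unfolding kappa_phase_def using nz by (simp only: diff_divide_distrib divide_self) simp
  also have "Complex (theta_d1 t) (phase_d1 t) - 2 * of_real (theta_d1 t) = - cnj (Complex (theta_d1 t) (phase_d1 t))"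
    by (simp add: complex_eq_iff)
  finally show "kappa_phase t = - cnj (Complex (theta_d1 t) (phase_d1 t)) / Complex (theta_d1 t) (phase_d1 t)" .
qed

lemma kappa_phase_zero: "xi_line t = 0 \<Longrightarrow> kappa_phase t = 1"
  by (simp add: kappa_phase_def zeta_cont_line_eq_0_iff)

lemma norm_kappa_phase: "cmod (kappa_phase t) = 1"
proof (cases "xi_line t = 0")
  case False
  thus ?thesis using kappa_phase_nonzero[OF False] by (simp add: norm_divide del: complex_cnj)
qed (simp add: kappa_phase_zero)

lemma kappa_phase_minus: "kappa_phase (- t) = cnj (kappa_phase t)"
proof (cases "xi_line t = 0")
  case False
  hence "xi_line (- t) \<noteq> 0" by (simp add: xi_line_even)
  moreover have "Complex (theta_d1 t) (- phase_d1 t) = cnj (Complex (theta_d1 t) (phase_d1 t))"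
    by (simp add: complex_eq_iff)
  ultimately show ?thesis using kappa_phase_nonzero(2)[OF False] kappa_phase_nonzero(2)[of "- t"]
    by (simp add: theta_d1_even phase_d1_odd)
qed (simp add: kappa_phase_zero xi_line_even)

lemma kappa_phase_eq_1_iff: "kappa_phase t = 1 \<longleftrightarrow> theta_d1 t = 0 \<or> xi_line t = 0"
proof (cases "xi_line t = 0")
  case False
  have "kappa_phase t = 1 \<longleftrightarrow> - cnj (Complex (theta_d1 t) (phase_d1 t)) = Complex (theta_d1 t) (phase_d1 t)"
    unfolding kappa_phase_nonzero(2)[OF False] by (rule right_inverse_eq[OF kappa_phase_nonzero(1)[OF False]])
  also have "\<dots> \<longleftrightarrow> theta_d1 t = 0" by (auto simp: complex_eq_iff)
  finally show ?thesis using False by simp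
qed (simp add: kappa_phase_zero)

lemma kappa_phase_0: "kappa_phase 0 = - 1"
proof -
  have x: "xi_line 0 \<noteq> 0" using xi_line_neg[of 0] by simp
  have p: "phase_d1 0 = 0" using phase_d1_odd[of 0] by simp
  hence "theta_d1 0 \<noteq> 0" using theta_d1_zero_phase_d1[of 0] by blast
  hence "Complex (theta_d1 0) 0 \<noteq> 0" by (simp add: complex_eq_iff)
  thus ?thesis unfolding kappa_phase_nonzero(2)[OF x] p by (simp add: complex_of_real_def[symmetric])
qed

text \<open>A real part is not holomorphic, so the Digamma values at the conjugate points are
  averaged. The strip keeps both arguments in the right half-plane.\<close>

lemma theta_d1_extension:
  obtains D where "D holomorphic_on {w. \<bar>Im w\<bar> < 1/2}" "\<And>t. D (of_real t) = of_real (theta_d1 t)"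
    "\<And>t. (D has_field_derivative of_real (theta_d2 t)) (at (of_real t))"
proof -
  define D where "D = (\<lambda>w. (Digamma (1/4 + \<i> * w / 2) + Digamma (1/4 - \<i> * w / 2)) / 4 - of_real (ln pi) / 2)"
  let ?S = "{w. \<bar>Im w\<bar> < 1/2}"
  have op: "open ?S" by (intro open_Collect_less continuous_intros)
  have nz: "1/4 + \<i> * w / 2 \<notin> \<int>\<^sub>\<le>\<^sub>0 \<and> 1/4 - \<i> * w / 2 \<notin> \<int>\<^sub>\<le>\<^sub>0" if "w \<in> ?S" for w
  proof -
    have "1/4 + \<i> * w / 2 \<notin> \<real>\<^sub>\<le>\<^sub>0" "1/4 - \<i> * w / 2 \<notin> \<real>\<^sub>\<le>\<^sub>0"
      using that by (auto simp: complex_nonpos_Reals_iff)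
    thus ?thesis using nonpos_Ints_subset_nonpos_Reals by blast
  qed
  have dg: "(\<lambda>w. Digamma (h w)) holomorphic_on ?S" if h: "h holomorphic_on ?S" "\<And>w. w \<in> ?S \<Longrightarrow> h w \<notin> \<int>\<^sub>\<le>\<^sub>0" for h
    by (rule holomorphic_on_compose_gen[unfolded o_def, OF h(1) holomorphic_on_Polygamma[of "- \<int>\<^sub>\<le>\<^sub>0"]]) (use h(2) in auto)
  have hol: "D holomorphic_on ?S" unfolding D_def
    by (intro holomorphic_intros dg) (use nz in auto)
  have val: "D (of_real t) = of_real (theta_d1 t)" for t
  proof -
    have eqs: "1/4 + \<i> * of_real t / 2 = Complex (1/4) (t/2)" "1/4 - \<i> * of_real t / 2 = Complex (1/4) (- t/2)"
      by (simp_all add: complex_eq_iff)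
    show ?thesis unfolding D_def eqs Digamma_quarter_line_cnj
      by (simp add: complex_eq_iff theta_d1_def)
  qed
  have "(D has_field_derivative of_real (theta_d2 t)) (at (of_real t))" for t
  proof -
    have d: "(D has_field_derivative deriv D (of_real t)) (at (of_real t))"
      by (rule holomorphic_derivI[OF hol op]) simp
    have "((\<lambda>t. D (of_real t)) has_vector_derivative deriv D (of_real t)) (at t)"
      by (rule has_vector_derivative_real_field[OF d])
    moreover have "((\<lambda>t. D (of_real t)) has_vector_derivative of_real (theta_d2 t)) (at t)"
      unfolding val using theta_d1_deriv[of t] by (intro has_vector_derivative_of_real) (simp add: has_real_derivative_iff_has_vector_derivative)
    ultimately have "deriv D (of_real t) = of_real (theta_d2 t)" by (rule vector_derivative_unique_at)
    thus ?thesis using d by simp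
  qed
  thus thesis using that[of D] hol val by blast
qed

text \<open>By the product rule for 1 + 2 theta' R with R = zeta/zeta'. Where Xi vanishes, R is 0
  with derivative 1/n; where theta' vanishes, R is i/W and only the derivative theta'' of the other
  factor survives.\<close>

lemma kappa_phase_extension:
  obtains Q r where "r > 0" "Q holomorphic_on ball (of_real a) r" "\<And>t. \<bar>t - a\<bar> < r \<Longrightarrow> Q (of_real t) = kappa_phase t"
    "xi_line a = 0 \<Longrightarrow> \<exists>n::nat. n > 0 \<and> deriv Q (of_real a) = 2 * \<i> * of_real (theta_d1 a / of_nat n)"
    "theta_d1 a = 0 \<Longrightarrow> deriv Q (of_real a) = 2 * \<i> * of_real (theta_d2 a / phase_d1 a)"
proof -
  obtain D where D: "D holomorphic_on {w. \<bar>Im w\<bar> < 1/2}" "\<And>t. D (of_real t) = of_real (theta_d1 t)"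
    "\<And>t. (D has_field_derivative of_real (theta_d2 t)) (at (of_real t))" using theta_d1_extension by blast
  let ?a = "critical_line a"
  have "zeta_cont (critical_line 0) \<noteq> 0" using xi_line_neg[of 0] by (simp add: zeta_cont_line_eq_0_iff)
  moreover have "critical_line 0 \<in> - {1}" "?a \<in> - {1}" by (auto simp: complex_eq_iff)
  moreover have "connected (- {1::complex})" by (intro connected_punctured_universe) simp
  ultimately obtain R r where R: "r > 0" "R holomorphic_on ball ?a r"
    "\<And>w. w \<in> ball ?a r \<Longrightarrow> R w = zeta_cont w / deriv zeta_cont w"
    "zeta_cont ?a = 0 \<Longrightarrow> \<exists>n::nat. n > 0 \<and> (R has_field_derivative 1 / of_nat n) (at ?a)"
    using holomorphic_log_deriv_reciprocal[of zeta_cont "- {1}" ?a] zeta_cont_holomorphic zeta_cont_line_deriv_eq_0[of a]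
    by (metis open_Compl closed_singleton)
  define e where "e = min r (1/2)"
  have e: "e > 0" "e \<le> r" "e \<le> 1/2" using R(1) by (auto simp: e_def)
  have cl: "1/2 + \<i> * of_real t = critical_line t" for t by (simp add: complex_eq_iff)
  have im: "1/2 + \<i> * w \<in> ball ?a r" if "w \<in> ball (of_real a) e" for w
  proof -
    have "?a - (1/2 + \<i> * w) = \<i> * (of_real a - w)" by (simp add: complex_eq_iff)
    hence "dist ?a (1/2 + \<i> * w) = dist (of_real a) w" by (simp add: dist_norm norm_mult)
    thus ?thesis using that e by simp
  qed
  have st: "w \<in> {w. \<bar>Im w\<bar> < 1/2}" if "w \<in> ball (of_real a) e" for w
  proof -
    have "\<bar>Im w\<bar> \<le> dist (of_real a) w" using abs_Im_le_cmod[of "of_real a - w"] by (simp add: dist_norm)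
    thus ?thesis using that e by simp
  qed
  define Q where "Q = (\<lambda>w. 1 + 2 * D w * R (1/2 + \<i> * w))"
  have RQ: "(\<lambda>w. R (1/2 + \<i> * w)) holomorphic_on ball (of_real a) e"
    by (rule holomorphic_on_compose_gen[unfolded o_def, OF _ R(2)]) (use im in \<open>auto intro!: holomorphic_intros\<close>)
  have DQ: "D holomorphic_on ball (of_real a) e" by (rule holomorphic_on_subset[OF D(1)]) (use st in auto)
  have Ra: "R ?a = zeta_cont ?a / deriv zeta_cont ?a" using R(1,3) by simp
  have dQ: "deriv Q (of_real a) = 2 * of_real (theta_d2 a) * R ?a + 2 * of_real (theta_d1 a) * (d * \<i>)"
    if d: "(R has_field_derivative d) (at ?a)" for d
  proof (rule DERIV_imp_deriv)
    have "((\<lambda>w. R (1/2 + \<i> * w)) has_field_derivative d * \<i>) (at (of_real a))"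
      by (rule DERIV_chain2[where f = R]) (use d cl in \<open>auto intro!: derivative_eq_intros\<close>)
    thus "(Q has_field_derivative 2 * of_real (theta_d2 a) * R ?a + 2 * of_real (theta_d1 a) * (d * \<i>)) (at (of_real a))"
      unfolding Q_def by (auto intro!: derivative_eq_intros D(3) simp: D(2) cl)
  qed
  show thesis
  proof (rule that[of e Q])
    show "Q holomorphic_on ball (of_real a) e" unfolding Q_def by (intro holomorphic_intros DQ RQ)
    fix t assume t: "\<bar>t - a\<bar> < e"
    hence "of_real t \<in> ball (complex_of_real a) e" by (simp add: dist_of_real dist_real_def abs_minus_commute)
    from R(3)[OF im[OF this]] show "Q (of_real t) = kappa_phase t"
      unfolding Q_def kappa_phase_def D(2) cl by simp
  next
    assume x: "xi_line a = 0"
    hence z: "zeta_cont ?a = 0" by (simp add: zeta_cont_line_eq_0_iff)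
    then obtain n :: nat where n: "n > 0" "(R has_field_derivative 1 / of_nat n) (at ?a)" using R(4) by blast
    have "deriv Q (of_real a) = 2 * \<i> * of_real (theta_d1 a / of_nat n)"
      unfolding dQ[OF n(2)] Ra z by simp
    thus "\<exists>n::nat. n > 0 \<and> deriv Q (of_real a) = 2 * \<i> * of_real (theta_d1 a / of_nat n)" using n(1) by blast
  next
    assume th: "theta_d1 a = 0"
    have x: "xi_line a \<noteq> 0" "phase_d1 a \<noteq> 0" using theta_d1_zero_phase_d1[OF th] by auto
    have z: "zeta_cont ?a \<noteq> 0" using x by (simp add: zeta_cont_line_eq_0_iff)
    have d: "(R has_field_derivative deriv R ?a) (at ?a)" by (rule holomorphic_derivI[OF R(2)]) (use R(1) in auto)
    have "Complex 0 (phase_d1 a) = \<i> * of_real (phase_d1 a)" by (simp add: complex_eq_iff)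
    hence "R ?a = \<i> / of_real (phase_d1 a)"
      unfolding Ra zeta_cont_line_log_deriv[OF x(1)] th using z x(2) by (simp add: field_simps)
    thus "deriv Q (of_real a) = 2 * \<i> * of_real (theta_d2 a / phase_d1 a)"
      unfolding dQ[OF d] th by simp
  qed (rule e)
qed

section \<open>Existence, uniqueness and upward crossings of \<open>kappa\<close>\<close>

lemma kappa_facts:
  shows kappa_real_analytic: "real_analytic kappa"
    and kappa_0: "kappa 0 = - 1/2"
    and exp_kappa: "exp (2 * of_real pi * \<i> * of_real (kappa t)) = kappa_phase t"
    and kappa_deriv_pos: "a \<ge> 0 \<Longrightarrow> kappa_phase a = 1 \<Longrightarrow> \<exists>d>0. (kappa has_real_derivative d) (at a)"
proof -
  have q0: "kappa_phase 0 = exp (2 * of_real pi * \<i> * of_real (- 1/2))"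
    using exp_minus[of "\<i> * pi"] by (simp add: kappa_phase_0 mult_ac)
  have loc: "\<exists>Q r. r > 0 \<and> Q holomorphic_on ball (of_real a) r \<and> (\<forall>t. \<bar>t - a\<bar> < r \<longrightarrow> Q (of_real t) = kappa_phase t)" for a
    by (rule kappa_phase_extension[of a]) blast
  obtain \<kappa> where k: "real_analytic \<kappa>" "\<kappa> 0 = - 1/2" "\<And>t. exp (2 * of_real pi * \<i> * of_real (\<kappa> t)) = kappa_phase t"
    and kd: "\<And>Q r a. r > 0 \<Longrightarrow> Q holomorphic_on ball (of_real a) r \<Longrightarrow> (\<And>t. \<bar>t - a\<bar> < r \<Longrightarrow> Q (of_real t) = kappa_phase t) \<Longrightarrow>
       (\<kappa> has_real_derivative Re (deriv Q (of_real a) / (2 * of_real pi * \<i> * kappa_phase a))) (at a)"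
    using analytic_phase[OF loc norm_kappa_phase q0] by blast
  have "kappa = \<kappa>"
    unfolding kappa_def riemann_zeta_eq deriv_rs_theta kappa_phase_def[symmetric]
  proof (rule the_equality)
    fix f assume f: "real_analytic f \<and> f 0 = - 1/2 \<and> (\<forall>t. exp (2 * of_real pi * \<i> * of_real (f t)) = kappa_phase t)"
    show "f = \<kappa>"
    proof
      fix t
      have "2 * pi * f t - 2 * pi * \<kappa> t = 2 * pi * f 0 - 2 * pi * \<kappa> 0"
      proof (rule continuous_phase_unique_on[of UNIV])
        show "continuous_on UNIV (\<lambda>t. 2 * pi * f t)" "continuous_on UNIV (\<lambda>t. 2 * pi * \<kappa> t)"
          using f k(1) real_analytic_imp_continuous by (blast intro: continuous_on_mult_left)+
        fix t
        have "\<i> * of_real (2 * pi * g t) = 2 * of_real pi * \<i> * of_real (g t)" for g :: "real \<Rightarrow> real" by simp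
        thus "exp (\<i> * of_real (2 * pi * f t)) = exp (\<i> * of_real (2 * pi * \<kappa> t))"
          using f k(3)[of t] by metis
      qed auto
      thus "f t = \<kappa> t" using f k(2) by simp
    qed
  qed (use k in blast)
  note kappa = this
  show "real_analytic kappa" "kappa 0 = - 1/2" "exp (2 * of_real pi * \<i> * of_real (kappa t)) = kappa_phase t"
    unfolding kappa using k by auto
  assume a: "a \<ge> 0" "kappa_phase a = 1"
  obtain t0 where t0: "6.1 < t0" "t0 < 6.4" "\<And>t. 0 \<le> t \<Longrightarrow> theta_d1 t = 0 \<longleftrightarrow> t = t0" "\<And>t. t > t0 \<Longrightarrow> theta_d1 t > 0"
    by (metis theta_d1_zero)
  obtain Q r where Q: "r > 0" "Q holomorphic_on ball (of_real a) r" "\<And>t. \<bar>t - a\<bar> < r \<Longrightarrow> Q (of_real t) = kappa_phase t"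
    "xi_line a = 0 \<Longrightarrow> \<exists>n::nat. n > 0 \<and> deriv Q (of_real a) = 2 * \<i> * of_real (theta_d1 a / of_nat n)"
    "theta_d1 a = 0 \<Longrightarrow> deriv Q (of_real a) = 2 * \<i> * of_real (theta_d2 a / phase_d1 a)"
    by (rule kappa_phase_extension[of a]) (rule that; assumption | simp)
  have "\<exists>c>0. deriv Q (of_real a) = 2 * \<i> * of_real c"
  proof (cases "xi_line a = 0")
    case True
    then obtain n :: nat where n: "n > 0" "deriv Q (of_real a) = 2 * \<i> * of_real (theta_d1 a / of_nat n)" using Q(4) by blast
    \<comment> \<open>Every zero of Xi lies beyond the bracket of t0, in the range where theta' is
      positive.\<close>
    have "a > 6.4" using True xi_line_neg[of a] a(1) by (cases "a \<le> 6.4") auto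
    hence "theta_d1 a / of_nat n > 0" using t0(2,4) n(1) by simp
    thus ?thesis using n(2) by blast
  next
    case False
    hence th: "theta_d1 a = 0" using a(2) kappa_phase_eq_1_iff by blast
    hence "a = t0" using t0(3)[OF a(1)] by simp
    hence "theta_d2 a / phase_d1 a > 0" using theta_d2_pos[of a] phase_d1_pos[of a] t0(1,2) by simp
    thus ?thesis using Q(5)[OF th] by blast
  qed
  then obtain c where c: "c > 0" "deriv Q (of_real a) = 2 * \<i> * of_real c" by blast
  have "Re (deriv Q (of_real a) / (2 * of_real pi * \<i> * kappa_phase a)) = c / pi"
    unfolding c(2) a(2) by (simp add: Re_divide power2_eq_square)
  hence "(kappa has_real_derivative c / pi) (at a)" using kd[OF Q(1-3)] unfolding kappa by simp
  thus "\<exists>d>0. (kappa has_real_derivative d) (at a)" using c(1) by (intro exI[of _ "c / pi"]) simp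
qed

lemma kappa_Ints_iff: "kappa t \<in> \<int> \<longleftrightarrow> kappa_phase t = 1"
proof -
  have "kappa_phase t = exp (\<i> * of_real (2 * pi * kappa t))" by (simp add: exp_kappa[symmetric] mult_ac)
  hence "kappa_phase t = cis (2 * pi * kappa t)" by (simp add: cis_conv_exp)
  thus ?thesis by (auto simp: complex_eq_iff cos_one_2pi_int elim!: Ints_cases)
qed

text \<open>The phase at - t is the conjugate of the phase at t, so kappa(- t) and - kappa(t) differ
  by a constant, namely 2 kappa(0) = -1.\<close>

lemma kappa_reflect: "kappa (- t) = - 1 - kappa t"
proof -
  have c: "continuous_on UNIV kappa" by (rule real_analytic_imp_continuous[OF kappa_real_analytic])
  have e: "\<i> * of_real (2 * pi * x) = 2 * of_real pi * \<i> * of_real x" for x :: real by simp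
  have "2 * pi * kappa (- t) - - (2 * pi * kappa t) = 2 * pi * kappa (- 0) - - (2 * pi * kappa 0)"
  proof (rule continuous_phase_unique_on[of UNIV])
    show "continuous_on UNIV (\<lambda>t. 2 * pi * kappa (- t))"
      by (intro continuous_on_mult_left continuous_on_compose2[OF c continuous_on_minus[OF continuous_on_id]]) auto
    show "continuous_on UNIV (\<lambda>t. - (2 * pi * kappa t))" by (intro continuous_intros c)
    fix t
    have "exp (\<i> * of_real (- (2 * pi * kappa t))) = cnj (exp (\<i> * of_real (2 * pi * kappa t)))"
      by (simp add: exp_cnj)
    also have "\<dots> = kappa_phase (- t)" unfolding e exp_kappa kappa_phase_minus ..
    finally show "exp (\<i> * of_real (2 * pi * kappa (- t))) = exp (\<i> * of_real (- (2 * pi * kappa t)))"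
      unfolding e exp_kappa by simp
  qed auto
  hence "2 * pi * (kappa (- t) + kappa t + 1) = 0" by (simp add: kappa_0 algebra_simps)
  thus ?thesis by (simp add: add_eq_0_iff)
qed

theorem corollary19:
  fixes n :: nat
  assumes "n \<ge> 1"
  shows "kappa (xi n) = real n \<and> (\<forall>t::real. kappa t = real n \<longrightarrow> t = xi n)"
proof -
  obtain t0 where t0: "6.1 < t0" "t0 < 6.4" "\<And>t. 0 \<le> t \<Longrightarrow> theta_d1 t = 0 \<longleftrightarrow> t = t0"
    by (metis theta_d1_zero)
  have crit: "critical_ordinates = {t. t > 0 \<and> xi_line t = 0}"
    by (simp add: critical_ordinates_def riemann_zeta_eq zeta_cont_line_eq_0_iff)
  show ?thesis unfolding xi_def
  proof (rule integer_points_enumerate[where ?t0.0 = t0])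
    show "continuous_on UNIV kappa" by (rule real_analytic_imp_continuous[OF kappa_real_analytic])
    show "\<exists>d>0. (kappa has_real_derivative d) (at t)" if "t \<ge> 0" "kappa t \<in> \<int>" for t
      using kappa_deriv_pos that kappa_Ints_iff by blast
    show "kappa t \<in> \<int> \<longleftrightarrow> t = t0 \<or> t \<in> critical_ordinates" if "t \<ge> 0" for t
    proof -
      have "t > 0" if "xi_line t = 0" using that xi_line_neg[of t] \<open>t \<ge> 0\<close> by (cases "t = 0") auto
      thus ?thesis using t0(3)[OF that] by (auto simp: kappa_Ints_iff kappa_phase_eq_1_iff crit)
    qed
    show "t0 < t" if "t \<in> critical_ordinates" for t
      using that xi_line_neg[of t] t0(2) by (cases "t \<le> 6.4") (auto simp: crit)
    show "infinite critical_ordinates" unfolding crit by (rule infinite_xi_line_zeros)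
  qed (use t0 assms kappa_0 kappa_reflect in auto)
qed

end
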